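(* Let $\mathcal C$ be a triangulated category endowed with a weight structure $w$ with heart $\underline{Hw}$. 1. Let $A:\underline{Hw}\to\mathcal A$ be an additive functor, where $\mathcal A$ is an abelian category, and assume that the following conditions are fulfilled: (i) the image of $A$ consists of projective objects of $\mathcal A$ only; (ii) if an $\underline{Hw}$-morphism $h$ is not split surjective (i.e., it is not a retraction) then $A(h)$ is not split surjective as well. Then for any $M\in\mathrm{Obj}\,\mathcal C$, $n\in\mathbb Z$, and $H=H^A$ we have: $M$ is $w$-bounded below and $H_i(M)=0$ for all $i<n$ if and only if $M\in\mathcal C_{w\ge n}$. 2. Assume that $\underline{Hw}$ is an $R$-linear category, where $R$ is a commutative unital ring, $\mathcal H$ is a full small subcategory of $\underline{Hw}$, $\mathcal A$ is the category of $R$-linear functors from $\mathcal H^{op}$ into the category of $R$-modules, and $A:\underline{Hw}\to\mathcal A$ is the corresponding Yoneda-type functor, i.e., for any $M\in\mathrm{Obj}\,\underline{Hw}$ the functor $A(M)$ sends $N\in\mathrm{Obj}\,\mathcal H$ into the $R$-module $\underline{Hw}(N,M)$; suppose in addition that the image of $A$ is contained in the coproductive hull in $\mathcal A$ of the image of the restriction of $A$ to $\mathcal H$. Then $A$ fulfils condition (i) of assertion 1. 3. Assume that $A:\underline{Hw}\to\mathcal A$ (an additive functor into an abelian category) is full and conservative. Then it fulfils condition (ii) of assertion 1.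
   Context: A weight structure $w$ on a triangulated category $\mathcal C$ (homological convention) is a pair of classes $\mathcal C_{w\le 0},\mathcal C_{w\ge 0}\subset \mathrm{Obj}\,\mathcal C$ such that: (i) both are closed under retracts in $\mathcal C$; (ii) $\mathcal C_{w\le 0}\subset\mathcal C_{w\le 0}[1]$ and $\mathcal C_{w\ge 0}[1]\subset\mathcal C_{w\ge 0}$; (iii) $\mathcal C(X,Y)=0$ for all $X\in\mathcal C_{w\le 0}$, $Y\in\mathcal C_{w\ge 0}[1]$; (iv) every $M\in\mathrm{Obj}\,\mathcal C$ fits in a distinguished triangle $LM\to M\to RM\to LM[1]$ with $LM\in\mathcal C_{w\le 0}$, $RM\in\mathcal C_{w\ge 0}[1]$. Notation: $\mathcal C_{w\ge i}=\mathcal C_{w\ge 0}[i]$, $\mathcal C_{w\le i}=\mathcal C_{w\le 0}[i]$; the heart $\underline{Hw}$ is the full subcategory with object class $\mathcal C_{w=0}=\mathcal C_{w\ge 0}\cap\mathcal C_{w\le 0}$. $M$ is $w$-bounded below if $M\in\bigcup_i\mathcal C_{w\ge i}$. Weight complexes. For $M\in\mathrm{Obj}\,\mathcal C$ choose for every $i\in\mathbb Z$ a distinguished triangle $w_{\le i}M\xrightarrow{h_i}M\to w_{\ge i+1}M\to w_{\le i}M[1]$ with $w_{\le i}M\in\mathcal C_{w\le i}$, $w_{\ge i+1}M\in\mathcal C_{w\ge i+1}$. There are unique $j_i:w_{\le i}M\to w_{\le i+1}M$ with $h_{i+1}\circ j_i=h_i$. Complete them to distinguished triangles $w_{\le i-1}M\xrightarrow{j_{i-1}}w_{\le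 i}M\xrightarrow{c_i}M_i\xrightarrow{e_{i-1}}w_{\le i-1}M[1]$. Put $M^p=M_{-p}[p]\in\mathcal C_{w=0}$ and $d^i=c_{-i-1}[i+1]\circ e_{-i-1}[i]:M^i\to M^{i+1}$. The complex $t(M)=(M^i,d^i)$ over $\underline{Hw}$ is (a choice of) a weight complex of $M$. For an additive functor $A:\underline{Hw}\to\mathcal A$, $H^A:\mathcal C\to\mathcal A$ is the homological functor sending $M$ to the zeroth homology of the complex $(A(M^j))$ (independent of the choice of $t(M)=(M^j)$). For a homological functor $H$ put $H_i=H\circ[-i]$. The coproductive hull of a subcategory $\mathcal H$ in an additive category $\mathcal B$ is the full additive subcategory of $\mathcal B$ whose objects are the retracts of all (small) coproducts of objects of $\mathcal H$ that exist in $\mathcal B$. *)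

theory Defs
  imports "HOL-Algebra.Module"
begin

section \<open>Additive and abelian categories\<close>

text \<open>Hom-sets are pairwise disjoint, since every arrow carries its domain and codomain.\<close>

record ('o, 'm) acat =
  Obj :: "'o set"
  Arr :: "'m set"
  Dom :: "'m \<Rightarrow> 'o"
  Cod :: "'m \<Rightarrow> 'o"
  Ident :: "'o \<Rightarrow> 'm"
  Comp :: "'m \<Rightarrow> 'm \<Rightarrow> 'm"  (infixr \<open>\<cdot>\<index>\<close> 75)
  Plus :: "'m \<Rightarrow> 'm \<Rightarrow> 'm"
  Null :: "'o \<Rightarrow> 'o \<Rightarrow> 'm"

definition Hom :: "('o, 'm, 'x) acat_scheme \<Rightarrow> 'o \<Rightarrow> 'o \<Rightarrow> 'm set" where
  "Hom C X Y = {f \<in> Arr C. Dom C f = X \<and> Cod C f = Y}"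

definition hom_group :: "('o, 'm, 'x) acat_scheme \<Rightarrow> 'o \<Rightarrow> 'o \<Rightarrow> 'm monoid" where
  "hom_group C X Y = \<lparr>carrier = Hom C X Y, monoid.mult = Plus C, one = Null C X Y\<rparr>"

definition Neg :: "('o, 'm, 'x) acat_scheme \<Rightarrow> 'm \<Rightarrow> 'm" where
  "Neg C f = m_inv (hom_group C (Dom C f) (Cod C f)) f"

locale category =
  fixes C :: "('o, 'm, 'x) acat_scheme" (structure)
  assumes Dom_closed: "f \<in> Arr C \<Longrightarrow> Dom C f \<in> Obj C"
    and Cod_closed: "f \<in> Arr C \<Longrightarrow> Cod C f \<in> Obj C"
    and Ident_closed: "X \<in> Obj C \<Longrightarrow> Ident C X \<in> Hom C X X"
    and Comp_closed: "f \<in> Hom C X Y \<Longrightarrow> g \<in> Hom C Y Z \<Longrightarrow> g \<cdot> f \<in> Hom C X Z"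
    and Ident_left: "f \<in> Hom C X Y \<Longrightarrow> Ident C Y \<cdot> f = f"
    and Ident_right: "f \<in> Hom C X Y \<Longrightarrow> f \<cdot> Ident C X = f"
    and Comp_assoc: "f \<in> Hom C X Y \<Longrightarrow> g \<in> Hom C Y Z \<Longrightarrow> h \<in> Hom C Z V \<Longrightarrow>
      (h \<cdot> g) \<cdot> f = h \<cdot> (g \<cdot> f)"

locale preadditive_category = category +
  assumes Hom_group: "X \<in> Obj C \<Longrightarrow> Y \<in> Obj C \<Longrightarrow> comm_group (hom_group C X Y)"
    and Comp_Plus_left: "f \<in> Hom C X Y \<Longrightarrow> g \<in> Hom C Y Z \<Longrightarrow> g' \<in> Hom C Y Z \<Longrightarrow>
      Plus C g g' \<cdot> f = Plus C (g \<cdot> f) (g' \<cdot> f)"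
    and Comp_Plus_right: "f \<in> Hom C X Y \<Longrightarrow> f' \<in> Hom C X Y \<Longrightarrow> g \<in> Hom C Y Z \<Longrightarrow>
      g \<cdot> Plus C f f' = Plus C (g \<cdot> f) (g \<cdot> f')"

definition is_zero_object :: "('o, 'm, 'x) acat_scheme \<Rightarrow> 'o \<Rightarrow> bool" where
  "is_zero_object C Z \<longleftrightarrow> Z \<in> Obj C \<and>
     (\<forall>X\<in>Obj C. (\<exists>!f. f \<in> Hom C X Z) \<and> (\<exists>!f. f \<in> Hom C Z X))"

definition is_biproduct ::
    "('o, 'm, 'x) acat_scheme \<Rightarrow> 'o \<Rightarrow> 'o \<Rightarrow> 'o \<Rightarrow> 'm \<Rightarrow> 'm \<Rightarrow> 'm \<Rightarrow> 'm \<Rightarrow> bool" where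
  "is_biproduct C X Y S i\<^sub>1 i\<^sub>2 p\<^sub>1 p\<^sub>2 \<longleftrightarrow> S \<in> Obj C \<and>
     i\<^sub>1 \<in> Hom C X S \<and> i\<^sub>2 \<in> Hom C Y S \<and> p\<^sub>1 \<in> Hom C S X \<and> p\<^sub>2 \<in> Hom C S Y \<and>
     p\<^sub>1 \<cdot>\<^bsub>C\<^esub> i\<^sub>1 = Ident C X \<and> p\<^sub>2 \<cdot>\<^bsub>C\<^esub> i\<^sub>2 = Ident C Y \<and>
     p\<^sub>2 \<cdot>\<^bsub>C\<^esub> i\<^sub>1 = Null C X Y \<and> p\<^sub>1 \<cdot>\<^bsub>C\<^esub> i\<^sub>2 = Null C Y X \<and>
     Plus C (i\<^sub>1 \<cdot>\<^bsub>C\<^esub> p\<^sub>1) (i\<^sub>2 \<cdot>\<^bsub>C\<^esub> p\<^sub>2) = Ident C S"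

locale additive_category = preadditive_category +
  assumes zero_object_exists: "\<exists>Z. is_zero_object C Z"
    and biproduct_exists: "X \<in> Obj C \<Longrightarrow> Y \<in> Obj C \<Longrightarrow>
      \<exists>S i\<^sub>1 i\<^sub>2 p\<^sub>1 p\<^sub>2. is_biproduct C X Y S i\<^sub>1 i\<^sub>2 p\<^sub>1 p\<^sub>2"

definition is_mono :: "('o, 'm, 'x) acat_scheme \<Rightarrow> 'm \<Rightarrow> bool" where
  "is_mono C f \<longleftrightarrow> f \<in> Arr C \<and>
     (\<forall>X. \<forall>g\<in>Hom C X (Dom C f). \<forall>h\<in>Hom C X (Dom C f). f \<cdot>\<^bsub>C\<^esub> g = f \<cdot>\<^bsub>C\<^esub> h \<longrightarrow> g = h)"

definition is_epi :: "('o, 'm, 'x) acat_scheme \<Rightarrow> 'm \<Rightarrow> bool" where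
  "is_epi C f \<longleftrightarrow> f \<in> Arr C \<and>
     (\<forall>X. \<forall>g\<in>Hom C (Cod C f) X. \<forall>h\<in>Hom C (Cod C f) X. g \<cdot>\<^bsub>C\<^esub> f = h \<cdot>\<^bsub>C\<^esub> f \<longrightarrow> g = h)"

definition is_iso :: "('o, 'm, 'x) acat_scheme \<Rightarrow> 'm \<Rightarrow> bool" where
  "is_iso C f \<longleftrightarrow> f \<in> Arr C \<and>
     (\<exists>g\<in>Hom C (Cod C f) (Dom C f). g \<cdot>\<^bsub>C\<^esub> f = Ident C (Dom C f) \<and> f \<cdot>\<^bsub>C\<^esub> g = Ident C (Cod C f))"

definition is_split_surjective :: "('o, 'm, 'x) acat_scheme \<Rightarrow> 'm \<Rightarrow> bool" where
  "is_split_surjective C f \<longleftrightarrow> f \<in> Arr C \<and>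
     (\<exists>s\<in>Hom C (Cod C f) (Dom C f). f \<cdot>\<^bsub>C\<^esub> s = Ident C (Cod C f))"

definition is_retract_of :: "('o, 'm, 'x) acat_scheme \<Rightarrow> 'o \<Rightarrow> 'o \<Rightarrow> bool" where
  "is_retract_of C X Y \<longleftrightarrow> X \<in> Obj C \<and> Y \<in> Obj C \<and>
     (\<exists>i\<in>Hom C X Y. \<exists>r\<in>Hom C Y X. r \<cdot>\<^bsub>C\<^esub> i = Ident C X)"

definition is_kernel :: "('o, 'm, 'x) acat_scheme \<Rightarrow> 'm \<Rightarrow> 'm \<Rightarrow> bool" where
  "is_kernel C f k \<longleftrightarrow> f \<in> Arr C \<and> k \<in> Arr C \<and> Cod C k = Dom C f \<and>
     f \<cdot>\<^bsub>C\<^esub> k = Null C (Dom C k) (Cod C f) \<and>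
     (\<forall>X. \<forall>g\<in>Hom C X (Dom C f). f \<cdot>\<^bsub>C\<^esub> g = Null C X (Cod C f) \<longrightarrow>
        (\<exists>!u. u \<in> Hom C X (Dom C k) \<and> k \<cdot>\<^bsub>C\<^esub> u = g))"

definition is_cokernel :: "('o, 'm, 'x) acat_scheme \<Rightarrow> 'm \<Rightarrow> 'm \<Rightarrow> bool" where
  "is_cokernel C f q \<longleftrightarrow> f \<in> Arr C \<and> q \<in> Arr C \<and> Dom C q = Cod C f \<and>
     q \<cdot>\<^bsub>C\<^esub> f = Null C (Dom C f) (Cod C q) \<and>
     (\<forall>X. \<forall>g\<in>Hom C (Cod C f) X. g \<cdot>\<^bsub>C\<^esub> f = Null C (Dom C f) X \<longrightarrow>
        (\<exists>!u. u \<in> Hom C (Cod C q) X \<and> u \<cdot>\<^bsub>C\<^esub> q = g))"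

locale abelian_category = additive_category +
  assumes kernel_exists: "f \<in> Arr C \<Longrightarrow> \<exists>k. is_kernel C f k"
    and cokernel_exists: "f \<in> Arr C \<Longrightarrow> \<exists>q. is_cokernel C f q"
    and mono_is_kernel: "is_mono C f \<Longrightarrow> \<exists>g. is_kernel C g f"
    and epi_is_cokernel: "is_epi C f \<Longrightarrow> \<exists>g. is_cokernel C g f"

definition is_projective :: "('o, 'm, 'x) acat_scheme \<Rightarrow> 'o \<Rightarrow> bool" where
  "is_projective C P \<longleftrightarrow> P \<in> Obj C \<and>
     (\<forall>e. is_epi C e \<longrightarrow>
        (\<forall>f\<in>Hom C P (Cod C e). \<exists>g\<in>Hom C P (Dom C e). e \<cdot>\<^bsub>C\<^esub> g = f))"

text \<open>\<open>K\<close> is the homology of \<open>X \<rightarrow> Y \<rightarrow> Z\<close> (arrows \<open>f\<close>, \<open>g\<close>) at \<open>Y\<close>: the cokernel of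
  the factorization \<open>u\<close> of \<open>f\<close> through the kernel of \<open>g\<close>.\<close>

definition is_homology :: "('o, 'm, 'x) acat_scheme \<Rightarrow> 'm \<Rightarrow> 'm \<Rightarrow> 'o \<Rightarrow> bool" where
  "is_homology C f g K \<longleftrightarrow>
     (\<exists>k u q. is_kernel C g k \<and> u \<in> Hom C (Dom C f) (Dom C k) \<and> k \<cdot>\<^bsub>C\<^esub> u = f \<and>
        is_cokernel C u q \<and> Cod C q = K)"

definition is_coproduct ::
    "('o, 'm, 'x) acat_scheme \<Rightarrow> 'i set \<Rightarrow> ('i \<Rightarrow> 'o) \<Rightarrow> 'o \<Rightarrow> ('i \<Rightarrow> 'm) \<Rightarrow> bool" where
  "is_coproduct C I X Q \<iota> \<longleftrightarrow> Q \<in> Obj C \<and> (\<forall>i\<in>I. X i \<in> Obj C \<and> \<iota> i \<in> Hom C (X i) Q) \<and>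
     (\<forall>Y\<in>Obj C. \<forall>g. (\<forall>i\<in>I. g i \<in> Hom C (X i) Y) \<longrightarrow>
        (\<exists>!u. u \<in> Hom C Q Y \<and> (\<forall>i\<in>I. u \<cdot>\<^bsub>C\<^esub> \<iota> i = g i)))"

definition full_subcat :: "('o, 'm, 'x) acat_scheme \<Rightarrow> 'o set \<Rightarrow> ('o, 'm) acat" where
  "full_subcat C S =
     \<lparr>Obj = S, Arr = {f \<in> Arr C. Dom C f \<in> S \<and> Cod C f \<in> S}, Dom = Dom C, Cod = Cod C,
      Ident = Ident C, Comp = Comp C, Plus = Plus C, Null = Null C\<rparr>"

definition op_cat :: "('o, 'm, 'x) acat_scheme \<Rightarrow> ('o, 'm) acat" where
  "op_cat C =
     \<lparr>Obj = Obj C, Arr = Arr C, Dom = Cod C, Cod = Dom C, Ident = Ident C,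
      Comp = (\<lambda>g f. f \<cdot>\<^bsub>C\<^esub> g), Plus = Plus C, Null = (\<lambda>X Y. Null C Y X)\<rparr>"

text \<open>The type \<^typ>\<open>'v\<close> plays the role of the universe: a set is small if it is in bijection with
  a set of elements of \<^typ>\<open>'v\<close>. Small coproducts are thus indexed by sets of type
  \<^typ>\<open>'v set\<close>.\<close>

definition small :: "'v itself \<Rightarrow> 'a set \<Rightarrow> bool" where
  "small _ S \<longleftrightarrow> (\<exists>f :: 'a \<Rightarrow> 'v. inj_on f S)"

definition coproductive_hull ::
    "'v itself \<Rightarrow> ('o, 'm, 'x) acat_scheme \<Rightarrow> 'o set \<Rightarrow> ('o, 'm) acat" where
  "coproductive_hull _ B S = full_subcat B
     {P. \<exists>(I :: 'v set) X Q \<iota>. X ` I \<subseteq> S \<and> is_coproduct B I X Q \<iota> \<and> is_retract_of B P Q}"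


section \<open>Functors\<close>

record ('o, 'm, 'p, 'n) cfun =
  OMap :: "'o \<Rightarrow> 'p"
  MMap :: "'m \<Rightarrow> 'n"

definition is_functor ::
    "('o, 'm, 'x) acat_scheme \<Rightarrow> ('p, 'n, 'y) acat_scheme \<Rightarrow> ('o, 'm, 'p, 'n) cfun \<Rightarrow> bool" where
  "is_functor C D F \<longleftrightarrow>
     (\<forall>X\<in>Obj C. OMap F X \<in> Obj D \<and> MMap F (Ident C X) = Ident D (OMap F X)) \<and>
     (\<forall>X Y. \<forall>f\<in>Hom C X Y. MMap F f \<in> Hom D (OMap F X) (OMap F Y)) \<and>
     (\<forall>X Y Z. \<forall>f\<in>Hom C X Y. \<forall>g\<in>Hom C Y Z. MMap F (g \<cdot>\<^bsub>C\<^esub> f) = MMap F g \<cdot>\<^bsub>D\<^esub> MMap F f)"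

definition is_additive_functor ::
    "('o, 'm, 'x) acat_scheme \<Rightarrow> ('p, 'n, 'y) acat_scheme \<Rightarrow> ('o, 'm, 'p, 'n) cfun \<Rightarrow> bool" where
  "is_additive_functor C D F \<longleftrightarrow> is_functor C D F \<and>
     (\<forall>X Y. \<forall>f\<in>Hom C X Y. \<forall>g\<in>Hom C X Y. MMap F (Plus C f g) = Plus D (MMap F f) (MMap F g))"

definition is_full ::
    "('o, 'm, 'x) acat_scheme \<Rightarrow> ('p, 'n, 'y) acat_scheme \<Rightarrow> ('o, 'm, 'p, 'n) cfun \<Rightarrow> bool" where
  "is_full C D F \<longleftrightarrow>
     (\<forall>X\<in>Obj C. \<forall>Y\<in>Obj C. \<forall>g\<in>Hom D (OMap F X) (OMap F Y). \<exists>f\<in>Hom C X Y. MMap F f = g)"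

definition is_conservative ::
    "('o, 'm, 'x) acat_scheme \<Rightarrow> ('p, 'n, 'y) acat_scheme \<Rightarrow> ('o, 'm, 'p, 'n) cfun \<Rightarrow> bool" where
  "is_conservative C D F \<longleftrightarrow> (\<forall>f\<in>Arr C. is_iso D (MMap F f) \<longrightarrow> is_iso C f)"

definition has_projective_image ::
    "('o, 'm, 'x) acat_scheme \<Rightarrow> ('p, 'n, 'y) acat_scheme \<Rightarrow> ('o, 'm, 'p, 'n) cfun \<Rightarrow> bool" where
  "has_projective_image C D F \<longleftrightarrow> (\<forall>X\<in>Obj C. is_projective D (OMap F X))"

definition preserves_non_split_surjectivity ::
    "('o, 'm, 'x) acat_scheme \<Rightarrow> ('p, 'n, 'y) acat_scheme \<Rightarrow> ('o, 'm, 'p, 'n) cfun \<Rightarrow> bool" where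
  "preserves_non_split_surjectivity C D F \<longleftrightarrow>
     (\<forall>h\<in>Arr C. \<not> is_split_surjective C h \<longrightarrow> \<not> is_split_surjective D (MMap F h))"


section \<open>Triangulated categories\<close>

text \<open>The translation \<open>[1]\<close> is an automorphism of the category; its integral powers
  \<open>[i]\<close> are recorded as \<open>Sh C i\<close> on objects and \<open>ShM C i\<close> on arrows. \<open>Tri C\<close> consists of the
  triples of arrows of the distinguished triangles.\<close>

record ('o, 'm) tcat = "('o, 'm) acat" +
  Sh :: "int \<Rightarrow> 'o \<Rightarrow> 'o"
  ShM :: "int \<Rightarrow> 'm \<Rightarrow> 'm"
  Tri :: "('m \<times> 'm \<times> 'm) set"

definition triangle ::
    "('o, 'm, 'x) tcat_scheme \<Rightarrow> 'o \<Rightarrow> 'o \<Rightarrow> 'o \<Rightarrow> 'm \<Rightarrow> 'm \<Rightarrow> 'm \<Rightarrow> bool" where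
  "triangle C X Y Z f g h \<longleftrightarrow> f \<in> Hom C X Y \<and> g \<in> Hom C Y Z \<and> h \<in> Hom C Z (Sh C 1 X)"

definition dist_triangle ::
    "('o, 'm, 'x) tcat_scheme \<Rightarrow> 'o \<Rightarrow> 'o \<Rightarrow> 'o \<Rightarrow> 'm \<Rightarrow> 'm \<Rightarrow> 'm \<Rightarrow> bool" where
  "dist_triangle C X Y Z f g h \<longleftrightarrow> triangle C X Y Z f g h \<and> (f, g, h) \<in> Tri C"

locale triangulated_category = additive_category C
  for C :: "('o, 'm, 'x) tcat_scheme" (structure) +
  assumes shift_functor: "is_additive_functor C C \<lparr>OMap = Sh C i, MMap = ShM C i\<rparr>"
    and shift_zero: "X \<in> Obj C \<Longrightarrow> Sh C 0 X = X" "f \<in> Arr C \<Longrightarrow> ShM C 0 f = f"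
    and shift_add: "X \<in> Obj C \<Longrightarrow> Sh C (i + j) X = Sh C i (Sh C j X)"
      "f \<in> Arr C \<Longrightarrow> ShM C (i + j) f = ShM C i (ShM C j f)"
    and Tri_triangle: "(f, g, h) \<in> Tri C \<Longrightarrow> \<exists>X Y Z. triangle C X Y Z f g h"
    and TR0: "dist_triangle C X Y Z f g h \<Longrightarrow> triangle C X' Y' Z' f' g' h' \<Longrightarrow>
      a \<in> Hom C X X' \<Longrightarrow> b \<in> Hom C Y Y' \<Longrightarrow> c \<in> Hom C Z Z' \<Longrightarrow>
      is_iso C a \<Longrightarrow> is_iso C b \<Longrightarrow> is_iso C c \<Longrightarrow>
      b \<cdot> f = f' \<cdot> a \<Longrightarrow> c \<cdot> g = g' \<cdot> b \<Longrightarrow> ShM C 1 a \<cdot> h = h' \<cdot> c \<Longrightarrow>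
      dist_triangle C X' Y' Z' f' g' h'"
    and TR1_ident: "X \<in> Obj C \<Longrightarrow> is_zero_object C Z \<Longrightarrow>
      dist_triangle C X X Z (Ident C X) (Null C X Z) (Null C Z (Sh C 1 X))"
    and TR1_cone: "f \<in> Hom C X Y \<Longrightarrow> \<exists>Z g h. dist_triangle C X Y Z f g h"
    and TR2: "triangle C X Y Z f g h \<Longrightarrow>
      dist_triangle C X Y Z f g h \<longleftrightarrow> dist_triangle C Y Z (Sh C 1 X) g h (Neg C (ShM C 1 f))"
    and TR3: "dist_triangle C X Y Z f g h \<Longrightarrow> dist_triangle C X' Y' Z' f' g' h' \<Longrightarrow>
      a \<in> Hom C X X' \<Longrightarrow> b \<in> Hom C Y Y' \<Longrightarrow> b \<cdot> f = f' \<cdot> a \<Longrightarrow>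
      \<exists>c\<in>Hom C Z Z'. c \<cdot> g = g' \<cdot> b \<and> ShM C 1 a \<cdot> h = h' \<cdot> c"
    and TR4: "dist_triangle C X Y Z' f u v \<Longrightarrow> dist_triangle C Y Z X' g p q \<Longrightarrow>
      dist_triangle C X Z Y' (g \<cdot> f) r s \<Longrightarrow>
      \<exists>a b. dist_triangle C Z' Y' X' a b (ShM C 1 u \<cdot> q) \<and>
        a \<cdot> u = r \<cdot> g \<and> s \<cdot> a = v \<and> b \<cdot> r = p \<and> q \<cdot> b = ShM C 1 f \<cdot> s"


section \<open>Weight structures\<close>

record 'o weights =
  Wle :: "'o set"
  Wge :: "'o set"

definition w_le :: "('o, 'm, 'x) tcat_scheme \<Rightarrow> 'o weights \<Rightarrow> int \<Rightarrow> 'o set" where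
  "w_le C W i = Sh C i ` Wle W"

definition w_ge :: "('o, 'm, 'x) tcat_scheme \<Rightarrow> 'o weights \<Rightarrow> int \<Rightarrow> 'o set" where
  "w_ge C W i = Sh C i ` Wge W"

locale weight_structure = triangulated_category C
  for C :: "('o, 'm, 'x) tcat_scheme" (structure) and W :: "'o weights" +
  assumes Wle_subset: "Wle W \<subseteq> Obj C"
    and Wge_subset: "Wge W \<subseteq> Obj C"
    and Wle_retract: "Y \<in> Wle W \<Longrightarrow> is_retract_of C X Y \<Longrightarrow> X \<in> Wle W"
    and Wge_retract: "Y \<in> Wge W \<Longrightarrow> is_retract_of C X Y \<Longrightarrow> X \<in> Wge W"
    and Wle_shift: "Wle W \<subseteq> w_le C W 1"
    and Wge_shift: "w_ge C W 1 \<subseteq> Wge W"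
    and orthogonality: "X \<in> Wle W \<Longrightarrow> Y \<in> w_ge C W 1 \<Longrightarrow> Hom C X Y = {Null C X Y}"
    and weight_decomposition: "M \<in> Obj C \<Longrightarrow>
      \<exists>LM RM f g h. LM \<in> Wle W \<and> RM \<in> w_ge C W 1 \<and> dist_triangle C LM M RM f g h"

definition heart :: "('o, 'm, 'x) tcat_scheme \<Rightarrow> 'o weights \<Rightarrow> ('o, 'm) acat" where
  "heart C W = full_subcat C (Wge W \<inter> Wle W)"

definition w_bounded_below :: "('o, 'm, 'x) tcat_scheme \<Rightarrow> 'o weights \<Rightarrow> 'o \<Rightarrow> bool" where
  "w_bounded_below C W M \<longleftrightarrow> M \<in> (\<Union>i. w_ge C W i)"

definition is_weight_complex ::
    "('o, 'm, 'x) tcat_scheme \<Rightarrow> 'o weights \<Rightarrow> 'o \<Rightarrow> (int \<Rightarrow> 'o) \<Rightarrow> (int \<Rightarrow> 'm) \<Rightarrow> bool" where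
  "is_weight_complex C W M T d \<longleftrightarrow>
     (\<exists>wl wg h g k j N c e.
        (\<forall>i. wl i \<in> w_le C W i \<and> wg i \<in> w_ge C W i) \<and>
        (\<forall>i. dist_triangle C (wl i) M (wg (i + 1)) (h i) (g i) (k i)) \<and>
        (\<forall>i. j i \<in> Hom C (wl i) (wl (i + 1)) \<and> h (i + 1) \<cdot>\<^bsub>C\<^esub> j i = h i) \<and>
        (\<forall>i. dist_triangle C (wl (i - 1)) (wl i) (N i) (j (i - 1)) (c i) (e (i - 1))) \<and>
        (\<forall>p. T p = Sh C p (N (- p))) \<and>
        (\<forall>i. d i = ShM C (i + 1) (c (- i - 1)) \<cdot>\<^bsub>C\<^esub> ShM C i (e (- i - 1))))"

text \<open>The object part of \<open>H\<^sup>A\<close>. It is determined up to isomorphism, as neither the choice of the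
  weight complex nor that of its homology matters.\<close>

definition weight_homology ::
    "('o, 'm, 'x) tcat_scheme \<Rightarrow> 'o weights \<Rightarrow> ('p, 'n, 'y) acat_scheme \<Rightarrow> ('o, 'm, 'p, 'n) cfun \<Rightarrow>
     'o \<Rightarrow> 'p" where
  "weight_homology C W D A M =
     (SOME K. \<exists>T d. is_weight_complex C W M T d \<and>
        is_homology D (MMap A (d (- 1))) (MMap A (d 0)) K)"

definition shifted_homology :: "('o, 'm, 'x) tcat_scheme \<Rightarrow> ('o \<Rightarrow> 'p) \<Rightarrow> int \<Rightarrow> 'o \<Rightarrow> 'p" where
  "shifted_homology C H i = H \<circ> Sh C (- i)"


section \<open>Linear categories and the Yoneda functor\<close>

text \<open>The components \<^const>\<open>monoid.mult\<close> and \<^const>\<open>one\<close> of a module record are irrelevant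
  to its module structure.\<close>

definition hom_module ::
    "('o, 'm, 'x) acat_scheme \<Rightarrow> ('r \<Rightarrow> 'm \<Rightarrow> 'm) \<Rightarrow> 'o \<Rightarrow> 'o \<Rightarrow> ('r, 'm) module" where
  "hom_module C sm X Y =
     \<lparr>carrier = Hom C X Y, monoid.mult = undefined, one = undefined,
      zero = Null C X Y, add = Plus C, smult = sm\<rparr>"

locale linear_category = preadditive_category C
  for R :: "'r ring" and C :: "('o, 'm, 'x) acat_scheme" (structure) and sm :: "'r \<Rightarrow> 'm \<Rightarrow> 'm" +
  assumes scalars: "cring R"
    and Hom_module: "X \<in> Obj C \<Longrightarrow> Y \<in> Obj C \<Longrightarrow> module R (hom_module C sm X Y)"
    and smult_Comp_left: "r \<in> carrier R \<Longrightarrow> f \<in> Hom C X Y \<Longrightarrow> g \<in> Hom C Y Z \<Longrightarrow>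
      sm r g \<cdot> f = sm r (g \<cdot> f)"
    and smult_Comp_right: "r \<in> carrier R \<Longrightarrow> f \<in> Hom C X Y \<Longrightarrow> g \<in> Hom C Y Z \<Longrightarrow>
      g \<cdot> sm r f = sm r (g \<cdot> f)"

definition is_linear_functor ::
    "'r ring \<Rightarrow> ('o, 'm, 'x) acat_scheme \<Rightarrow> ('r \<Rightarrow> 'm \<Rightarrow> 'm) \<Rightarrow>
     ('p, 'n, 'y) acat_scheme \<Rightarrow> ('r \<Rightarrow> 'n \<Rightarrow> 'n) \<Rightarrow> ('o, 'm, 'p, 'n) cfun \<Rightarrow> bool" where
  "is_linear_functor R C sm D sm' F \<longleftrightarrow> is_additive_functor C D F \<and>
     (\<forall>r\<in>carrier R. \<forall>f\<in>Arr C. MMap F (sm r f) = sm' r (MMap F f))"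

datatype ('a, 'b) arrow = Arrow (src: 'a) (tgt: 'a) (act: 'b)

definition module_homs ::
    "'r ring \<Rightarrow> ('r, 'v) module \<Rightarrow> ('r, 'v) module \<Rightarrow> ('v \<Rightarrow> 'v) set" where
  "module_homs R M N = {\<phi> \<in> carrier M \<rightarrow>\<^sub>E carrier N.
     (\<forall>x\<in>carrier M. \<forall>y\<in>carrier M. \<phi> (x \<oplus>\<^bsub>M\<^esub> y) = \<phi> x \<oplus>\<^bsub>N\<^esub> \<phi> y) \<and>
     (\<forall>r\<in>carrier R. \<forall>x\<in>carrier M. \<phi> (r \<odot>\<^bsub>M\<^esub> x) = r \<odot>\<^bsub>N\<^esub> \<phi> x)}"

text \<open>The category of small \<open>R\<close>-modules, i.e. of those with elements in the universe
  \<^typ>\<open>'v\<close>. (If \<^typ>\<open>'v\<close> is infinite, it is abelian with all small coproducts.)\<close>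

definition module_cat ::
    "'r ring \<Rightarrow> (('r, 'v) module, (('r, 'v) module, 'v \<Rightarrow> 'v) arrow) acat" where
  "module_cat R =
     \<lparr>Obj = {M. module R M},
      Arr = {Arrow M N \<phi> | M N \<phi>. module R M \<and> module R N \<and> \<phi> \<in> module_homs R M N},
      Dom = src, Cod = tgt,
      Ident = (\<lambda>M. Arrow M M (\<lambda>x\<in>carrier M. x)),
      Comp = (\<lambda>g f. Arrow (src f) (tgt g) (compose (carrier (src f)) (act g) (act f))),
      Plus = (\<lambda>f g. Arrow (src f) (tgt f) (\<lambda>x\<in>carrier (src f). act f x \<oplus>\<^bsub>tgt f\<^esub> act g x)),
      Null = (\<lambda>M N. Arrow M N (\<lambda>x\<in>carrier M. \<zero>\<^bsub>N\<^esub>))\<rparr>"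

definition module_cat_smult ::
    "'r \<Rightarrow> (('r, 'v) module, 'v \<Rightarrow> 'v) arrow \<Rightarrow> (('r, 'v) module, 'v \<Rightarrow> 'v) arrow" where
  "module_cat_smult r f = Arrow (src f) (tgt f) (\<lambda>x\<in>carrier (src f). r \<odot>\<^bsub>tgt f\<^esub> act f x)"

definition nat_transformations ::
    "('o, 'm, 'x) acat_scheme \<Rightarrow> ('p, 'n, 'y) acat_scheme \<Rightarrow>
     ('o, 'm, 'p, 'n) cfun \<Rightarrow> ('o, 'm, 'p, 'n) cfun \<Rightarrow> ('o \<Rightarrow> 'n) set" where
  "nat_transformations C D F G = {\<eta> \<in> extensional (Obj C).
     (\<forall>X\<in>Obj C. \<eta> X \<in> Hom D (OMap F X) (OMap G X)) \<and>
     (\<forall>X Y. \<forall>f\<in>Hom C X Y. \<eta> Y \<cdot>\<^bsub>D\<^esub> MMap F f = MMap G f \<cdot>\<^bsub>D\<^esub> \<eta> X)}"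

definition linear_functors ::
    "'r ring \<Rightarrow> ('o, 'm, 'x) acat_scheme \<Rightarrow> ('r \<Rightarrow> 'm \<Rightarrow> 'm) \<Rightarrow>
     ('p, 'n, 'y) acat_scheme \<Rightarrow> ('r \<Rightarrow> 'n \<Rightarrow> 'n) \<Rightarrow> ('o, 'm, 'p, 'n) cfun set" where
  "linear_functors R C sm D sm' = {F. is_linear_functor R C sm D sm' F \<and>
     OMap F \<in> extensional (Obj C) \<and> MMap F \<in> extensional (Arr C)}"

definition linear_functor_cat ::
    "'r ring \<Rightarrow> ('o, 'm, 'x) acat_scheme \<Rightarrow> ('r \<Rightarrow> 'm \<Rightarrow> 'm) \<Rightarrow>
     ('p, 'n, 'y) acat_scheme \<Rightarrow> ('r \<Rightarrow> 'n \<Rightarrow> 'n) \<Rightarrow>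
     (('o, 'm, 'p, 'n) cfun, (('o, 'm, 'p, 'n) cfun, 'o \<Rightarrow> 'n) arrow) acat" where
  "linear_functor_cat R C sm D sm' =
     \<lparr>Obj = linear_functors R C sm D sm',
      Arr = {Arrow F G \<eta> | F G \<eta>. F \<in> linear_functors R C sm D sm' \<and>
               G \<in> linear_functors R C sm D sm' \<and> \<eta> \<in> nat_transformations C D F G},
      Dom = src, Cod = tgt,
      Ident = (\<lambda>F. Arrow F F (\<lambda>X\<in>Obj C. Ident D (OMap F X))),
      Comp = (\<lambda>b a. Arrow (src a) (tgt b) (\<lambda>X\<in>Obj C. act b X \<cdot>\<^bsub>D\<^esub> act a X)),
      Plus = (\<lambda>a b. Arrow (src a) (tgt a) (\<lambda>X\<in>Obj C. Plus D (act a X) (act b X))),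
      Null = (\<lambda>F G. Arrow F G (\<lambda>X\<in>Obj C. Null D (OMap F X) (OMap G X)))\<rparr>"

text \<open>\<open>R\<close>-linear functors from the opposite of the full subcategory on \<open>S\<close> to \<open>R\<close>-modules.\<close>

definition presheaf_cat ::
    "'r ring \<Rightarrow> ('o, 'm, 'x) acat_scheme \<Rightarrow> ('r \<Rightarrow> 'm \<Rightarrow> 'm) \<Rightarrow> 'o set \<Rightarrow>
     (('o, 'm, ('r, 'v) module, (('r, 'v) module, 'v \<Rightarrow> 'v) arrow) cfun,
      (('o, 'm, ('r, 'v) module, (('r, 'v) module, 'v \<Rightarrow> 'v) arrow) cfun,
       'o \<Rightarrow> (('r, 'v) module, 'v \<Rightarrow> 'v) arrow) arrow) acat" where
  "presheaf_cat R B sm S =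
     linear_functor_cat R (op_cat (full_subcat B S)) sm (module_cat R) module_cat_smult"

text \<open>Transport of the module of arrows from \<open>N\<close> to \<open>M\<close> into the universe along a map \<open>enc\<close> that
  is injective on it.\<close>

definition yoneda_module ::
    "('o, 'm, 'x) acat_scheme \<Rightarrow> ('r \<Rightarrow> 'm \<Rightarrow> 'm) \<Rightarrow> ('m \<Rightarrow> 'v) \<Rightarrow> 'o \<Rightarrow> 'o \<Rightarrow> ('r, 'v) module" where
  "yoneda_module B sm enc N M =
     (let dec = inv_into (Hom B N M) enc
      in \<lparr>carrier = enc ` Hom B N M, monoid.mult = undefined, one = undefined,
          zero = enc (Null B N M), add = (\<lambda>x y. enc (Plus B (dec x) (dec y))),
          smult = (\<lambda>r x. enc (sm r (dec x)))\<rparr>)"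

text \<open>\<open>M \<mapsto> (N \<mapsto> B(N, M))\<close> for \<open>N\<close> in \<open>S\<close>; arrows act by composition.\<close>

definition yoneda_obj ::
    "('o, 'm, 'x) acat_scheme \<Rightarrow> ('r \<Rightarrow> 'm \<Rightarrow> 'm) \<Rightarrow> ('m \<Rightarrow> 'v) \<Rightarrow> 'o set \<Rightarrow> 'o \<Rightarrow>
     ('o, 'm, ('r, 'v) module, (('r, 'v) module, 'v \<Rightarrow> 'v) arrow) cfun" where
  "yoneda_obj B sm enc S M =
     \<lparr>OMap = (\<lambda>N\<in>S. yoneda_module B sm enc N M),
      MMap = (\<lambda>f\<in>Arr (full_subcat B S).
        Arrow (yoneda_module B sm enc (Cod B f) M) (yoneda_module B sm enc (Dom B f) M)
          (\<lambda>x\<in>enc ` Hom B (Cod B f) M. enc (inv_into (Hom B (Cod B f) M) enc x \<cdot>\<^bsub>B\<^esub> f)))\<rparr>"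

definition yoneda ::
    "('o, 'm, 'x) acat_scheme \<Rightarrow> ('r \<Rightarrow> 'm \<Rightarrow> 'm) \<Rightarrow> ('m \<Rightarrow> 'v) \<Rightarrow> 'o set \<Rightarrow>
     ('o, 'm, ('o, 'm, ('r, 'v) module, (('r, 'v) module, 'v \<Rightarrow> 'v) arrow) cfun,
      (('o, 'm, ('r, 'v) module, (('r, 'v) module, 'v \<Rightarrow> 'v) arrow) cfun,
       'o \<Rightarrow> (('r, 'v) module, 'v \<Rightarrow> 'v) arrow) arrow) cfun" where
  "yoneda B sm enc S =
     \<lparr>OMap = yoneda_obj B sm enc S,
      MMap = (\<lambda>g. Arrow (yoneda_obj B sm enc S (Dom B g)) (yoneda_obj B sm enc S (Cod B g))
        (\<lambda>N\<in>S. Arrow (yoneda_module B sm enc N (Dom B g)) (yoneda_module B sm enc N (Cod B g))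
          (\<lambda>x\<in>enc ` Hom B N (Dom B g). enc (g \<cdot>\<^bsub>B\<^esub> inv_into (Hom B N (Dom B g)) enc x))))\<rparr>"

end

theory Submission
  imports Defs
begin

text \<open>
  Assertion 1. Shifting reduces the claim to \<open>M\<close> of weights at least 0 and homology in degree 0. Orthogonality
  kills the connecting maps below weight 0, so \<open>N\<^sub>0\<close> splits as \<open>w\<^sub>\<le>\<^sub>0M \<oplus> w\<^sub>\<le>\<^sub>-\<^sub>1M[1]\<close> and the homology is the
  cokernel of \<open>A(p)\<close> for \<open>p = e\<^sub>0[-1] : N\<^sub>1[-1] \<rightarrow> w\<^sub>\<le>\<^sub>0M\<close>. By conditions (i) and (ii) it vanishes iff \<open>p\<close> is split
  surjective, i.e. iff \<open>w\<^sub>\<le>\<^sub>0M \<rightarrow> w\<^sub>\<le>\<^sub>1M\<close> is zero, which happens exactly when \<open>M\<close> has weights at least 1.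

  Assertion 2. Epimorphisms of presheaves are pointwise surjective, so representable presheaves are
  projective by the Yoneda lemma; coproducts and retracts inherit projectivity.

  Assertion 3. A splitting of \<open>A(h)\<close> lifts along the full functor \<open>A\<close> to some \<open>t\<close>, and \<open>h \<cdot> t\<close> is invertible.
\<close>

section \<open>Preadditive and triangulated categories\<close>

text \<open>\<open>weight_homology\<close> is a \<open>SOME\<close> over all weight complexes and
  all their homology objects, so nothing is known about the value picked. Independence of the
  choices is bypassed: the vanishing criterion is proved for every weight complex and every homology
  object of it, and existence of both settles the chosen value. Boundedness below supplies some
  \<open>m\<close> with \<open>M\<close> in \<open>w_ge C W m\<close>; each vanishing homology
  object raises this bound by one until \<open>n\<close> is reached. The functor \<open>A\<close>
  only sees the heart, so the terms in degrees -1, 0, 1 must be shown to lie there. For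
  \<open>N i\<close> with \<open>i \<le> 0\<close> extension closure suffices, but
  \<open>wl 1\<close> is only known to have weights at least 0, and \<open>N 1\<close> needs a
  diagram chase. For presheaves the obstacle is the universe: pointwise surjectivity of epimorphisms
  needs a quotient module whose elements again have type \<open>'v\<close>. Arrows are compared by
  equality, so all functions are restricted to their carriers.\<close>

context category
begin

lemma Hom_Dom: "f \<in> Hom C X Y \<Longrightarrow> X \<in> Obj C"
  by (auto simp: Hom_def dest: Dom_closed)

lemma Hom_Cod: "f \<in> Hom C X Y \<Longrightarrow> Y \<in> Obj C"
  by (auto simp: Hom_def dest: Cod_closed)

lemma Hom_self: "f \<in> Arr C \<Longrightarrow> f \<in> Hom C (Dom C f) (Cod C f)"
  by (simp add: Hom_def)

end

lemma Hom_simps: "f \<in> Hom C X Y \<Longrightarrow> f \<in> Arr C \<and> Dom C f = X \<and> Cod C f = Y"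
  by (simp add: Hom_def)

context preadditive_category
begin

lemma Null_closed: "X \<in> Obj C \<Longrightarrow> Y \<in> Obj C \<Longrightarrow> Null C X Y \<in> Hom C X Y"
proof -
  assume "X \<in> Obj C" "Y \<in> Obj C"
  then interpret G: comm_group "hom_group C X Y" by (rule Hom_group)
  show ?thesis using G.one_closed by (simp add: hom_group_def)
qed

lemma Plus_closed: "f \<in> Hom C X Y \<Longrightarrow> g \<in> Hom C X Y \<Longrightarrow> Plus C f g \<in> Hom C X Y"
proof -
  assume fg: "f \<in> Hom C X Y" "g \<in> Hom C X Y"
  then interpret G: comm_group "hom_group C X Y" by (intro Hom_group) (auto dest: Hom_Dom Hom_Cod)
  show ?thesis using G.m_closed fg by (simp add: hom_group_def)
qed

lemma Neg_closed: "f \<in> Hom C X Y \<Longrightarrow> Neg C f \<in> Hom C X Y"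
proof -
  assume fg: "f \<in> Hom C X Y"
  then interpret G: comm_group "hom_group C X Y" by (intro Hom_group) (auto dest: Hom_Dom Hom_Cod)
  show ?thesis using G.inv_closed[of f] Hom_simps[OF fg] fg by (simp add: hom_group_def Neg_def)
qed

lemma Plus_Neg: "f \<in> Hom C X Y \<Longrightarrow> Plus C f (Neg C f) = Null C X Y"
proof -
  assume fg: "f \<in> Hom C X Y"
  then interpret G: comm_group "hom_group C X Y" by (intro Hom_group) (auto dest: Hom_Dom Hom_Cod)
  show ?thesis using G.r_inv[of f] Hom_simps[OF fg] fg by (simp add: hom_group_def Neg_def)
qed

lemma Plus_Null: "f \<in> Hom C X Y \<Longrightarrow> Plus C f (Null C X Y) = f"
proof -
  assume fg: "f \<in> Hom C X Y"
  then interpret G: comm_group "hom_group C X Y" by (intro Hom_group) (auto dest: Hom_Dom Hom_Cod)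
  show ?thesis using G.r_one[of f] fg by (simp add: hom_group_def)
qed

lemma Plus_comm: "f \<in> Hom C X Y \<Longrightarrow> g \<in> Hom C X Y \<Longrightarrow> Plus C f g = Plus C g f"
proof -
  assume fg: "f \<in> Hom C X Y" "g \<in> Hom C X Y"
  then interpret G: comm_group "hom_group C X Y" by (intro Hom_group) (auto dest: Hom_Dom Hom_Cod)
  show ?thesis using G.m_comm[of f g] fg by (simp add: hom_group_def)
qed

lemma Plus_assoc: "f \<in> Hom C X Y \<Longrightarrow> g \<in> Hom C X Y \<Longrightarrow> h \<in> Hom C X Y \<Longrightarrow>
    Plus C (Plus C f g) h = Plus C f (Plus C g h)"
proof -
  assume fg: "f \<in> Hom C X Y" "g \<in> Hom C X Y" "h \<in> Hom C X Y"
  then interpret G: comm_group "hom_group C X Y" by (intro Hom_group) (auto dest: Hom_Dom Hom_Cod)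
  show ?thesis using G.m_assoc[of f g h] fg by (simp add: hom_group_def)
qed

lemma Plus_cancel:
  assumes "f \<in> Hom C X Y" "g \<in> Hom C X Y" "h \<in> Hom C X Y" "Plus C f g = Plus C f h"
  shows "g = h"
proof -
  interpret G: comm_group "hom_group C X Y"
    using assms by (intro Hom_group) (auto dest: Hom_Dom Hom_Cod)
  show ?thesis using G.Units_l_cancel[of f g h] G.Units_eq assms by (simp add: hom_group_def)
qed

text \<open>Cancelling one copy of \<open>f\<close> leaves zero. This is the device by which
  composition and additive functors are seen to preserve \<open>Null\<close>.\<close>

lemma Plus_idem: "f \<in> Hom C X Y \<Longrightarrow> Plus C f f = f \<Longrightarrow> f = Null C X Y"
  using Plus_cancel[of f X Y f "Null C X Y"] Plus_Null Null_closed Hom_Dom Hom_Cod by metis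

lemma Neg_unique: "f \<in> Hom C X Y \<Longrightarrow> g \<in> Hom C X Y \<Longrightarrow> Plus C f g = Null C X Y \<Longrightarrow> Neg C f = g"
  using Plus_cancel[of f X Y g "Neg C f"] Plus_Neg Neg_closed by metis

lemma Neg_Neg: "f \<in> Hom C X Y \<Longrightarrow> Neg C (Neg C f) = f"
  by (rule Neg_unique[where X = X and Y = Y]) (simp_all add: Plus_comm[of "Neg C f" X Y f] Plus_Neg Neg_closed)

lemma Comp_Null_right: "g \<in> Hom C Y Z \<Longrightarrow> X \<in> Obj C \<Longrightarrow> g \<cdot> Null C X Y = Null C X Z"
proof -
  assume g: "g \<in> Hom C Y Z" and X: "X \<in> Obj C"
  have N: "Null C X Y \<in> Hom C X Y" by (simp add: Null_closed X Hom_Dom[OF g])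
  show ?thesis
  proof (rule Plus_idem)
    show "g \<cdot> Null C X Y \<in> Hom C X Z" using Comp_closed[OF N g] .
    show "Plus C (g \<cdot> Null C X Y) (g \<cdot> Null C X Y) = g \<cdot> Null C X Y"
      using Comp_Plus_right[OF N N g] Plus_Null[OF N] by simp
  qed
qed

lemma Comp_Null_left: "f \<in> Hom C X Y \<Longrightarrow> Z \<in> Obj C \<Longrightarrow> Null C Y Z \<cdot> f = Null C X Z"
proof -
  assume f: "f \<in> Hom C X Y" and Z: "Z \<in> Obj C"
  have N: "Null C Y Z \<in> Hom C Y Z" by (simp add: Null_closed Z Hom_Cod[OF f])
  show ?thesis
  proof (rule Plus_idem)
    show "Null C Y Z \<cdot> f \<in> Hom C X Z" using Comp_closed[OF f N] .
    show "Plus C (Null C Y Z \<cdot> f) (Null C Y Z \<cdot> f) = Null C Y Z \<cdot> f"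
      using Comp_Plus_left[OF f N N] Plus_Null[OF N] by simp
  qed
qed

lemma Comp_Neg_left:
  assumes f: "f \<in> Hom C X Y" and g: "g \<in> Hom C Y Z"
  shows "Neg C g \<cdot> f = Neg C (g \<cdot> f)"
proof -
  have "Plus C (g \<cdot> f) (Neg C g \<cdot> f) = Null C X Z"
    using Comp_Plus_left[OF f g Neg_closed[OF g]] Plus_Neg[OF g] Comp_Null_left[OF f] Hom_Cod[OF g]
    by simp
  from Neg_unique[OF Comp_closed[OF f g] Comp_closed[OF f Neg_closed[OF g]] this]
  show ?thesis by simp
qed

lemma Comp_Neg_right:
  assumes f: "f \<in> Hom C X Y" and g: "g \<in> Hom C Y Z"
  shows "g \<cdot> Neg C f = Neg C (g \<cdot> f)"
proof -
  have "Plus C (g \<cdot> f) (g \<cdot> Neg C f) = Null C X Z"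
    using Comp_Plus_right[OF f Neg_closed[OF f] g] Plus_Neg[OF f] Comp_Null_right[OF g] Hom_Dom[OF f]
    by simp
  from Neg_unique[OF Comp_closed[OF f g] Comp_closed[OF Neg_closed[OF f] g] this]
  show ?thesis by simp
qed

lemma Neg_Null: "X \<in> Obj C \<Longrightarrow> Y \<in> Obj C \<Longrightarrow> Neg C (Null C X Y) = Null C X Y"
  by (rule Neg_unique[where X = X and Y = Y]) (auto simp: Plus_Null Null_closed)

lemma Neg_eq_Null:
  assumes "f \<in> Hom C X Y" and "Neg C f = Null C X Y"
  shows "f = Null C X Y"
  using Neg_Neg[OF assms(1)] assms Neg_Null Hom_Dom Hom_Cod by metis

lemma zero_object_Hom_eq:
  assumes "is_zero_object C Z"
  shows "f \<in> Hom C X Z \<Longrightarrow> f' \<in> Hom C X Z \<Longrightarrow> f = f'"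
    and "f \<in> Hom C Z X \<Longrightarrow> f' \<in> Hom C Z X \<Longrightarrow> f = f'"
  using assms Hom_Dom Hom_Cod unfolding is_zero_object_def by blast+

text \<open>Every arrow into or out of \<open>Z\<close> factors through the identity of
  \<open>Z\<close>, hence through zero.\<close>

lemma zero_object_if_Ident_Null:
  assumes Z: "Z \<in> Obj C" and id: "Ident C Z = Null C Z Z"
  shows "is_zero_object C Z"
  unfolding is_zero_object_def
proof (intro conjI ballI Z)
  fix X assume X: "X \<in> Obj C"
  have "f = Null C X Z" if f: "f \<in> Hom C X Z" for f
    using Ident_left[OF f] Comp_Null_left[OF f Z] id by simp
  then show "\<exists>!f. f \<in> Hom C X Z" using Null_closed X Z by blast
  have "f = Null C Z X" if f: "f \<in> Hom C Z X" for f
    using Ident_right[OF f] Comp_Null_right[OF f Z] id by simp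
  then show "\<exists>!f. f \<in> Hom C Z X" using Null_closed X Z by blast
qed

end

section \<open>Functors and additive functors\<close>

lemma functor_Obj: "is_functor C D F \<Longrightarrow> X \<in> Obj C \<Longrightarrow> OMap F X \<in> Obj D"
  by (simp add: is_functor_def)

lemma functor_Ident: "is_functor C D F \<Longrightarrow> X \<in> Obj C \<Longrightarrow> MMap F (Ident C X) = Ident D (OMap F X)"
  by (simp add: is_functor_def)

lemma functor_Hom: "is_functor C D F \<Longrightarrow> f \<in> Hom C X Y \<Longrightarrow> MMap F f \<in> Hom D (OMap F X) (OMap F Y)"
  by (simp add: is_functor_def)

lemma functor_Comp: "is_functor C D F \<Longrightarrow> f \<in> Hom C X Y \<Longrightarrow> g \<in> Hom C Y Z \<Longrightarrow>
    MMap F (g \<cdot>\<^bsub>C\<^esub> f) = MMap F g \<cdot>\<^bsub>D\<^esub> MMap F f"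
  by (simp add: is_functor_def)

lemma additive_functor_Null:
  assumes F: "is_additive_functor C D F" and "preadditive_category C" "preadditive_category D"
    and X: "X \<in> Obj C" and Y: "Y \<in> Obj C"
  shows "MMap F (Null C X Y) = Null D (OMap F X) (OMap F Y)"
proof -
  interpret C: preadditive_category C by fact
  interpret D: preadditive_category D by fact
  have N: "Null C X Y \<in> Hom C X Y" using C.Null_closed X Y .
  show ?thesis
  proof (rule D.Plus_idem)
    show "MMap F (Null C X Y) \<in> Hom D (OMap F X) (OMap F Y)"
      using F by (intro functor_Hom[OF _ N]) (simp add: is_additive_functor_def)
    show "Plus D (MMap F (Null C X Y)) (MMap F (Null C X Y)) = MMap F (Null C X Y)"
      using F N C.Plus_Null[OF N] unfolding is_additive_functor_def by metis
  qed
qed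

lemma additive_functor_Neg:
  assumes F: "is_additive_functor C D F" and "preadditive_category C" "preadditive_category D"
    and f: "f \<in> Hom C X Y"
  shows "MMap F (Neg C f) = Neg D (MMap F f)"
proof -
  interpret C: preadditive_category C by fact
  interpret D: preadditive_category D by fact
  have F': "is_functor C D F" using F by (simp add: is_additive_functor_def)
  have "Plus D (MMap F f) (MMap F (Neg C f)) = MMap F (Plus C f (Neg C f))"
    using F f C.Neg_closed[OF f] unfolding is_additive_functor_def by metis
  also have "\<dots> = Null D (OMap F X) (OMap F Y)"
    using C.Plus_Neg[OF f] additive_functor_Null[OF assms(1-3)] C.Hom_Dom[OF f] C.Hom_Cod[OF f] by simp
  finally show ?thesis
    using D.Neg_unique functor_Hom[OF F'] f C.Neg_closed[OF f] by metis
qed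

section \<open>Exactness of distinguished triangles and their shifts\<close>

context triangulated_category
begin

lemma Sh_Obj: "X \<in> Obj C \<Longrightarrow> Sh C i X \<in> Obj C"
  using functor_Obj shift_functor[of i] unfolding is_additive_functor_def by fastforce

lemma ShM_Hom: "f \<in> Hom C X Y \<Longrightarrow> ShM C i f \<in> Hom C (Sh C i X) (Sh C i Y)"
  using functor_Hom shift_functor[of i] unfolding is_additive_functor_def by fastforce

lemma ShM_Ident: "X \<in> Obj C \<Longrightarrow> ShM C i (Ident C X) = Ident C (Sh C i X)"
  using functor_Ident shift_functor[of i] unfolding is_additive_functor_def by fastforce

lemma ShM_Comp: "f \<in> Hom C X Y \<Longrightarrow> g \<in> Hom C Y Z \<Longrightarrow> ShM C i (g \<cdot> f) = ShM C i g \<cdot> ShM C i f"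
  using functor_Comp shift_functor[of i] unfolding is_additive_functor_def by fastforce

lemma ShM_Null: "X \<in> Obj C \<Longrightarrow> Y \<in> Obj C \<Longrightarrow> ShM C i (Null C X Y) = Null C (Sh C i X) (Sh C i Y)"
  using additive_functor_Null[OF shift_functor[of i] preadditive_category_axioms preadditive_category_axioms]
  by simp

lemma ShM_Neg: "f \<in> Hom C X Y \<Longrightarrow> ShM C i (Neg C f) = Neg C (ShM C i f)"
  using additive_functor_Neg[OF shift_functor[of i] preadditive_category_axioms preadditive_category_axioms]
  by simp

lemma Sh_Sh: "X \<in> Obj C \<Longrightarrow> Sh C i (Sh C j X) = Sh C (i + j) X"
  by (simp add: shift_add)

lemma ShM_ShM: "f \<in> Hom C X Y \<Longrightarrow> ShM C i (ShM C j f) = ShM C (i + j) f"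
  by (simp add: shift_add Hom_def)

lemma ShM_0: "f \<in> Hom C X Y \<Longrightarrow> ShM C 0 f = f"
  by (simp add: shift_zero Hom_def)

lemma ShM_eq_Null:
  assumes f: "f \<in> Hom C X Y" and n: "ShM C i f = Null C (Sh C i X) (Sh C i Y)"
  shows "f = Null C X Y"
proof -
  have XY: "X \<in> Obj C" "Y \<in> Obj C" using f Hom_Dom Hom_Cod by auto
  have "f = ShM C (- i) (ShM C i f)" using f by (simp add: ShM_ShM ShM_0)
  also have "\<dots> = Null C X Y" using XY by (simp add: n ShM_Null Sh_Obj Sh_Sh shift_zero)
  finally show ?thesis .
qed

lemma dist_triangle_Hom:
  assumes "dist_triangle C X Y Z f g h"
  shows "f \<in> Hom C X Y" "g \<in> Hom C Y Z" "h \<in> Hom C Z (Sh C 1 X)"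
  using assms by (auto simp: dist_triangle_def triangle_def)

lemma dist_triangle_rotate:
  "dist_triangle C X Y Z f g h \<Longrightarrow> dist_triangle C Y Z (Sh C 1 X) g h (Neg C (ShM C 1 f))"
  using TR2 by (auto simp: dist_triangle_def)

lemma Neg_ShM_Neg_ShM:
  assumes "f \<in> Hom C X Y" "i + j = 0"
  shows "Neg C (ShM C i (Neg C (ShM C j f))) = f"
  using assms by (simp add: ShM_Neg[OF ShM_Hom[OF assms(1)]] ShM_ShM ShM_0 Neg_Neg[OF assms(1)])

text \<open>TR2 is an equivalence, so it suffices that the rotation of the new triangle is the given
  one. The signs from rotating and from the definition of the first arrow cancel by
  \<open>Neg_ShM_Neg_ShM\<close>.\<close>

lemma dist_triangle_rotate_back:
  assumes D: "dist_triangle C X Y Z f g h"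
  shows "dist_triangle C (Sh C (- 1) Z) X Y (Neg C (ShM C (- 1) h)) f g"
proof -
  note H = dist_triangle_Hom[OF D]
  have Z: "Z \<in> Obj C" and X: "X \<in> Obj C" using H Hom_Cod Hom_Dom by auto
  have s: "Sh C 1 (Sh C (- 1) Z) = Z" "Sh C (- 1) (Sh C 1 X) = X"
    using Z X by (simp_all add: Sh_Sh shift_zero)
  have "triangle C (Sh C (- 1) Z) X Y (Neg C (ShM C (- 1) h)) f g"
    using H Neg_closed[OF ShM_Hom[OF H(3), of "- 1"]] by (simp add: triangle_def s)
  then show ?thesis
    using TR2 D Neg_ShM_Neg_ShM[OF H(3), of 1 "- 1"] by (simp add: s)
qed

lemma zero_object_Sh:
  assumes "is_zero_object C Z"
  shows "is_zero_object C (Sh C i Z)"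
proof (rule zero_object_if_Ident_Null)
  have Z: "Z \<in> Obj C" using assms by (simp add: is_zero_object_def)
  then show "Sh C i Z \<in> Obj C" by (rule Sh_Obj)
  have "Ident C Z = Null C Z Z"
    using zero_object_Hom_eq(1)[OF assms] Ident_closed[OF Z] Null_closed[OF Z Z] by blast
  then show "Ident C (Sh C i Z) = Null C (Sh C i Z) (Sh C i Z)"
    using ShM_Ident[OF Z] ShM_Null[OF Z Z] by metis
qed

text \<open>TR3 maps the triangle on the identity of \<open>X\<close> to the given one by
  \<open>Ident C X\<close> and \<open>f\<close>; the square then makes \<open>g \<cdot> f\<close>
  factor through a zero object.\<close>

lemma dist_triangle_Comp:
  assumes D: "dist_triangle C X Y Z f g h"
  shows "g \<cdot> f = Null C X Z"
proof -
  note H = dist_triangle_Hom[OF D]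
  obtain Z\<^sub>0 where O: "is_zero_object C Z\<^sub>0" using zero_object_exists by blast
  have X: "X \<in> Obj C" and Ob: "Z\<^sub>0 \<in> Obj C" using H Hom_Dom O by (auto simp: is_zero_object_def)
  obtain c where c: "c \<in> Hom C Z\<^sub>0 Z" "c \<cdot> Null C X Z\<^sub>0 = g \<cdot> f"
    using TR3[OF TR1_ident[OF X O] D Ident_closed[OF X] H(1)] by blast
  then show ?thesis using Comp_Null_right[OF c(1) X] by simp
qed

text \<open>\<open>f\<close> is a weak kernel of \<open>g\<close>. TR3 only fills in the third
  arrow, so both the identity triangle of \<open>V\<close> and the given one are rotated once; the
  fill-in is the wanted lift shifted by 1, up to signs that cancel, and it is shifted back at the
  end.\<close>

lemma dist_triangle_lift:
  assumes D: "dist_triangle C X Y Z f g h" and u: "u \<in> Hom C V Y" and gu: "g \<cdot> u = Null C V Z"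
  obtains v where "v \<in> Hom C V X" "f \<cdot> v = u"
proof -
  note H = dist_triangle_Hom[OF D]
  obtain Z\<^sub>0 where O: "is_zero_object C Z\<^sub>0" using zero_object_exists by blast
  have Ob: "Z\<^sub>0 \<in> Obj C" using O by (auto simp: is_zero_object_def)
  have V: "V \<in> Obj C" and Y: "Y \<in> Obj C" and X: "X \<in> Obj C" and Z: "Z \<in> Obj C"
    using u H Hom_Dom Hom_Cod by blast+
  have f1: "ShM C 1 f \<in> Hom C (Sh C 1 X) (Sh C 1 Y)" and u1: "ShM C 1 u \<in> Hom C (Sh C 1 V) (Sh C 1 Y)"
    using ShM_Hom H(1) u by auto
  have i1: "Ident C (Sh C 1 V) \<in> Hom C (Sh C 1 V) (Sh C 1 V)" using V Sh_Obj Ident_closed by blast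
  have "Null C Z\<^sub>0 Z \<cdot> Null C V Z\<^sub>0 = g \<cdot> u"
    using gu Comp_Null_right Null_closed Ob Z V by metis
  then obtain c where c: "c \<in> Hom C (Sh C 1 V) (Sh C 1 X)"
      "ShM C 1 u \<cdot> Neg C (ShM C 1 (Ident C V)) = Neg C (ShM C 1 f) \<cdot> c"
    using TR3[OF dist_triangle_rotate[OF TR1_ident[OF V O]] dist_triangle_rotate[OF D] u Null_closed[OF Ob Z]]
    by blast
  have "Neg C (ShM C 1 u) = Neg C (ShM C 1 f \<cdot> c)"
    using c(2) Comp_Neg_right[OF i1 u1] Comp_Neg_left[OF c(1) f1] Ident_right[OF u1] by (simp add: ShM_Ident V)
  then have e: "ShM C 1 u = ShM C 1 f \<cdot> c"
    using Neg_Neg u1 Comp_closed[OF c(1) f1] by metis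
  show ?thesis
  proof (rule that)
    have c': "ShM C (- 1) c \<in> Hom C (Sh C (- 1) (Sh C 1 V)) (Sh C (- 1) (Sh C 1 X))"
      by (rule ShM_Hom[OF c(1)])
    then show "ShM C (- 1) c \<in> Hom C V X" using V X by (simp add: Sh_Sh shift_zero)
    have "ShM C (- 1) (ShM C 1 u) = ShM C (- 1) (ShM C 1 f) \<cdot> ShM C (- 1) c"
      unfolding e by (rule ShM_Comp[OF c(1) f1])
    then show "f \<cdot> ShM C (- 1) c = u" using u H(1) by (simp add: ShM_ShM ShM_0)
  qed
qed

text \<open>Dually, \<open>g\<close> is a weak cokernel of \<open>f\<close>. Here the fill-in of TR3
  is the extension itself, once a triangle from a zero object to \<open>V\<close> to
  \<open>V\<close> is at hand.\<close>

lemma dist_triangle_extend: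
  assumes D: "dist_triangle C X Y Z f g h" and u: "u \<in> Hom C Y V" and uf: "u \<cdot> f = Null C X V"
  obtains v where "v \<in> Hom C Z V" "v \<cdot> g = u"
proof -
  note H = dist_triangle_Hom[OF D]
  obtain Z\<^sub>0 where O: "is_zero_object C Z\<^sub>0" using zero_object_exists by blast
  have Ob: "Z\<^sub>0 \<in> Obj C" using O by (auto simp: is_zero_object_def)
  have V: "V \<in> Obj C" and X: "X \<in> Obj C"
    using u H Hom_Dom Hom_Cod by blast+
  note O1 = zero_object_Sh[OF O, of 1]
  have Ob1: "Sh C 1 Z\<^sub>0 \<in> Obj C" using Ob by (rule Sh_Obj)
  have N: "Null C Z\<^sub>0 V \<in> Hom C Z\<^sub>0 V" using Null_closed Ob V .
  \<comment> \<open>This triangle is distinguished because its rotation is the identity triangle of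
    \<open>V\<close> ending in the zero object \<open>Sh C 1 Z\<^sub>0\<close>.\<close>
  have t: "triangle C Z\<^sub>0 V V (Null C Z\<^sub>0 V) (Ident C V) (Null C V (Sh C 1 Z\<^sub>0))"
    using N Ident_closed Null_closed V Ob1 by (simp add: triangle_def)
  have "Neg C (ShM C 1 (Null C Z\<^sub>0 V)) = Null C (Sh C 1 Z\<^sub>0) (Sh C 1 V)"
    using Ob V Ob1 by (simp add: ShM_Null Neg_Null Sh_Obj)
  then have D': "dist_triangle C Z\<^sub>0 V V (Null C Z\<^sub>0 V) (Ident C V) (Null C V (Sh C 1 Z\<^sub>0))"
    using TR2[OF t] TR1_ident[OF V O1] by simp
  have "u \<cdot> f = Null C Z\<^sub>0 V \<cdot> Null C X Z\<^sub>0"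
    using uf Comp_Null_right N X by metis
  then obtain c where "c \<in> Hom C Z V" "c \<cdot> g = Ident C V \<cdot> u"
    using TR3[OF D D' Null_closed[OF X Ob] u] by blast
  then show ?thesis using that Ident_left[OF u] by simp
qed

text \<open>The identity of \<open>Y\<close> kills \<open>f\<close>, hence extends along
  \<open>g\<close>. The left inverse \<open>v\<close> of \<open>g\<close> exhibits \<open>Y\<close>
  as a retract of \<open>Z\<close>, which is how weights are transferred below.\<close>

lemma Null_first_imp_section:
  assumes D: "dist_triangle C X Y Z f g h" and f: "f = Null C X Y"
  obtains v where "v \<in> Hom C Z Y" "v \<cdot> g = Ident C Y"
proof -
  note H = dist_triangle_Hom[OF D]
  have Y: "Y \<in> Obj C" using H Hom_Cod by blast
  have "Ident C Y \<cdot> f = Null C X Y" using Ident_left[OF H(1)] f by simp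
  from dist_triangle_extend[OF D Ident_closed[OF Y] this] that show ?thesis by blast
qed

text \<open>Exactness at \<open>Sh C 1 X\<close> in the twice rotated triangle: the identity lifts
  along \<open>h\<close> iff it is killed by the shift of \<open>f\<close>, and shifting reflects
  zero arrows.\<close>

lemma Null_first_iff_split:
  assumes D: "dist_triangle C X Y Z f g h"
  shows "f = Null C X Y \<longleftrightarrow> (\<exists>s\<in>Hom C (Sh C 1 X) Z. h \<cdot> s = Ident C (Sh C 1 X))"
proof -
  note H = dist_triangle_Hom[OF D]
  have X: "X \<in> Obj C" and Y: "Y \<in> Obj C" using H Hom_Dom Hom_Cod by blast+
  then have X1: "Sh C 1 X \<in> Obj C" and Y1: "Sh C 1 Y \<in> Obj C" by (auto intro: Sh_Obj)
  have f1: "ShM C 1 f \<in> Hom C (Sh C 1 X) (Sh C 1 Y)" by (rule ShM_Hom[OF H(1)])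
  note D' = dist_triangle_rotate[OF dist_triangle_rotate[OF D]]
  have c: "Neg C (ShM C 1 f) \<cdot> h = Null C Z (Sh C 1 Y)" by (rule dist_triangle_Comp[OF D'])
  show ?thesis
  proof
    assume "f = Null C X Y"
    then have "Neg C (ShM C 1 f) \<cdot> Ident C (Sh C 1 X) = Null C (Sh C 1 X) (Sh C 1 Y)"
      using X Y X1 Y1 by (simp add: ShM_Null Neg_Null Comp_Null_left Ident_closed)
    from dist_triangle_lift[OF D' Ident_closed[OF X1] this]
    show "\<exists>s\<in>Hom C (Sh C 1 X) Z. h \<cdot> s = Ident C (Sh C 1 X)" by blast
  next
    assume "\<exists>s\<in>Hom C (Sh C 1 X) Z. h \<cdot> s = Ident C (Sh C 1 X)"
    then obtain s where s: "s \<in> Hom C (Sh C 1 X) Z" "h \<cdot> s = Ident C (Sh C 1 X)" by blast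
    have "Neg C (ShM C 1 f) = Neg C (ShM C 1 f) \<cdot> h \<cdot> s"
      using s Ident_right[OF Neg_closed[OF f1]] by simp
    also have "\<dots> = (Neg C (ShM C 1 f) \<cdot> h) \<cdot> s"
      using Comp_assoc[OF s(1) H(3) Neg_closed[OF f1]] by simp
    also have "\<dots> = Null C (Sh C 1 X) (Sh C 1 Y)" using c Comp_Null_left[OF s(1) Y1] by simp
    finally have "ShM C 1 f = Null C (Sh C 1 X) (Sh C 1 Y)" by (rule Neg_eq_Null[OF f1])
    then show "f = Null C X Y" by (rule ShM_eq_Null[OF H(1)])
  qed
qed

text \<open>Three rotations shift all three objects and change signs of arrows. Only the objects
  matter for shifting weight decompositions, so the arrows are left existential.\<close>

lemma dist_triangle_shift1:
  assumes D: "dist_triangle C X Y Z f g h"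
  shows "\<exists>f g h. dist_triangle C (Sh C 1 X) (Sh C 1 Y) (Sh C 1 Z) f g h"
  using dist_triangle_rotate[OF dist_triangle_rotate[OF dist_triangle_rotate[OF D]]] by blast

lemma dist_triangle_shift_minus1:
  assumes D: "dist_triangle C X Y Z f g h"
  shows "\<exists>f g h. dist_triangle C (Sh C (- 1) X) (Sh C (- 1) Y) (Sh C (- 1) Z) f g h"
  using dist_triangle_rotate_back[OF dist_triangle_rotate_back[OF dist_triangle_rotate_back[OF D]]]
  by blast

lemma dist_triangle_shift:
  assumes D: "dist_triangle C X Y Z f g h"
  shows "\<exists>f g h. dist_triangle C (Sh C i X) (Sh C i Y) (Sh C i Z) f g h"
proof -
  note H = dist_triangle_Hom[OF D]
  have O: "X \<in> Obj C" "Y \<in> Obj C" "Z \<in> Obj C" using H Hom_Dom Hom_Cod by blast+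
  show ?thesis
  proof (induction i rule: int_induct[where k = 0])
    case base
    then show ?case using D O by (auto simp: shift_zero)
  next
    case (step1 i)
    then obtain f g h where "dist_triangle C (Sh C i X) (Sh C i Y) (Sh C i Z) f g h" by blast
    from dist_triangle_shift1[OF this] show ?case using O by (simp add: Sh_Sh add.commute)
  next
    case (step2 i)
    then obtain f g h where "dist_triangle C (Sh C i X) (Sh C i Y) (Sh C i Z) f g h" by blast
    from dist_triangle_shift_minus1[OF this] show ?case using O by (simp add: Sh_Sh)
  qed
qed

end

section \<open>Weight structures and weight complexes\<close>

context weight_structure
begin

lemma Wle_Obj: "X \<in> Wle W \<Longrightarrow> X \<in> Obj C"
  using Wle_subset by blast

lemma Wge_Obj: "X \<in> Wge W \<Longrightarrow> X \<in> Obj C"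
  using Wge_subset by blast

lemma w_le_Obj: "X \<in> w_le C W i \<Longrightarrow> X \<in> Obj C"
  unfolding w_le_def using Wle_Obj Sh_Obj by blast

lemma w_ge_Obj: "X \<in> w_ge C W i \<Longrightarrow> X \<in> Obj C"
  unfolding w_ge_def using Wge_Obj Sh_Obj by blast

lemma w_le_Sh: "X \<in> w_le C W i \<Longrightarrow> j + i = k \<Longrightarrow> Sh C j X \<in> w_le C W k"
  unfolding w_le_def using Wle_Obj by (auto simp: Sh_Sh)

lemma w_ge_Sh: "X \<in> w_ge C W i \<Longrightarrow> j + i = k \<Longrightarrow> Sh C j X \<in> w_ge C W k"
  unfolding w_ge_def using Wge_Obj by (auto simp: Sh_Sh)

lemma w_le_0: "w_le C W 0 = Wle W"
  using Wle_Obj by (force simp: w_le_def shift_zero)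

lemma w_ge_0: "w_ge C W 0 = Wge W"
  using Wge_Obj by (force simp: w_ge_def shift_zero)

lemma w_ge_Suc: "w_ge C W (i + 1) \<subseteq> w_ge C W i"
proof
  fix X assume X: "X \<in> w_ge C W (i + 1)"
  then have "Sh C (- i) X \<in> w_ge C W 0" using w_ge_Sh[of X "i + 1" "- i" 1] w_ge_0 Wge_shift by auto
  from w_ge_Sh[OF this, of i] show "X \<in> w_ge C W i"
    using w_ge_Obj[OF X] by (simp add: Sh_Sh shift_zero)
qed

lemma w_ge_antimono: "X \<in> w_ge C W j \<Longrightarrow> i \<le> j \<Longrightarrow> X \<in> w_ge C W i"
proof -
  assume X: "X \<in> w_ge C W j" and "i \<le> j"
  from \<open>i \<le> j\<close> show ?thesis
  proof (induction i rule: int_le_induct)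
    case base
    then show ?case by (rule X)
  next
    case (step i)
    then show ?case using w_ge_Suc[of "i - 1"] by auto
  qed
qed

text \<open>Lower \<open>j\<close> to \<open>i + 1\<close> and shift by \<open>- i\<close> to reach
  the orthogonality axiom.\<close>

lemma orthogonal:
  assumes X: "X \<in> w_le C W i" and Y: "Y \<in> w_ge C W j" and ij: "i < j" and f: "f \<in> Hom C X Y"
  shows "f = Null C X Y"
proof (rule ShM_eq_Null[OF f])
  have "Y \<in> w_ge C W (i + 1)" using w_ge_antimono[OF Y] ij by simp
  then have "Hom C (Sh C (- i) X) (Sh C (- i) Y) = {Null C (Sh C (- i) X) (Sh C (- i) Y)}"
    using w_le_Sh[OF X, of "- i" 0] w_ge_Sh[of Y "i + 1" "- i" 1] by (simp add: orthogonality w_le_0)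
  then show "ShM C (- i) f = Null C (Sh C (- i) X) (Sh C (- i) Y)"
    using ShM_Hom[OF f, of "- i"] by blast
qed

lemma weight_decomposition_at:
  assumes M: "M \<in> Obj C"
  shows "\<exists>L R f g h. L \<in> w_le C W i \<and> R \<in> w_ge C W (i + 1) \<and> dist_triangle C L M R f g h"
proof -
  obtain L R f g h where LR: "L \<in> Wle W" "R \<in> w_ge C W 1" "dist_triangle C L (Sh C (- i) M) R f g h"
    using weight_decomposition[OF Sh_Obj[OF M]] by blast
  obtain f' g' h' where "dist_triangle C (Sh C i L) (Sh C i (Sh C (- i) M)) (Sh C i R) f' g' h'"
    using dist_triangle_shift[OF LR(3)] by blast
  then have "dist_triangle C (Sh C i L) M (Sh C i R) f' g' h'" using M by (simp add: Sh_Sh shift_zero)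
  moreover have "Sh C i L \<in> w_le C W i" "Sh C i R \<in> w_ge C W (i + 1)"
    using LR w_le_Sh[of L 0 i i] w_ge_Sh[of R 1 i] by (auto simp: w_le_0)
  ultimately show ?thesis by blast
qed

lemma w_ge_retract:
  assumes Y: "Y \<in> w_ge C W i" and s: "s \<in> Hom C X Y" and r: "r \<in> Hom C Y X" and rs: "r \<cdot> s = Ident C X"
  shows "X \<in> w_ge C W i"
proof -
  have X: "X \<in> Obj C" using s Hom_Dom by blast
  have "is_retract_of C (Sh C (- i) X) (Sh C (- i) Y)"
    unfolding is_retract_of_def
    using ShM_Hom[OF s, of "- i"] ShM_Hom[OF r, of "- i"] ShM_Comp[OF s r, of "- i"] rs
      Sh_Obj[OF X] Sh_Obj[OF w_ge_Obj[OF Y]] ShM_Ident[OF X] by metis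
  then have "Sh C (- i) X \<in> Wge W"
    using Wge_retract w_ge_Sh[OF Y, of "- i" 0] w_ge_0 by auto
  then show ?thesis using w_ge_Sh[of "Sh C (- i) X" 0 i i] X by (simp add: Sh_Sh shift_zero w_ge_0)
qed

lemma w_le_retract:
  assumes Y: "Y \<in> w_le C W i" and s: "s \<in> Hom C X Y" and r: "r \<in> Hom C Y X" and rs: "r \<cdot> s = Ident C X"
  shows "X \<in> w_le C W i"
proof -
  have X: "X \<in> Obj C" using s Hom_Dom by blast
  have "is_retract_of C (Sh C (- i) X) (Sh C (- i) Y)"
    unfolding is_retract_of_def
    using ShM_Hom[OF s, of "- i"] ShM_Hom[OF r, of "- i"] ShM_Comp[OF s r, of "- i"] rs
      Sh_Obj[OF X] Sh_Obj[OF w_le_Obj[OF Y]] ShM_Ident[OF X] by metis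
  then have "Sh C (- i) X \<in> Wle W"
    using Wle_retract w_le_Sh[OF Y, of "- i" 0] w_le_0 by auto
  then show ?thesis using w_le_Sh[of "Sh C (- i) X" 0 i i] X by (simp add: Sh_Sh shift_zero w_le_0)
qed

text \<open>Converse of orthogonality: the first arrow of a weight decomposition of \<open>X\<close>
  is zero by \<open>orth\<close>, so \<open>X\<close> is a retract of its part of weights at least
  \<open>i\<close>.\<close>

lemma w_geI:
  assumes X: "X \<in> Obj C"
    and orth: "\<And>V v. V \<in> w_le C W (i - 1) \<Longrightarrow> v \<in> Hom C V X \<Longrightarrow> v = Null C V X"
  shows "X \<in> w_ge C W i"
proof -
  obtain L R f g h where LR: "L \<in> w_le C W (i - 1)" "R \<in> w_ge C W i" "dist_triangle C L X R f g h"
    using weight_decomposition_at[OF X, of "i - 1"] by auto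
  note H = dist_triangle_Hom[OF LR(3)]
  obtain v where "v \<in> Hom C R X" "v \<cdot> g = Ident C X"
    using Null_first_imp_section[OF LR(3) orth[OF LR(1) H(1)]] .
  then show ?thesis using w_ge_retract[OF LR(2) H(2)] by blast
qed

lemma w_leI:
  assumes X: "X \<in> Obj C"
    and orth: "\<And>V v. V \<in> w_ge C W (i + 1) \<Longrightarrow> v \<in> Hom C X V \<Longrightarrow> v = Null C X V"
  shows "X \<in> w_le C W i"
proof -
  obtain L R f g h where LR: "L \<in> w_le C W i" "R \<in> w_ge C W (i + 1)" "dist_triangle C L X R f g h"
    using weight_decomposition_at[OF X] by blast
  note H = dist_triangle_Hom[OF LR(3)]
  have "g \<cdot> Ident C X = Null C X R" using Ident_right[OF H(2)] orth[OF LR(2) H(2)] by simp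
  then obtain v where "v \<in> Hom C X L" "f \<cdot> v = Ident C X"
    using dist_triangle_lift[OF LR(3) Ident_closed[OF X]] by blast
  then show ?thesis using w_le_retract[OF LR(1) _ H(1)] by blast
qed

text \<open>By \<open>w_geI\<close> it is enough to kill arrows into \<open>Y\<close>: they die in
  \<open>Z\<close>, so they come from \<open>X\<close>, where they are zero as well.\<close>

lemma w_ge_extension:
  assumes D: "dist_triangle C X Y Z f g h" and X: "X \<in> w_ge C W i" and Z: "Z \<in> w_ge C W i"
  shows "Y \<in> w_ge C W i"
proof (rule w_geI)
  note H = dist_triangle_Hom[OF D]
  show "Y \<in> Obj C" using H Hom_Dom by blast
  fix V u assume V: "V \<in> w_le C W (i - 1)" and u: "u \<in> Hom C V Y"
  have "g \<cdot> u = Null C V Z" using orthogonal[OF V Z] Comp_closed[OF u H(2)] by simp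
  then obtain v where v: "v \<in> Hom C V X" "f \<cdot> v = u" using dist_triangle_lift[OF D u] by blast
  then have "v = Null C V X" using orthogonal[OF V X] by simp
  then show "u = Null C V Y" using v(2) Comp_Null_right[OF H(1)] w_le_Obj[OF V] by simp
qed

lemma w_le_extension:
  assumes D: "dist_triangle C X Y Z f g h" and X: "X \<in> w_le C W i" and Z: "Z \<in> w_le C W i"
  shows "Y \<in> w_le C W i"
proof (rule w_leI)
  note H = dist_triangle_Hom[OF D]
  show "Y \<in> Obj C" using H Hom_Dom by blast
  fix V u assume V: "V \<in> w_ge C W (i + 1)" and u: "u \<in> Hom C Y V"
  have "u \<cdot> f = Null C X V" using orthogonal[OF X V] Comp_closed[OF H(1) u] by simp
  then obtain v where v: "v \<in> Hom C Z V" "v \<cdot> g = u" using dist_triangle_extend[OF D u] by blast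
  then have "v = Null C Z V" using orthogonal[OF Z V] by simp
  then show "u = Null C Y V" using v(2) Comp_Null_left[OF H(2)] w_ge_Obj[OF V] by simp
qed

section \<open>Existence and low-degree shape of weight complexes\<close>

lemma weight_complex_exists:
  assumes M: "M \<in> Obj C"
  shows "\<exists>T d. is_weight_complex C W M T d"
proof -
  obtain wl R h g k where D: "\<And>i. wl i \<in> w_le C W i" "\<And>i. R i \<in> w_ge C W (i + 1)"
      "\<And>i. dist_triangle C (wl i) M (R i) (h i) (g i) (k i)"
    using weight_decomposition_at[OF M] by metis
  have "\<exists>j. j \<in> Hom C (wl i) (wl (i + 1)) \<and> h (i + 1) \<cdot> j = h i" for i
  proof -
    have "g (i + 1) \<cdot> h i = Null C (wl i) (R (i + 1))"
      by (rule orthogonal[OF D(1) D(2) _ Comp_closed[OF dist_triangle_Hom(1)[OF D(3)] dist_triangle_Hom(2)[OF D(3)]]]) simp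
    from dist_triangle_lift[OF D(3) dist_triangle_Hom(1)[OF D(3)] this] show ?thesis by blast
  qed
  then obtain j where j: "\<And>i. j i \<in> Hom C (wl i) (wl (i + 1))" "\<And>i. h (i + 1) \<cdot> j i = h i"
    by metis
  have "\<exists>N c e. dist_triangle C (wl i) (wl (i + 1)) N (j i) c e" for i
    using TR1_cone[OF j(1)] by blast
  then obtain N c e where N: "\<And>i. dist_triangle C (wl i) (wl (i + 1)) (N i) (j i) (c i) (e i)"
    by metis
  \<comment> \<open>Reindexing: \<open>R i\<close> plays the role of \<open>wg (i + 1)\<close>, and
    the cone here is indexed by the source of \<open>j i\<close>, whereas the definition indexes it
    by the target; hence the shifts by -1.\<close>
  show ?thesis
    unfolding is_weight_complex_def
    by (rule exI[of _ "\<lambda>i. Sh C i (N (- i - 1))"],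
        rule exI[of _ "\<lambda>i. ShM C (i + 1) (c (- i - 1 - 1)) \<cdot> ShM C i (e (- i - 1))"],
        rule exI[of _ wl], rule exI[of _ "\<lambda>i. R (i - 1)"], rule exI[of _ h], rule exI[of _ g],
        rule exI[of _ k], rule exI[of _ j], rule exI[of _ "\<lambda>i. N (i - 1)"],
        rule exI[of _ "\<lambda>i. c (i - 1)"], rule exI[of _ e])
      (use D D(2)[of "i - 1" for i] j N[of "i - 1" for i] in simp)
qed

text \<open>For \<open>M \<in> C\<^sub>w\<^sub>\<ge>\<^sub>0\<close> the term in degree 0 splits as \<open>L \<oplus> E\<close>, where \<open>E\<close> is
  also a summand of the term in degree 1; hence the homology in degree 0 is governed by \<open>p\<close> alone.\<close>

lemma weight_complex_nonneg:
  assumes M: "M \<in> w_ge C W 0" and T: "is_weight_complex C W M T d"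
  obtains L E p c q m r r' s m' where
    "L \<in> Wge W \<inter> Wle W" "E \<in> Wge W \<inter> Wle W" "T (- 1) \<in> Wge W \<inter> Wle W"
    "T 0 \<in> Wge W \<inter> Wle W" "T 1 \<in> Wge W \<inter> Wle W"
    "p \<in> Hom C (T (- 1)) L" "c \<in> Hom C L (T 0)" "q \<in> Hom C (T 0) E" "m \<in> Hom C E (T 1)"
    "d (- 1) = c \<cdot> p" "d 0 = m \<cdot> q" "q \<cdot> c = Null C L E"
    "r \<in> Hom C (T 0) L" "r \<cdot> c = Ident C L"
    "r' \<in> Hom C (T 0) L" "s \<in> Hom C E (T 0)" "Plus C (c \<cdot> r') (s \<cdot> q) = Ident C (T 0)"
    "m' \<in> Hom C (T 1) E" "m' \<cdot> m = Ident C E"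
    "(\<exists>t\<in>Hom C L (T (- 1)). p \<cdot> t = Ident C L) \<longleftrightarrow> M \<in> w_ge C W 1"
proof -
  obtain wl wg h g k j N c e where
    *: "\<forall>i. wl i \<in> w_le C W i \<and> wg i \<in> w_ge C W i"
      "\<forall>i. dist_triangle C (wl i) M (wg (i + 1)) (h i) (g i) (k i)"
      "\<forall>i. j i \<in> Hom C (wl i) (wl (i + 1)) \<and> h (i + 1) \<cdot> j i = h i"
      "\<forall>i. dist_triangle C (wl (i - 1)) (wl i) (N i) (j (i - 1)) (c i) (e (i - 1))"
      "\<forall>p. T p = Sh C p (N (- p))"
      "\<forall>i. d i = ShM C (i + 1) (c (- i - 1)) \<cdot> ShM C i (e (- i - 1))"
    using T unfolding is_weight_complex_def by (elim exE conjE) (rule that)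
  have wl: "wl i \<in> w_le C W i" and wg: "wg i \<in> w_ge C W i"
    and D: "dist_triangle C (wl i) M (wg (i + 1)) (h i) (g i) (k i)"
    and j: "j i \<in> Hom C (wl i) (wl (i + 1))" "h (i + 1) \<cdot> j i = h i"
    and N: "dist_triangle C (wl (i - 1)) (wl i) (N i) (j (i - 1)) (c i) (e (i - 1))"
    and Tp: "T i = Sh C i (N (- i))"
    and d: "d i = ShM C (i + 1) (c (- i - 1)) \<cdot> ShM C i (e (- i - 1))" for i
    using * by auto
  \<comment> \<open>Rotated back, the decomposition makes \<open>wl i\<close> an extension of
    \<open>M\<close> by \<open>wg (i + 1)\<close> shifted by -1, whose weights are at least
    \<open>i\<close>.\<close>
  have wlge: "wl i \<in> w_ge C W n" if "M \<in> w_ge C W n" "n \<le> i" for i n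
    using w_ge_extension[OF dist_triangle_rotate_back[OF D] w_ge_antimono[OF w_ge_Sh[OF wg] that(2)] that(1)]
    by simp
  have wlge': "wl i \<in> w_ge C W i" if "i \<le> 0" for i
    using w_ge_extension[OF dist_triangle_rotate_back[OF D] w_ge_Sh[OF wg] w_ge_antimono[OF M that], of i]
    by simp
  have ob: "wl i \<in> Obj C" for i using wl w_le_Obj by blast
  note N1 = N[of 1, simplified] and N0 = N[of 0, simplified] and Nm = N[of "- 1", simplified]
  note H1 = dist_triangle_Hom[OF N1] and H0 = dist_triangle_Hom[OF N0] and Hm = dist_triangle_Hom[OF Nm]
  have Nob: "N i \<in> Obj C" for i using dist_triangle_Hom[OF N[of i]] Hom_Cod by blast
  \<comment> \<open>For \<open>i < 0\<close> the arrow \<open>j i\<close> goes from weights at most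
    \<open>i\<close> to weights at least \<open>i + 1\<close>. This breaks down for
    \<open>j 0\<close>, since \<open>wl 1\<close> is only known to have weights at least 0;
    \<open>j 0\<close> is the arrow that will measure whether \<open>M\<close> has weights at least
    1.\<close>
  have jm1: "j (- 1) = Null C (wl (- 1)) (wl 0)"
    using orthogonal[OF wl wlge', of 0 "- 1"] j(1)[of "- 1"] by simp
  have jm2: "j (- 2) = Null C (wl (- 2)) (wl (- 1))"
    using orthogonal[OF wl wlge', of "- 1" "- 2"] j(1)[of "- 2"] by simp
  have Nle: "N i \<in> w_le C W i" for i
    by (rule w_le_extension[OF dist_triangle_rotate[OF N] wl]) (rule w_le_Sh[OF wl], simp)
  have Nge: "N i \<in> w_ge C W i" if "i \<le> 0" for i
    by (rule w_ge_extension[OF dist_triangle_rotate[OF N] wlge'[OF that]])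
      (rule w_ge_Sh[OF wlge'], use that in auto)
  \<comment> \<open>Extension closure would only give weights at least 0, so arrows \<open>v\<close>
    from weights at most 0 are shown to vanish directly. Orthogonality lifts \<open>v\<close> to
    \<open>x\<close> into \<open>wl 1\<close>.\<close>
  have N1ge: "N 1 \<in> w_ge C W 1"
  proof (rule w_geI[OF Nob])
    fix V v assume "V \<in> w_le C W (1 - 1)" and v: "v \<in> Hom C V (N 1)"
    then have V: "V \<in> w_le C W 0" by simp
    note Vob = w_le_Obj[OF V]
    have "e 0 \<cdot> v = Null C V (Sh C 1 (wl 0))"
      by (rule orthogonal[OF V w_ge_Sh[OF wlge', of 0 1 1] _ Comp_closed[OF v H1(3)]]) auto
    then obtain x where x: "x \<in> Hom C V (wl 1)" "c 1 \<cdot> x = v"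
      using dist_triangle_lift[OF dist_triangle_rotate[OF N1] v] by blast
    note D0 = D[of 0, simplified] and D1 = D[of 1, simplified]
    note HD0 = dist_triangle_Hom[OF D0] and HD1 = dist_triangle_Hom[OF D1]
    note hx = Comp_closed[OF x(1) HD1(1)]
    have "g 0 \<cdot> h 1 \<cdot> x = Null C V (wg 1)"
      by (rule orthogonal[OF V wg _ Comp_closed[OF hx HD0(2)]]) simp
    then obtain y where y: "y \<in> Hom C V (wl 0)" "h 0 \<cdot> y = h 1 \<cdot> x"
      using dist_triangle_lift[OF D0 hx] by blast
    note jy = Comp_closed[OF y(1) H1(1)]
    have hj: "h 1 \<cdot> j 0 \<cdot> y = h 1 \<cdot> x"
      using Comp_assoc[OF y(1) H1(1) HD1(1)] j(2)[of 0] y(2) by simp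
    \<comment> \<open>\<open>x\<close> and \<open>j 0 \<cdot> y\<close> agree in \<open>M\<close>,
      so their difference comes from \<open>wg 2\<close> shifted by -1, of weights at least 1, and
      is zero. Then \<open>v\<close> factors through \<open>c 1 \<cdot> j 0\<close>, which is
      zero.\<close>
    let ?z = "Plus C x (Neg C (j 0 \<cdot> y))"
    have z: "?z \<in> Hom C V (wl 1)" by (rule Plus_closed[OF x(1) Neg_closed[OF jy]])
    have "h 1 \<cdot> ?z = Null C V M"
      using Comp_Plus_right[OF x(1) Neg_closed[OF jy] HD1(1)] Comp_Neg_right[OF jy HD1(1)] hj
        Plus_Neg[OF hx] by simp
    then obtain w where w: "w \<in> Hom C V (Sh C (- 1) (wg 2))"
        "Neg C (ShM C (- 1) (k 1)) \<cdot> w = ?z"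
      using dist_triangle_lift[OF dist_triangle_rotate_back[OF D1] z] by blast
    have "w = Null C V (Sh C (- 1) (wg 2))"
      by (rule orthogonal[OF V w_ge_Sh[OF wg, of "- 1" 2 1] _ w(1)]) auto
    then have "?z = Null C V (wl 1)"
      using w(2) Comp_Null_right[OF dist_triangle_Hom(1)[OF dist_triangle_rotate_back[OF D1]] Vob] by simp
    then have "x = j 0 \<cdot> y"
      using Neg_unique[OF x(1) Neg_closed[OF jy]] Neg_Neg[OF x(1)] Neg_Neg[OF jy] by metis
    then have "v = (c 1 \<cdot> j 0) \<cdot> y" using x(2) Comp_assoc[OF y(1) H1(1) H1(2)] by simp
    then show "v = Null C V (N 1)"
      using dist_triangle_Comp[OF N1] Comp_Null_left[OF y(1) Nob] by simp
  qed
  obtain r where r: "r \<in> Hom C (N 0) (wl 0)" "r \<cdot> c 0 = Ident C (wl 0)"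
    using Null_first_imp_section[OF N0 jm1] by blast
  obtain s where s: "s \<in> Hom C (Sh C 1 (wl (- 1))) (N 0)" "e (- 1) \<cdot> s = Ident C (Sh C 1 (wl (- 1)))"
    using Null_first_iff_split[OF N0] jm1 by blast
  obtain v where v: "v \<in> Hom C (N (- 1)) (wl (- 1))" "v \<cdot> c (- 1) = Ident C (wl (- 1))"
    using Null_first_imp_section[OF Nm jm2] by blast
  have qc: "e (- 1) \<cdot> c 0 = Null C (wl 0) (Sh C 1 (wl (- 1)))"
    by (rule dist_triangle_Comp[OF dist_triangle_rotate[OF N0]])
  have sq: "s \<cdot> e (- 1) \<in> Hom C (N 0) (N 0)" using Comp_closed[OF H0(3) s(1)] .
  \<comment> \<open>The projector complementary to \<open>s \<cdot> e (- 1)\<close>. It is killed by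
    \<open>e (- 1)\<close>, so it factors through \<open>c 0\<close>; the factor \<open>r'\<close>
    is obtained separately from the retraction \<open>r\<close>.\<close>
  let ?z = "Plus C (Ident C (N 0)) (Neg C (s \<cdot> e (- 1)))"
  note idN = Ident_closed[OF Nob[of 0]]
  have z: "?z \<in> Hom C (N 0) (N 0)" by (rule Plus_closed[OF idN Neg_closed[OF sq]])
  have "e (- 1) \<cdot> s \<cdot> e (- 1) = e (- 1)"
    using Comp_assoc[OF H0(3) s(1) H0(3)] s(2) Ident_left[OF H0(3)] by simp
  then have "e (- 1) \<cdot> ?z = Null C (N 0) (Sh C 1 (wl (- 1)))"
    using Comp_Plus_right[OF idN Neg_closed[OF sq] H0(3)] Comp_Neg_right[OF sq H0(3)]
      Ident_right[OF H0(3)] Plus_Neg[OF H0(3)] by simp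
  then obtain r' where r': "r' \<in> Hom C (N 0) (wl 0)" "c 0 \<cdot> r' = ?z"
    using dist_triangle_lift[OF dist_triangle_rotate[OF N0] z] by blast
  have sum: "Plus C (c 0 \<cdot> r') (s \<cdot> e (- 1)) = Ident C (N 0)"
    using Plus_assoc[OF idN Neg_closed[OF sq] sq] Plus_comm[OF sq Neg_closed[OF sq]] Plus_Neg[OF sq]
      Plus_Null[OF idN] r'(2) by simp
  \<comment> \<open>\<open>Null_first_iff_split\<close> speaks of splittings of \<open>e 0\<close>,
    while the differential contains its shift by -1; both directions merely shift the
    splitting.\<close>
  have "(\<exists>t\<in>Hom C (wl 0) (Sh C (- 1) (N 1)). ShM C (- 1) (e 0) \<cdot> t = Ident C (wl 0)) \<longleftrightarrow>
      j 0 = Null C (wl 0) (wl 1)"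
  proof
    assume "\<exists>t\<in>Hom C (wl 0) (Sh C (- 1) (N 1)). ShM C (- 1) (e 0) \<cdot> t = Ident C (wl 0)"
    then obtain t where t: "t \<in> Hom C (wl 0) (Sh C (- 1) (N 1))" "ShM C (- 1) (e 0) \<cdot> t = Ident C (wl 0)"
      by blast
    have "ShM C 1 t \<in> Hom C (Sh C 1 (wl 0)) (N 1)"
      using ShM_Hom[OF t(1), of 1] Nob[of 1] by (simp add: Sh_Sh shift_zero)
    moreover have "e 0 \<cdot> ShM C 1 t = Ident C (Sh C 1 (wl 0))"
      using ShM_Comp[OF t(1) , of "ShM C (- 1) (e 0)" "wl 0" 1] ShM_Hom[OF H1(3), of "- 1"] t(2) ob[of 0]
      by (simp add: ShM_ShM[OF H1(3)] ShM_0[OF H1(3)] ShM_Ident Sh_Sh shift_zero)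
    ultimately show "j 0 = Null C (wl 0) (wl 1)" using Null_first_iff_split[OF N1] by blast
  next
    assume "j 0 = Null C (wl 0) (wl 1)"
    then obtain t where t: "t \<in> Hom C (Sh C 1 (wl 0)) (N 1)" "e 0 \<cdot> t = Ident C (Sh C 1 (wl 0))"
      using Null_first_iff_split[OF N1] by blast
    have "ShM C (- 1) t \<in> Hom C (wl 0) (Sh C (- 1) (N 1))"
      using ShM_Hom[OF t(1), of "- 1"] ob[of 0] by (simp add: Sh_Sh shift_zero)
    moreover have "ShM C (- 1) (e 0) \<cdot> ShM C (- 1) t = Ident C (wl 0)"
      using ShM_Comp[OF t(1) H1(3), of "- 1"] t(2) ob[of 0] Sh_Obj[OF ob[of 0], of 1]
      by (simp add: ShM_Ident Sh_Sh shift_zero)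
    ultimately show "\<exists>t\<in>Hom C (wl 0) (Sh C (- 1) (N 1)). ShM C (- 1) (e 0) \<cdot> t = Ident C (wl 0)" by blast
  qed
  \<comment> \<open>If \<open>j 0\<close> vanishes, so does \<open>h 0 = h 1 \<cdot> j 0\<close>,
    and \<open>M\<close> becomes a retract of \<open>wg 1\<close>. Conversely, weights of
    \<open>M\<close> at least 1 force the same for \<open>wl 1\<close>, and \<open>j 0\<close> is
    zero by orthogonality.\<close>
  also have "j 0 = Null C (wl 0) (wl 1) \<longleftrightarrow> M \<in> w_ge C W 1"
  proof
    assume j0: "j 0 = Null C (wl 0) (wl 1)"
    note D0 = D[of 0, simplified] and D1 = D[of 1, simplified]
    have "h 0 = Null C (wl 0) M"
      using j(2)[of 0] j0 Comp_Null_right[OF dist_triangle_Hom(1)[OF D1] ob] by simp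
    then show "M \<in> w_ge C W 1"
      using Null_first_imp_section[OF D0] w_ge_retract[OF wg dist_triangle_Hom(2)[OF D0]] by blast
  next
    assume "M \<in> w_ge C W 1"
    then show "j 0 = Null C (wl 0) (wl 1)"
      using orthogonal[OF wl wlge, of 1 1 0] j(1)[of 0] by simp
  qed
  finally have main: "(\<exists>t\<in>Hom C (wl 0) (Sh C (- 1) (N 1)). ShM C (- 1) (e 0) \<cdot> t = Ident C (wl 0)) \<longleftrightarrow>
      M \<in> w_ge C W 1" .
  have T0: "T 0 = N 0" and T1: "T 1 = Sh C 1 (N (- 1))" and Tm: "T (- 1) = Sh C (- 1) (N 1)"
    using Tp[of 0] Tp[of 1] Tp[of "- 1"] Nob[of 0] by (simp_all add: shift_zero)
  show ?thesis
  \<comment> \<open>\<open>E\<close> is \<open>wl (- 1)\<close> shifted by 1: \<open>e (- 1)\<close>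
    projects \<open>N 0\<close> onto it, and the shift of \<open>c (- 1)\<close> embeds it into
    \<open>T 1\<close>, split by the shift of \<open>v\<close>.\<close>
  proof (rule that[of "wl 0" "Sh C 1 (wl (- 1))" "ShM C (- 1) (e 0)" "c 0" "e (- 1)" "ShM C 1 (c (- 1))"
        r r' s "ShM C 1 v"], unfold T0 T1 Tm)
    show "wl 0 \<in> Wge W \<inter> Wle W" using wl[of 0] wlge'[of 0] by (simp add: w_ge_0 w_le_0)
    show "Sh C 1 (wl (- 1)) \<in> Wge W \<inter> Wle W"
      using w_ge_Sh[OF wlge', of "- 1" 1 0] w_le_Sh[OF wl, of "1" "- 1" 0] by (simp add: w_ge_0 w_le_0)
    show "Sh C (- 1) (N 1) \<in> Wge W \<inter> Wle W"
      using w_ge_Sh[OF N1ge, of "- 1" 0] w_le_Sh[OF Nle, of "- 1" 1 0] by (simp add: w_ge_0 w_le_0)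
    show "N 0 \<in> Wge W \<inter> Wle W" using Nle[of 0] Nge[of 0] by (simp add: w_ge_0 w_le_0)
    show "Sh C 1 (N (- 1)) \<in> Wge W \<inter> Wle W"
      using w_ge_Sh[OF Nge, of "- 1" 1 0] w_le_Sh[OF Nle, of "1" "- 1" 0] by (simp add: w_ge_0 w_le_0)
    show "ShM C (- 1) (e 0) \<in> Hom C (Sh C (- 1) (N 1)) (wl 0)"
      using ShM_Hom[OF H1(3), of "- 1"] ob[of 0] by (simp add: Sh_Sh shift_zero)
    show "d (- 1) = c 0 \<cdot> ShM C (- 1) (e 0)" using d[of "- 1"] ShM_0[OF H0(2)] by simp
    show "d 0 = ShM C 1 (c (- 1)) \<cdot> e (- 1)" using d[of 0] ShM_0[OF H0(3)] by simp
    show "ShM C 1 v \<cdot> ShM C 1 (c (- 1)) = Ident C (Sh C 1 (wl (- 1)))"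
      using ShM_Comp[OF Hm(2) v(1), of 1] v(2) ob by (simp add: ShM_Ident)
  qed (use H0 qc r r' s sum main ShM_Hom[OF v(1)] ShM_Hom[OF Hm(2)] in auto)
qed

end

text \<open>\<open>c\<close> is a kernel of \<open>q\<close>, and thus of \<open>m \<cdot> q\<close>.\<close>

lemma (in preadditive_category) split_homology_zero_iff:
  assumes p: "p \<in> Hom C P L" and c: "c \<in> Hom C L S" and q: "q \<in> Hom C S E" and m: "m \<in> Hom C E U"
    and qc: "q \<cdot> c = Null C L E" and r: "r \<in> Hom C S L" "r \<cdot> c = Ident C L"
    and r': "r' \<in> Hom C S L" and s: "s \<in> Hom C E S" and sum: "Plus C (c \<cdot> r') (s \<cdot> q) = Ident C S"
    and m': "m' \<in> Hom C U E" "m' \<cdot> m = Ident C E"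
    and K: "is_homology C (c \<cdot> p) (m \<cdot> q) K"
  shows "is_zero_object C K \<longleftrightarrow> is_epi C p"
proof -
  have cp: "c \<cdot> p \<in> Hom C P S" and mq: "m \<cdot> q \<in> Hom C S U" using Comp_closed p c q m by blast+
  note simps = Hom_simps[OF cp] Hom_simps[OF mq] Hom_simps[OF p]
  obtain k u z where k: "is_kernel C (m \<cdot> q) k" and u: "u \<in> Hom C P (Dom C k)" and ku: "k \<cdot> u = c \<cdot> p"
    and z: "is_cokernel C u z" and Kz: "Cod C z = K"
    using K simps unfolding is_homology_def by auto
  define I where "I = Dom C k"
  have kH: "k \<in> Hom C I S" using k simps by (simp add: is_kernel_def I_def Hom_def)
  have zH: "z \<in> Hom C I K" using z u Kz by (simp add: is_cokernel_def I_def Hom_def)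
  have uH: "u \<in> Hom C P I" using u by (simp add: I_def)
  have ob: "P \<in> Obj C" "L \<in> Obj C" "S \<in> Obj C" "E \<in> Obj C" "U \<in> Obj C" "I \<in> Obj C" "K \<in> Obj C"
    using p c q m kH zH Hom_Dom Hom_Cod by blast+
  have mqk: "(m \<cdot> q) \<cdot> k = Null C I U" using k simps by (simp add: is_kernel_def I_def)
  have kU: "\<exists>!u. u \<in> Hom C X I \<and> k \<cdot> u = g" if "g \<in> Hom C X S" "(m \<cdot> q) \<cdot> g = Null C X U" for X g
    using k that simps unfolding is_kernel_def I_def by auto
  have zU: "\<exists>!u. u \<in> Hom C K X \<and> u \<cdot> z = g" if "g \<in> Hom C I X" "g \<cdot> u = Null C P X" for X g
    using z that Hom_simps[OF uH] Kz unfolding is_cokernel_def by auto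
  have zu: "z \<cdot> u = Null C P K" using z Hom_simps[OF uH] Kz unfolding is_cokernel_def by auto
  \<comment> \<open>The kernel \<open>k\<close> in the given homology is arbitrary; \<open>a\<close>
    and \<open>b\<close> below are the mutually inverse comparison arrows between it and
    \<open>c\<close>.\<close>
  have "(m \<cdot> q) \<cdot> c = Null C L U"
    using Comp_assoc[OF c q m] qc Comp_Null_right[OF m ob(2)] by simp
  then obtain a where a: "a \<in> Hom C L I" "k \<cdot> a = c" using kU[OF c] by blast
  \<comment> \<open>The left inverse \<open>m'\<close> cancels \<open>m\<close>, so what
    \<open>m \<cdot> q\<close> kills is already killed by \<open>q\<close>.\<close>
  have "q \<cdot> k = Ident C E \<cdot> q \<cdot> k" using Ident_left[OF Comp_closed[OF kH q]] by simp
  also have "\<dots> = m' \<cdot> m \<cdot> q \<cdot> k"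
    using Comp_assoc[OF Comp_closed[OF kH q] m m'(1)] m'(2) by simp
  also have "\<dots> = Null C I E"
    using mqk Comp_assoc[OF kH q m] Comp_Null_right[OF m'(1) ob(6)] by simp
  finally have qk: "q \<cdot> k = Null C I E" .
  define b where "b = r' \<cdot> k"
  have b: "b \<in> Hom C I L" unfolding b_def using Comp_closed[OF kH r'] .
  have "k = Plus C (c \<cdot> r') (s \<cdot> q) \<cdot> k" using sum Ident_left[OF kH] by simp
  also have "\<dots> = Plus C (c \<cdot> b) (s \<cdot> q \<cdot> k)"
    using Comp_Plus_left[OF kH Comp_closed[OF r' c] Comp_closed[OF q s]]
      Comp_assoc[OF kH r' c] Comp_assoc[OF kH q s] by (simp add: b_def)
  also have "\<dots> = c \<cdot> b"
    using qk Comp_Null_right[OF s ob(6)] Plus_Null[OF Comp_closed[OF b c]] by simp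
  finally have cb: "c \<cdot> b = k" by simp
  have ab: "a \<cdot> b = Ident C I"
  proof -
    have "k \<cdot> a \<cdot> b = k" using Comp_assoc[OF b a(1) kH] a(2) cb by simp
    then show ?thesis
      using kU[OF kH mqk] Comp_closed[OF b a(1)] Ident_closed[OF ob(6)] Ident_right[OF kH] by blast
  qed
  have up: "u = a \<cdot> p"
  proof -
    have "(m \<cdot> q) \<cdot> c \<cdot> p = Null C P U"
      using Comp_assoc[OF p c mq] \<open>(m \<cdot> q) \<cdot> c = Null C L U\<close> Comp_Null_left[OF p ob(5)] by simp
    moreover have "k \<cdot> a \<cdot> p = c \<cdot> p" using Comp_assoc[OF p a(1) kH] a(2) by simp
    ultimately show ?thesis using kU[OF cp] uH Comp_closed[OF p a(1)] ku by blast
  qed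
  have ba: "b \<cdot> a = Ident C L"
  proof -
    have "c \<cdot> b \<cdot> a = c" using Comp_assoc[OF a(1) b c] cb a(2) by simp
    then have "(r \<cdot> c) \<cdot> b \<cdot> a = r \<cdot> c" using Comp_assoc[OF Comp_closed[OF a(1) b] c r(1)] by simp
    then show ?thesis using r(2) Ident_left[OF Comp_closed[OF a(1) b]] by simp
  qed
  show ?thesis
  proof
    assume "is_zero_object C K"
    show "is_epi C p"
      unfolding is_epi_def
    proof (intro conjI allI ballI impI)
      show "p \<in> Arr C" using simps by simp
      fix X x y assume "x \<in> Hom C (Cod C p) X" "y \<in> Hom C (Cod C p) X" and xy: "x \<cdot> p = y \<cdot> p"
      then have x: "x \<in> Hom C L X" and y: "y \<in> Hom C L X" using simps by auto
      \<comment> \<open>Since \<open>b \<cdot> u = p\<close>, an arrow killing \<open>p\<close>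
        gives one killing \<open>u\<close>, which factors through the cokernel \<open>K\<close>;
        with \<open>K\<close> zero it vanishes, and \<open>a\<close> undoes
        \<open>b\<close>.\<close>
      let ?w = "Plus C x (Neg C y)"
      have w: "?w \<in> Hom C L X" by (rule Plus_closed[OF x Neg_closed[OF y]])
      have wp: "?w \<cdot> p = Null C P X"
        using Comp_Plus_left[OF p x Neg_closed[OF y]] Comp_Neg_left[OF p y] xy Plus_Neg[OF Comp_closed[OF p y]]
        by simp
      have bu: "b \<cdot> u = p" using up Comp_assoc[OF p a(1) b] ba Ident_left[OF p] by simp
      have "(?w \<cdot> b) \<cdot> u = Null C P X" using Comp_assoc[OF uH b w] bu wp by simp
      then obtain v where v: "v \<in> Hom C K X" "v \<cdot> z = ?w \<cdot> b" using zU[OF Comp_closed[OF b w]] by blast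
      have X: "X \<in> Obj C" using x Hom_Cod by blast
      have "v = Null C K X" using zero_object_Hom_eq(2)[OF \<open>is_zero_object C K\<close> v(1)] Null_closed ob X by blast
      then have "?w \<cdot> b = Null C I X" using v(2) Comp_Null_left[OF zH X] by simp
      then have "?w \<cdot> b \<cdot> a = Null C L X" using Comp_assoc[OF a(1) b w] Comp_Null_left[OF a(1) X] by simp
      then have "?w = Null C L X" using ba Ident_right[OF w] by simp
      then show "x = y" using Neg_unique[OF x Neg_closed[OF y]] Neg_Neg[OF x] Neg_Neg[OF y] by metis
    qed
  next
    assume epi: "is_epi C p"
    \<comment> \<open>\<open>u = a \<cdot> p\<close> reduces \<open>z \<cdot> u = 0\<close> to
      \<open>z \<cdot> a = 0\<close>, so the cokernel arrow \<open>z\<close> is zero. Uniqueness of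
      factorizations through it then identifies the identity of \<open>K\<close> with zero.\<close>
    have za: "z \<cdot> a \<in> Hom C L K" using Comp_closed[OF a(1) zH] .
    have "(z \<cdot> a) \<cdot> p = Null C L K \<cdot> p"
      using Comp_assoc[OF p a(1) zH] up zu Comp_Null_left[OF p ob(7)] by simp
    then have "z \<cdot> a = Null C L K"
      using epi za Null_closed[OF ob(2,7)] simps unfolding is_epi_def by blast
    then have "(z \<cdot> a) \<cdot> b = Null C I K" using Comp_Null_left[OF b ob(7)] by simp
    then have z0: "z = Null C I K" using Comp_assoc[OF b a(1) zH] ab Ident_right[OF zH] by simp
    have "Ident C K \<cdot> z = z" "Null C K K \<cdot> z = z"
      using Ident_left[OF zH] Comp_Null_left[OF zH ob(7)] z0 by auto
    then have "Ident C K = Null C K K"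
      using zU[OF zH zu] Ident_closed[OF ob(7)] Null_closed[OF ob(7,7)] by blast
    then show "is_zero_object C K" by (rule zero_object_if_Ident_Null[OF ob(7)])
  qed
qed

lemma (in abelian_category) homology_exists:
  assumes f: "f \<in> Hom C X Y" and g: "g \<in> Hom C Y Z" and gf: "g \<cdot> f = Null C X Z"
  shows "\<exists>K. is_homology C f g K"
proof -
  obtain k where k: "is_kernel C g k" using kernel_exists Hom_simps[OF g] by blast
  then obtain u where u: "u \<in> Hom C X (Dom C k)" "k \<cdot> u = f"
    using f gf Hom_simps[OF g] unfolding is_kernel_def by metis
  obtain q where "is_cokernel C u q" using cokernel_exists Hom_simps[OF u(1)] by blast
  then show ?thesis unfolding is_homology_def using k u Hom_simps[OF f] by blast
qed

lemma (in category) split_surjective_is_epi: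
  assumes "is_split_surjective C p"
  shows "is_epi C p"
proof -
  obtain s where p: "p \<in> Arr C" and s: "s \<in> Hom C (Cod C p) (Dom C p)" "p \<cdot> s = Ident C (Cod C p)"
    using assms unfolding is_split_surjective_def by blast
  show ?thesis unfolding is_epi_def
  proof (intro conjI allI ballI impI p)
    fix X x y assume x: "x \<in> Hom C (Cod C p) X" and y: "y \<in> Hom C (Cod C p) X" and xy: "x \<cdot> p = y \<cdot> p"
    have "x = (x \<cdot> p) \<cdot> s"
      using Comp_assoc[OF s(1) Hom_self[OF p] x] s(2) Ident_right[OF x] by simp
    also have "\<dots> = y"
      unfolding xy using Comp_assoc[OF s(1) Hom_self[OF p] y] s(2) Ident_right[OF y] by simp
    finally show "x = y" .
  qed
qed

lemma (in category) epi_onto_projective_split: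
  assumes "is_epi C p" "is_projective C (Cod C p)"
  shows "is_split_surjective C p"
  using assms Ident_closed[of "Cod C p"] unfolding is_projective_def is_split_surjective_def is_epi_def
  by blast

section \<open>Vanishing of weight homology\<close>

lemma Hom_full_subcat: "f \<in> Hom (full_subcat C S) X Y \<longleftrightarrow> f \<in> Hom C X Y \<and> X \<in> S \<and> Y \<in> S"
  by (auto simp: Hom_def full_subcat_def)

lemma full_subcat_simps:
  "Obj (full_subcat C S) = S" "Dom (full_subcat C S) = Dom C" "Cod (full_subcat C S) = Cod C"
  "Ident (full_subcat C S) = Ident C" "Comp (full_subcat C S) = Comp C"
  "Plus (full_subcat C S) = Plus C" "Null (full_subcat C S) = Null C"
  by (simp_all add: full_subcat_def)

lemma Arr_full_subcat: "f \<in> Arr (full_subcat C S) \<longleftrightarrow> f \<in> Arr C \<and> Dom C f \<in> S \<and> Cod C f \<in> S"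
  by (simp add: full_subcat_def)

lemma (in category) category_full_subcat:
  assumes "S \<subseteq> Obj C"
  shows "category (full_subcat C S)"
  using assms
  by unfold_locales
    (auto simp: Hom_full_subcat full_subcat_simps Arr_full_subcat
      intro: Ident_closed Comp_closed Ident_left Ident_right Comp_assoc)

lemma (in preadditive_category) preadditive_category_full_subcat:
  assumes "S \<subseteq> Obj C"
  shows "preadditive_category (full_subcat C S)"
proof -
  interpret S: category "full_subcat C S" by (rule category_full_subcat[OF assms])
  have "hom_group (full_subcat C S) X Y = hom_group C X Y" if "X \<in> S" "Y \<in> S" for X Y
    using that by (auto simp: hom_group_def Hom_full_subcat full_subcat_simps)
  then have "preadditive_category_axioms (full_subcat C S)"
    using assms Hom_group Comp_Plus_left Comp_Plus_right
    by (intro preadditive_category_axioms.intro)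
      (auto simp: Hom_full_subcat full_subcat_simps subset_eq)
  then show ?thesis by (rule preadditive_category.intro[OF S.category_axioms])
qed

lemma full_conservative_preserves_non_split_surjectivity:
  assumes "category C" "category D" and F: "is_functor C D F"
    and full: "is_full C D F" and cons: "is_conservative C D F"
  shows "preserves_non_split_surjectivity C D F"
  unfolding preserves_non_split_surjectivity_def
proof (intro ballI impI)
  interpret C: category C by fact
  interpret D: category D by fact
  fix h assume h: "h \<in> Arr C" and ns: "\<not> is_split_surjective C h"
  show "\<not> is_split_surjective D (MMap F h)"
  proof
    let ?X = "Dom C h" and ?Y = "Cod C h"
    assume sp: "is_split_surjective D (MMap F h)"
    have hH: "h \<in> Hom C ?X ?Y" by (rule C.Hom_self[OF h])
    have FhH: "MMap F h \<in> Hom D (OMap F ?X) (OMap F ?Y)" by (rule functor_Hom[OF F hH])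
    obtain s where s: "s \<in> Hom D (OMap F ?Y) (OMap F ?X)"
        "MMap F h \<cdot>\<^bsub>D\<^esub> s = Ident D (OMap F ?Y)"
      using sp Hom_simps[OF FhH] unfolding is_split_surjective_def by auto
    have ob: "?X \<in> Obj C" "?Y \<in> Obj C" using C.Hom_Dom[OF hH] C.Hom_Cod[OF hH] by auto
    obtain t where t: "t \<in> Hom C ?Y ?X" "MMap F t = s"
      using full s(1) ob unfolding is_full_def by blast
    have ht: "h \<cdot>\<^bsub>C\<^esub> t \<in> Hom C ?Y ?Y" by (rule C.Comp_closed[OF t(1) hH])
    have Fob: "OMap F ?Y \<in> Obj D" by (rule functor_Obj[OF F ob(2)])
    have "MMap F (h \<cdot>\<^bsub>C\<^esub> t) = Ident D (OMap F ?Y)"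
      using functor_Comp[OF F t(1) hH] s(2) t(2) by simp
    moreover have "is_iso D (Ident D (OMap F ?Y))"
      using D.Ident_closed[OF Fob] D.Ident_left[OF D.Ident_closed[OF Fob]]
      unfolding is_iso_def Hom_def by auto
    ultimately have "is_iso C (h \<cdot>\<^bsub>C\<^esub> t)"
      using cons Hom_simps[OF ht] unfolding is_conservative_def by metis
    \<comment> \<open>\<open>A\<close> need not be faithful, so \<open>h \<cdot> t\<close> is only
      invertible, not the identity; the section of \<open>h\<close> is \<open>t\<close> corrected by
      the inverse \<open>g\<close>.\<close>
    then obtain g where g: "g \<in> Hom C ?Y ?Y" "(h \<cdot>\<^bsub>C\<^esub> t) \<cdot>\<^bsub>C\<^esub> g = Ident C ?Y"
      using Hom_simps[OF ht] unfolding is_iso_def by auto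
    then have "h \<cdot>\<^bsub>C\<^esub> (t \<cdot>\<^bsub>C\<^esub> g) = Ident C ?Y" using C.Comp_assoc[OF g(1) t(1) hH] by simp
    then have "is_split_surjective C h"
      using h C.Comp_closed[OF g(1) t(1)] unfolding is_split_surjective_def by blast
    then show False using ns by contradiction
  qed
qed

lemma functor_split_surjective:
  assumes "category C" and F: "is_functor C D F" and h: "is_split_surjective C h"
  shows "is_split_surjective D (MMap F h)"
proof -
  interpret C: category C by fact
  obtain s where s: "h \<in> Arr C" "s \<in> Hom C (Cod C h) (Dom C h)" "h \<cdot>\<^bsub>C\<^esub> s = Ident C (Cod C h)"
    using h unfolding is_split_surjective_def by blast
  note hH = C.Hom_self[OF s(1)]
  have "MMap F h \<cdot>\<^bsub>D\<^esub> MMap F s = Ident D (OMap F (Cod C h))"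
    using functor_Comp[OF F s(2) hH] s(3) functor_Ident[OF F C.Cod_closed[OF s(1)]] by simp
  then show ?thesis
    using functor_Hom[OF F hH] functor_Hom[OF F s(2)] unfolding is_split_surjective_def Hom_def by auto
qed

context weight_structure
begin

lemma preadditive_category_heart: "preadditive_category (heart C W)"
  unfolding heart_def using Wge_Obj by (intro preadditive_category_full_subcat) blast

text \<open>The splitting data from \<open>weight_complex_nonneg\<close> are equations between
  arrows of the heart. An additive functor carries them to \<open>\<A>\<close>, where
  \<open>split_homology_zero_iff\<close> applies to the images.\<close>

lemma weight_homology_zero_iff:
  assumes "abelian_category \<A>" and F: "is_additive_functor (heart C W) \<A> A"
    and proj: "has_projective_image (heart C W) \<A> A"
    and split: "preserves_non_split_surjectivity (heart C W) \<A> A"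
    and M: "M \<in> w_ge C W 0"
  shows "is_zero_object \<A> (weight_homology C W \<A> A M) \<longleftrightarrow> M \<in> w_ge C W 1"
proof -
  interpret A: abelian_category \<A> by fact
  interpret H: preadditive_category "heart C W" by (rule preadditive_category_heart)
  have F': "is_functor (heart C W) \<A> A" using F by (simp add: is_additive_functor_def)
  have HC: "Ident (heart C W) = Ident C" "Comp (heart C W) = Comp C" "Plus (heart C W) = Plus C"
      "Null (heart C W) = Null C" "Obj (heart C W) = Wge W \<inter> Wle W"
    by (simp_all add: heart_def full_subcat_simps)
  have heartI: "f \<in> Hom (heart C W) X Y"
    if "f \<in> Hom C X Y" "X \<in> Wge W \<inter> Wle W" "Y \<in> Wge W \<inter> Wle W" for f X Y
    using that by (auto simp: heart_def Hom_full_subcat)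
  have FC: "MMap A (g \<cdot> f) = MMap A g \<cdot>\<^bsub>\<A>\<^esub> MMap A f"
    if "f \<in> Hom (heart C W) X Y" "g \<in> Hom (heart C W) Y Z" for f g X Y Z
    using functor_Comp[OF F' that] by (simp add: HC)
  have FI: "MMap A (Ident C X) = Ident \<A> (OMap A X)" if "X \<in> Wge W \<inter> Wle W" for X
    using functor_Ident[OF F'] that by (simp add: HC)
  have FN: "MMap A (Null C X Y) = Null \<A> (OMap A X) (OMap A Y)"
    if "X \<in> Wge W \<inter> Wle W" "Y \<in> Wge W \<inter> Wle W" for X Y
    using additive_functor_Null[OF F H.preadditive_category_axioms A.preadditive_category_axioms] that
    by (simp add: HC)
  have FP: "MMap A (Plus C f g) = Plus \<A> (MMap A f) (MMap A g)"
    if "f \<in> Hom (heart C W) X Y" "g \<in> Hom (heart C W) X Y" for f g X Y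
    using F that by (auto simp: is_additive_functor_def HC)
  \<comment> \<open>The \<open>SOME\<close> in \<open>weight_homology\<close> may pick any weight
    complex and any homology object, so the criterion is stated for all of them, together with
    existence.\<close>
  have *: "(\<exists>K. is_homology \<A> (MMap A (d (- 1))) (MMap A (d 0)) K) \<and>
      (\<forall>K. is_homology \<A> (MMap A (d (- 1))) (MMap A (d 0)) K \<longrightarrow>
        (is_zero_object \<A> K \<longleftrightarrow> M \<in> w_ge C W 1))"
    if T: "is_weight_complex C W M T d" for T d
  proof -
    obtain L E p c q m r r' s m' where
      ob: "L \<in> Wge W \<inter> Wle W" "E \<in> Wge W \<inter> Wle W" "T (- 1) \<in> Wge W \<inter> Wle W"
        "T 0 \<in> Wge W \<inter> Wle W" "T 1 \<in> Wge W \<inter> Wle W" and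
      hom: "p \<in> Hom C (T (- 1)) L" "c \<in> Hom C L (T 0)" "q \<in> Hom C (T 0) E" "m \<in> Hom C E (T 1)"
        "r \<in> Hom C (T 0) L" "r' \<in> Hom C (T 0) L" "s \<in> Hom C E (T 0)" "m' \<in> Hom C (T 1) E" and
      eq: "d (- 1) = c \<cdot> p" "d 0 = m \<cdot> q" "q \<cdot> c = Null C L E" "r \<cdot> c = Ident C L"
        "Plus C (c \<cdot> r') (s \<cdot> q) = Ident C (T 0)" "m' \<cdot> m = Ident C E" and
      iff: "(\<exists>t\<in>Hom C L (T (- 1)). p \<cdot> t = Ident C L) \<longleftrightarrow> M \<in> w_ge C W 1"
      by (rule weight_complex_nonneg[OF M T])
    have p: "p \<in> Hom (heart C W) (T (- 1)) L" and c: "c \<in> Hom (heart C W) L (T 0)"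
      and q: "q \<in> Hom (heart C W) (T 0) E" and m: "m \<in> Hom (heart C W) E (T 1)"
      and r: "r \<in> Hom (heart C W) (T 0) L" and r': "r' \<in> Hom (heart C W) (T 0) L"
      and s: "s \<in> Hom (heart C W) E (T 0)" and m': "m' \<in> Hom (heart C W) (T 1) E"
      using hom ob by (auto intro: heartI)
    note cr' = H.Comp_closed[OF r' c, unfolded HC] and sq = H.Comp_closed[OF q s, unfolded HC]
    have Feq: "MMap A q \<cdot>\<^bsub>\<A>\<^esub> MMap A c = Null \<A> (OMap A L) (OMap A E)"
      "MMap A r \<cdot>\<^bsub>\<A>\<^esub> MMap A c = Ident \<A> (OMap A L)"
      "Plus \<A> (MMap A c \<cdot>\<^bsub>\<A>\<^esub> MMap A r') (MMap A s \<cdot>\<^bsub>\<A>\<^esub> MMap A q) = Ident \<A> (OMap A (T 0))"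
      "MMap A m' \<cdot>\<^bsub>\<A>\<^esub> MMap A m = Ident \<A> (OMap A E)"
      "MMap A (d (- 1)) = MMap A c \<cdot>\<^bsub>\<A>\<^esub> MMap A p" "MMap A (d 0) = MMap A m \<cdot>\<^bsub>\<A>\<^esub> MMap A q"
      using FC[OF c q] FC[OF c r] FC[OF r' c] FC[OF q s] FC[OF m m'] FC[OF p c] FC[OF q m]
        FP[OF cr' sq] eq FN[OF ob(1,2)] FI[OF ob(1)] FI[OF ob(2)] FI[OF ob(4)] by simp_all
    note Fh = functor_Hom[OF F']
    note cp = A.Comp_closed[OF Fh[OF p] Fh[OF c]] and mq = A.Comp_closed[OF Fh[OF q] Fh[OF m]]
    have AP: "OMap A (T (- 1)) \<in> Obj \<A>" and AL: "OMap A L \<in> Obj \<A>"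
      and AU: "OMap A (T 1) \<in> Obj \<A>"
      using functor_Obj[OF F'] ob by (auto simp: HC)
    have "(MMap A m \<cdot>\<^bsub>\<A>\<^esub> MMap A q) \<cdot>\<^bsub>\<A>\<^esub> MMap A c = Null \<A> (OMap A L) (OMap A (T 1))"
      using A.Comp_assoc[OF Fh[OF c] Fh[OF q] Fh[OF m]] Feq(1) A.Comp_Null_right[OF Fh[OF m] AL] by simp
    then have "(MMap A m \<cdot>\<^bsub>\<A>\<^esub> MMap A q) \<cdot>\<^bsub>\<A>\<^esub> (MMap A c \<cdot>\<^bsub>\<A>\<^esub> MMap A p) =
        Null \<A> (OMap A (T (- 1))) (OMap A (T 1))"
      using A.Comp_assoc[OF Fh[OF p] Fh[OF c] mq] A.Comp_Null_left[OF Fh[OF p] AU] by simp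
    then have ex: "\<exists>K. is_homology \<A> (MMap A (d (- 1))) (MMap A (d 0)) K"
      using A.homology_exists[OF cp mq] Feq(5,6) by simp
    have "is_epi \<A> (MMap A p) \<longleftrightarrow> M \<in> w_ge C W 1"
    proof -
      have pr: "is_projective \<A> (Cod \<A> (MMap A p))"
        using proj ob(1) Hom_simps[OF Fh[OF p]] by (auto simp: has_projective_image_def HC)
      \<comment> \<open>Projectivity of the image of \<open>L\<close> splits the epimorphism in
        \<open>\<A>\<close>; the contrapositive of condition (ii) then moves the splitting back to
        the heart.\<close>
      have "is_epi \<A> (MMap A p) \<longleftrightarrow> is_split_surjective \<A> (MMap A p)"
        using A.epi_onto_projective_split[OF _ pr] A.split_surjective_is_epi by blast
      also have "\<dots> \<longleftrightarrow> is_split_surjective (heart C W) p"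
        using split functor_split_surjective[OF H.category_axioms F'] Hom_simps[OF p]
        unfolding preserves_non_split_surjectivity_def by blast
      also have "\<dots> \<longleftrightarrow> (\<exists>t\<in>Hom C L (T (- 1)). p \<cdot> t = Ident C L)"
        using Hom_simps[OF p] ob unfolding is_split_surjective_def
        by (auto simp: HC heart_def Hom_full_subcat full_subcat_simps)
      finally show ?thesis using iff by simp
    qed
    moreover have "is_zero_object \<A> K \<longleftrightarrow> is_epi \<A> (MMap A p)"
      if "is_homology \<A> (MMap A (d (- 1))) (MMap A (d 0)) K" for K
      by (rule A.split_homology_zero_iff[OF Fh[OF p] Fh[OF c] Fh[OF q] Fh[OF m] Feq(1) Fh[OF r] Feq(2)
            Fh[OF r'] Fh[OF s] Feq(3) Fh[OF m'] Feq(4)])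
        (use that Feq(5,6) in simp)
    ultimately show ?thesis using ex by blast
  qed
  have "\<exists>K T d. is_weight_complex C W M T d \<and> is_homology \<A> (MMap A (d (- 1))) (MMap A (d 0)) K"
    using weight_complex_exists[OF w_ge_Obj[OF M]] * by blast
  from someI_ex[OF this] * show ?thesis unfolding weight_homology_def by blast
qed

text \<open>The object \<open>H\<^sub>i(M)\<close> is \<open>H\<close> of \<open>M\<close> shifted
  by \<open>- i\<close>, so \<open>weight_homology_zero_iff\<close> for the shifted object decides
  whether the bound \<open>i\<close> can be raised to \<open>i + 1\<close>. If the initial bound
  already exceeds \<open>n\<close>, monotonicity suffices.\<close>

lemma bounded_below_homology_vanishing_iff:
  assumes A: "abelian_category \<A>" "is_additive_functor (heart C W) \<A> A"
      "has_projective_image (heart C W) \<A> A" "preserves_non_split_surjectivity (heart C W) \<A> A"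
  shows "(w_bounded_below C W M \<and>
      (\<forall>i<n. is_zero_object \<A> (shifted_homology C (weight_homology C W \<A> A) i M)))
    \<longleftrightarrow> M \<in> w_ge C W n"
proof (intro iffI conjI allI impI; (elim conjE)?)
  assume M: "M \<in> w_ge C W n"
  then show "w_bounded_below C W M" unfolding w_bounded_below_def by blast
  fix i assume "i < n"
  then have "Sh C (- i) M \<in> w_ge C W 1" using w_ge_antimono[OF w_ge_Sh[OF M, of "- i"], of "n - i" 1] by simp
  with w_ge_antimono[OF this, of 0]
  show "is_zero_object \<A> (shifted_homology C (weight_homology C W \<A> A) i M)"
    using weight_homology_zero_iff[OF A] by (simp add: shifted_homology_def)
next
  assume "w_bounded_below C W M"
    and zero: "\<forall>i<n. is_zero_object \<A> (shifted_homology C (weight_homology C W \<A> A) i M)"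
  then obtain m where m: "M \<in> w_ge C W m" unfolding w_bounded_below_def by blast
  have step: "M \<in> w_ge C W (i + 1)" if i: "M \<in> w_ge C W i" "i < n" for i
  proof -
    have "Sh C (- i) M \<in> w_ge C W 1"
      using zero i weight_homology_zero_iff[OF A w_ge_Sh[OF i(1)], of "- i"] by (simp add: shifted_homology_def)
    from w_ge_Sh[OF this, of i] show ?thesis using w_ge_Obj[OF m] by (simp add: Sh_Sh shift_zero)
  qed
  show "M \<in> w_ge C W n"
  proof (cases "m \<le> n")
    case True
    have "k \<le> n \<longrightarrow> M \<in> w_ge C W k" if "m \<le> k" for k
      using that by (induction k rule: int_ge_induct) (use m step in auto)
    then show ?thesis using True by blast
  next
    case False
    then show ?thesis using w_ge_antimono[OF m] by simp
  qed
qed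

end

section \<open>Quotient modules and linear functor categories\<close>

text \<open>A chosen element of the coset of \<open>x\<close> replaces the coset itself: elements of
  an object of \<open>module_cat\<close> must have type \<open>'v\<close>, whereas cosets have type
  \<open>'v set\<close>.\<close>

definition coset_rep :: "('r, 'v) module \<Rightarrow> 'v set \<Rightarrow> 'v \<Rightarrow> 'v" where
  "coset_rep M K x = (SOME y. y \<in> carrier M \<and> (\<exists>k\<in>K. y = x \<oplus>\<^bsub>M\<^esub> k))"

definition quotient_module :: "('r, 'v) module \<Rightarrow> 'v set \<Rightarrow> ('r, 'v) module" where
  "quotient_module M K =
     \<lparr>carrier = coset_rep M K ` carrier M, monoid.mult = undefined, one = undefined,
      zero = coset_rep M K \<zero>\<^bsub>M\<^esub>, add = (\<lambda>x y. coset_rep M K (x \<oplus>\<^bsub>M\<^esub> y)),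
      smult = (\<lambda>r x. coset_rep M K (r \<odot>\<^bsub>M\<^esub> x))\<rparr>"

lemma quotient_module_simps:
  "carrier (quotient_module M K) = coset_rep M K ` carrier M"
  "\<zero>\<^bsub>quotient_module M K\<^esub> = coset_rep M K \<zero>\<^bsub>M\<^esub>"
  "x \<oplus>\<^bsub>quotient_module M K\<^esub> y = coset_rep M K (x \<oplus>\<^bsub>M\<^esub> y)"
  "r \<odot>\<^bsub>quotient_module M K\<^esub> x = coset_rep M K (r \<odot>\<^bsub>M\<^esub> x)"
  by (simp_all add: quotient_module_def)

locale module_with_submodule = module R M for R :: "'r ring" and M :: "('r, 'v) module" (structure) +
  fixes K :: "'v set"
  assumes submodule: "submodule K R M"
begin

lemmas K_facts = submoduleE[OF submodule]

lemma K_carrier: "k \<in> K \<Longrightarrow> k \<in> carrier M"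
  using K_facts(1) by blast

lemma K_zero: "\<zero>\<^bsub>M\<^esub> \<in> K"
  using K_facts(1,2,3,5) M.r_neg by (metis all_not_in_conv subsetD)

lemma coset_rep_props:
  assumes "x \<in> carrier M"
  shows "coset_rep M K x \<in> carrier M" "\<exists>k\<in>K. coset_rep M K x = x \<oplus>\<^bsub>M\<^esub> k"
proof -
  have "\<exists>y. y \<in> carrier M \<and> (\<exists>k\<in>K. y = x \<oplus>\<^bsub>M\<^esub> k)" using assms K_zero M.r_zero by metis
  from someI_ex[OF this] show "coset_rep M K x \<in> carrier M" "\<exists>k\<in>K. coset_rep M K x = x \<oplus>\<^bsub>M\<^esub> k"
    unfolding coset_rep_def by blast+
qed

text \<open>The choice depends on \<open>x\<close> only through its set of candidates, the coset of
  \<open>x\<close>, which translation by \<open>k\<close> does not change.\<close>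

lemma coset_rep_add_K:
  assumes x: "x \<in> carrier M" and k: "k \<in> K"
  shows "coset_rep M K (x \<oplus>\<^bsub>M\<^esub> k) = coset_rep M K x"
proof -
  have "(\<exists>l\<in>K. y = (x \<oplus>\<^bsub>M\<^esub> k) \<oplus>\<^bsub>M\<^esub> l) \<longleftrightarrow> (\<exists>l\<in>K. y = x \<oplus>\<^bsub>M\<^esub> l)" for y
  proof
    assume "\<exists>l\<in>K. y = (x \<oplus>\<^bsub>M\<^esub> k) \<oplus>\<^bsub>M\<^esub> l"
    then show "\<exists>l\<in>K. y = x \<oplus>\<^bsub>M\<^esub> l" using x k K_facts(5) K_carrier M.a_assoc by metis
  next
    assume "\<exists>l\<in>K. y = x \<oplus>\<^bsub>M\<^esub> l"
    then obtain l where l: "l \<in> K" "y = x \<oplus>\<^bsub>M\<^esub> l" by blast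
    have "y = (x \<oplus>\<^bsub>M\<^esub> k) \<oplus>\<^bsub>M\<^esub> (\<ominus>\<^bsub>M\<^esub> k \<oplus>\<^bsub>M\<^esub> l)"
      using x k l K_carrier M.a_assoc M.a_inv_closed M.r_neg2 M.a_closed by metis
    then show "\<exists>l\<in>K. y = (x \<oplus>\<^bsub>M\<^esub> k) \<oplus>\<^bsub>M\<^esub> l" using k l K_facts(3,5) by blast
  qed
  then show ?thesis unfolding coset_rep_def by simp
qed

lemma coset_rep_idem: "x \<in> carrier M \<Longrightarrow> coset_rep M K (coset_rep M K x) = coset_rep M K x"
  using coset_rep_props(2)[of x] coset_rep_add_K by metis

text \<open>With its companions for the right summand and for scalars, this absorbs inner
  representatives, so that each module law of the quotient reduces to the law in
  \<open>M\<close>.\<close>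

lemma coset_rep_add_left:
  assumes "x \<in> carrier M" "y \<in> carrier M"
  shows "coset_rep M K (coset_rep M K x \<oplus>\<^bsub>M\<^esub> y) = coset_rep M K (x \<oplus>\<^bsub>M\<^esub> y)"
proof -
  obtain k where k: "k \<in> K" "coset_rep M K x = x \<oplus>\<^bsub>M\<^esub> k" using coset_rep_props(2)[OF assms(1)] by blast
  then have "coset_rep M K x \<oplus>\<^bsub>M\<^esub> y = (x \<oplus>\<^bsub>M\<^esub> y) \<oplus>\<^bsub>M\<^esub> k"
    using assms K_carrier by (simp add: M.a_ac)
  then show ?thesis using coset_rep_add_K k assms by simp
qed

lemma coset_rep_add_right:
  assumes "x \<in> carrier M" "y \<in> carrier M"
  shows "coset_rep M K (x \<oplus>\<^bsub>M\<^esub> coset_rep M K y) = coset_rep M K (x \<oplus>\<^bsub>M\<^esub> y)"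
  using coset_rep_add_left[OF assms(2,1)] assms coset_rep_props(1) by (simp add: M.a_comm)

lemma coset_rep_smult:
  assumes "r \<in> carrier R" "x \<in> carrier M"
  shows "coset_rep M K (r \<odot>\<^bsub>M\<^esub> coset_rep M K x) = coset_rep M K (r \<odot>\<^bsub>M\<^esub> x)"
proof -
  obtain k where k: "k \<in> K" "coset_rep M K x = x \<oplus>\<^bsub>M\<^esub> k" using coset_rep_props(2)[OF assms(2)] by blast
  then have "r \<odot>\<^bsub>M\<^esub> coset_rep M K x = r \<odot>\<^bsub>M\<^esub> x \<oplus>\<^bsub>M\<^esub> r \<odot>\<^bsub>M\<^esub> k"
    using assms K_carrier by (simp add: smult_r_distr)
  then show ?thesis using coset_rep_add_K assms k(1) K_facts(4) by simp
qed

text \<open>The quotient map kills nothing outside \<open>K\<close>; this is what turns its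
  vanishing into surjectivity later on.\<close>

lemma coset_rep_eq_zero:
  assumes "x \<in> carrier M" "coset_rep M K x = coset_rep M K \<zero>\<^bsub>M\<^esub>"
  shows "x \<in> K"
proof -
  obtain k l where k: "k \<in> K" "coset_rep M K x = x \<oplus>\<^bsub>M\<^esub> k"
    and l: "l \<in> K" "coset_rep M K \<zero>\<^bsub>M\<^esub> = \<zero>\<^bsub>M\<^esub> \<oplus>\<^bsub>M\<^esub> l"
    using coset_rep_props(2)[OF assms(1)] coset_rep_props(2)[OF M.zero_closed] by blast
  then have "x \<oplus>\<^bsub>M\<^esub> k = l" using assms(2) K_carrier by simp
  then have "x = l \<oplus>\<^bsub>M\<^esub> \<ominus>\<^bsub>M\<^esub> k"
    using k(1) assms(1) K_carrier by (metis M.a_assoc M.a_inv_closed M.r_neg M.r_zero)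
  then show ?thesis using K_facts(3,5) k l by blast
qed

lemma coset_rep_zero: "k \<in> K \<Longrightarrow> coset_rep M K k = coset_rep M K \<zero>\<^bsub>M\<^esub>"
  using coset_rep_add_K[OF M.zero_closed, of k] K_carrier by simp

lemma quotient_module: "module R (quotient_module M K)"
proof -
  note reps = coset_rep_props(1) coset_rep_idem coset_rep_add_left coset_rep_add_right coset_rep_smult
  have "abelian_group (quotient_module M K)"
  proof (rule abelian_groupI)
    fix x assume "x \<in> carrier (quotient_module M K)"
    then obtain a where a: "a \<in> carrier M" "x = coset_rep M K a" by (auto simp: quotient_module_simps)
    then have "coset_rep M K (\<ominus>\<^bsub>M\<^esub> a) \<oplus>\<^bsub>quotient_module M K\<^esub> x = \<zero>\<^bsub>quotient_module M K\<^esub>"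
      by (simp add: quotient_module_simps reps M.l_neg)
    then show "\<exists>y\<in>carrier (quotient_module M K). y \<oplus>\<^bsub>quotient_module M K\<^esub> x = \<zero>\<^bsub>quotient_module M K\<^esub>"
      using a by (auto simp: quotient_module_simps)
  qed (auto simp: quotient_module_simps reps, simp_all add: M.a_ac)
  then show ?thesis
    by (intro moduleI R.is_cring)
      (auto simp: quotient_module_simps reps, simp_all add: smult_l_distr smult_r_distr smult_assoc1)
qed

end

lemma module_homs_map:
  assumes \<phi>: "\<phi> \<in> module_homs R M N"
  shows "x \<in> carrier M \<Longrightarrow> \<phi> x \<in> carrier N"
    and "x \<in> carrier M \<Longrightarrow> y \<in> carrier M \<Longrightarrow> \<phi> (x \<oplus>\<^bsub>M\<^esub> y) = \<phi> x \<oplus>\<^bsub>N\<^esub> \<phi> y"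
    and "r \<in> carrier R \<Longrightarrow> x \<in> carrier M \<Longrightarrow> \<phi> (r \<odot>\<^bsub>M\<^esub> x) = r \<odot>\<^bsub>N\<^esub> \<phi> x"
    and "\<phi> \<in> extensional (carrier M)"
  using assms by (auto simp: module_homs_def PiE_def)

lemma module_homs_zero:
  assumes "module R M" "module R N" and \<phi>: "\<phi> \<in> module_homs R M N"
  shows "\<phi> \<zero>\<^bsub>M\<^esub> = \<zero>\<^bsub>N\<^esub>"
proof -
  interpret M: module R M by fact
  interpret N: module R N by fact
  have "\<phi> \<zero>\<^bsub>M\<^esub> \<oplus>\<^bsub>N\<^esub> \<phi> \<zero>\<^bsub>M\<^esub> = \<phi> \<zero>\<^bsub>M\<^esub>"
    using module_homs_map(2)[OF \<phi>, of "\<zero>\<^bsub>M\<^esub>" "\<zero>\<^bsub>M\<^esub>"] by simp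
  then show ?thesis using module_homs_map(1)[OF \<phi> M.M.zero_closed] by (simp add: N.M.add.r_cancel_one)
qed

lemma submodule_image:
  assumes "module R M" "module R N" and \<phi>: "\<phi> \<in> module_homs R M N"
  shows "submodule (\<phi> ` carrier M) R N"
proof -
  interpret M: module R M by fact
  interpret N: module R N by fact
  note h = module_homs_map[OF \<phi>]
  show ?thesis
  proof (rule N.submoduleI)
    show "\<zero>\<^bsub>N\<^esub> \<in> \<phi> ` carrier M" using module_homs_zero[OF assms] M.M.zero_closed by (metis image_eqI)
    fix a assume "a \<in> \<phi> ` carrier M"
    then obtain x where x: "x \<in> carrier M" "a = \<phi> x" by blast
    have "\<phi> (\<ominus>\<^bsub>M\<^esub> x) \<oplus>\<^bsub>N\<^esub> a = \<zero>\<^bsub>N\<^esub>"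
      using h(2)[of "\<ominus>\<^bsub>M\<^esub> x" x] x module_homs_zero[OF assms] by (simp add: M.M.l_neg)
    then have "\<ominus>\<^bsub>N\<^esub> a = \<phi> (\<ominus>\<^bsub>M\<^esub> x)" using h(1) x by (simp add: N.M.minus_equality)
    then show "\<ominus>\<^bsub>N\<^esub> a \<in> \<phi> ` carrier M" using x by simp
  next
    fix a b assume "a \<in> \<phi> ` carrier M" "b \<in> \<phi> ` carrier M"
    then show "a \<oplus>\<^bsub>N\<^esub> b \<in> \<phi> ` carrier M" by (auto simp flip: h(2))
  next
    fix a x assume "a \<in> carrier R" "x \<in> \<phi> ` carrier M"
    then show "a \<odot>\<^bsub>N\<^esub> x \<in> \<phi> ` carrier M" by (auto simp flip: h(3))
  qed (use h(1) in auto)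
qed

section \<open>The category of modules\<close>

lemma Hom_module_cat:
  "f \<in> Hom (module_cat R) M N \<longleftrightarrow>
     (\<exists>\<phi>. f = Arrow M N \<phi> \<and> module R M \<and> module R N \<and> \<phi> \<in> module_homs R M N)"
  by (auto simp: Hom_def module_cat_def)

lemma module_cat_simps:
  "Obj (module_cat R) = {M. module R M}" "Dom (module_cat R) = src" "Cod (module_cat R) = tgt"
  "Ident (module_cat R) M = Arrow M M (\<lambda>x\<in>carrier M. x)"
  "Comp (module_cat R) g f = Arrow (src f) (tgt g) (compose (carrier (src f)) (act g) (act f))"
  "Plus (module_cat R) f g =
     Arrow (src f) (tgt f) (\<lambda>x\<in>carrier (src f). act f x \<oplus>\<^bsub>tgt f\<^esub> act g x)"
  "Null (module_cat R) M N = Arrow M N (\<lambda>x\<in>carrier M. \<zero>\<^bsub>N\<^esub>)"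
  by (simp_all add: module_cat_def)

text \<open>The identity laws are equalities of total functions; they hold because elements of
  \<open>module_homs\<close> are \<open>undefined\<close> off the carrier, as are the restricted
  composites.\<close>

lemma category_module_cat:
  fixes R :: "'r ring"
  shows "category (module_cat R :: (('r, 'v) module, (('r, 'v) module, 'v \<Rightarrow> 'v) arrow) acat)"
proof
  fix f :: "(('r, 'v) module, 'v \<Rightarrow> 'v) arrow" assume "f \<in> Arr (module_cat R)"
  then show "Dom (module_cat R) f \<in> Obj (module_cat R)" "Cod (module_cat R) f \<in> Obj (module_cat R)"
    by (auto simp: module_cat_def)
next
  fix X :: "('r, 'v) module" assume "X \<in> Obj (module_cat R)"
  then have X: "module R X" by (simp add: module_cat_simps)
  then interpret X: module R X .
  show "Ident (module_cat R) X \<in> Hom (module_cat R) X X"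
    using X by (auto simp: Hom_module_cat module_cat_simps module_homs_def)
next
  fix f g :: "(('r, 'v) module, 'v \<Rightarrow> 'v) arrow" and X Y Z
  assume "f \<in> Hom (module_cat R) X Y" "g \<in> Hom (module_cat R) Y Z"
  then obtain \<phi> \<psi> where f: "f = Arrow X Y \<phi>" "module R X" "\<phi> \<in> module_homs R X Y"
    and g: "g = Arrow Y Z \<psi>" "module R Z" "\<psi> \<in> module_homs R Y Z"
    unfolding Hom_module_cat by blast
  interpret X: module R X by fact
  have "compose (carrier X) \<psi> \<phi> \<in> module_homs R X Z"
    using module_homs_map[OF f(3)] module_homs_map[OF g(3)] by (auto simp: module_homs_def compose_def)
  then show "g \<cdot>\<^bsub>module_cat R\<^esub> f \<in> Hom (module_cat R) X Z"
    using f g by (simp add: Hom_module_cat module_cat_simps)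
next
  fix f :: "(('r, 'v) module, 'v \<Rightarrow> 'v) arrow" and X Y assume "f \<in> Hom (module_cat R) X Y"
  then obtain \<phi> where f: "f = Arrow X Y \<phi>" "\<phi> \<in> module_homs R X Y"
    unfolding Hom_module_cat by blast
  note h = module_homs_map[OF f(2)]
  show "Ident (module_cat R) Y \<cdot>\<^bsub>module_cat R\<^esub> f = f"
    using h(1,4) by (auto simp: f(1) module_cat_simps compose_def extensional_def)
  show "f \<cdot>\<^bsub>module_cat R\<^esub> Ident (module_cat R) X = f"
    using h(1,4) by (auto simp: f(1) module_cat_simps compose_def extensional_def)
next
  fix f g h :: "(('r, 'v) module, 'v \<Rightarrow> 'v) arrow" and X Y Z V
  assume "f \<in> Hom (module_cat R) X Y" "g \<in> Hom (module_cat R) Y Z" "h \<in> Hom (module_cat R) Z V"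
  then obtain \<phi> \<psi> \<chi> where "f = Arrow X Y \<phi>" "\<phi> \<in> module_homs R X Y" "g = Arrow Y Z \<psi>" "h = Arrow Z V \<chi>"
    unfolding Hom_module_cat by blast
  then show "(h \<cdot>\<^bsub>module_cat R\<^esub> g) \<cdot>\<^bsub>module_cat R\<^esub> f = h \<cdot>\<^bsub>module_cat R\<^esub> (g \<cdot>\<^bsub>module_cat R\<^esub> f)"
    using module_homs_map(1) by (fastforce simp: module_cat_simps compose_def intro!: restrict_ext)
qed

section \<open>Categories of linear functors\<close>

lemma linear_functor_cat_simps:
  "Obj (linear_functor_cat R C sm D sm') = linear_functors R C sm D sm'"
  "Dom (linear_functor_cat R C sm D sm') = src" "Cod (linear_functor_cat R C sm D sm') = tgt"
  "Ident (linear_functor_cat R C sm D sm') F = Arrow F F (\<lambda>X\<in>Obj C. Ident D (OMap F X))"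
  "Comp (linear_functor_cat R C sm D sm') b a = Arrow (src a) (tgt b) (\<lambda>X\<in>Obj C. act b X \<cdot>\<^bsub>D\<^esub> act a X)"
  by (simp_all add: linear_functor_cat_def)

lemma Hom_linear_functor_cat:
  "f \<in> Hom (linear_functor_cat R C sm D sm') F G \<longleftrightarrow>
     (\<exists>\<eta>. f = Arrow F G \<eta> \<and> F \<in> linear_functors R C sm D sm' \<and> G \<in> linear_functors R C sm D sm' \<and>
        \<eta> \<in> nat_transformations C D F G)"
  by (auto simp: Hom_def linear_functor_cat_def)

lemma nat_transformationD:
  assumes "\<eta> \<in> nat_transformations C D F G"
  shows "\<eta> \<in> extensional (Obj C)"
    and "X \<in> Obj C \<Longrightarrow> \<eta> X \<in> Hom D (OMap F X) (OMap G X)"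
    and "f \<in> Hom C X Y \<Longrightarrow> \<eta> Y \<cdot>\<^bsub>D\<^esub> MMap F f = MMap G f \<cdot>\<^bsub>D\<^esub> \<eta> X"
  using assms by (auto simp: nat_transformations_def)

lemma linear_functorsD:
  assumes "F \<in> linear_functors R C sm D sm'"
  shows "is_functor C D F"
    and "\<And>X Y f g. f \<in> Hom C X Y \<Longrightarrow> g \<in> Hom C X Y \<Longrightarrow> MMap F (Plus C f g) = Plus D (MMap F f) (MMap F g)"
    and "\<And>r f. r \<in> carrier R \<Longrightarrow> f \<in> Arr C \<Longrightarrow> MMap F (sm r f) = sm' r (MMap F f)"
  using assms by (auto simp: linear_functors_def is_linear_functor_def is_additive_functor_def)

lemma category_linear_functor_cat:
  assumes "category C" "category D"
  shows "category (linear_functor_cat R C sm D sm')"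
proof -
  interpret C: category C by fact
  interpret D: category D by fact
  let ?P = "linear_functor_cat R C sm D sm'"
  show ?thesis
  proof
    fix f assume "f \<in> Arr ?P"
    then show "Dom ?P f \<in> Obj ?P" "Cod ?P f \<in> Obj ?P" by (auto simp: linear_functor_cat_def)
  next
    fix F assume "F \<in> Obj ?P"
    then have F: "F \<in> linear_functors R C sm D sm'" by (simp add: linear_functor_cat_simps)
    note F' = linear_functorsD(1)[OF F]
    have "(\<lambda>X\<in>Obj C. Ident D (OMap F X)) \<in> nat_transformations C D F F"
      using functor_Obj[OF F'] D.Ident_left[OF functor_Hom[OF F']] D.Ident_right[OF functor_Hom[OF F']]
      by (auto simp: nat_transformations_def C.Hom_Dom C.Hom_Cod intro: D.Ident_closed)
    then show "Ident ?P F \<in> Hom ?P F F" using F by (simp add: Hom_linear_functor_cat linear_functor_cat_simps)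
  next
    fix a b F G H assume "a \<in> Hom ?P F G" "b \<in> Hom ?P G H"
    then obtain \<alpha> \<beta> where a: "a = Arrow F G \<alpha>" "\<alpha> \<in> nat_transformations C D F G"
        "F \<in> linear_functors R C sm D sm'"
      and b: "b = Arrow G H \<beta>" "\<beta> \<in> nat_transformations C D G H" "G \<in> linear_functors R C sm D sm'"
        "H \<in> linear_functors R C sm D sm'"
      unfolding Hom_linear_functor_cat by blast
    note A = nat_transformationD[OF a(2)] and B = nat_transformationD[OF b(2)]
    have nat: "(\<beta> Y \<cdot>\<^bsub>D\<^esub> \<alpha> Y) \<cdot>\<^bsub>D\<^esub> MMap F f = MMap H f \<cdot>\<^bsub>D\<^esub> (\<beta> X \<cdot>\<^bsub>D\<^esub> \<alpha> X)"
      if f: "f \<in> Hom C X Y" for f X Y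
    proof -
      have X: "X \<in> Obj C" and Y: "Y \<in> Obj C" using f C.Hom_Dom C.Hom_Cod by auto
      note Ff = functor_Hom[OF linear_functorsD(1)[OF a(3)] f]
        and Gf = functor_Hom[OF linear_functorsD(1)[OF b(3)] f]
        and Hf = functor_Hom[OF linear_functorsD(1)[OF b(4)] f]
      show ?thesis
        using D.Comp_assoc[OF Ff A(2)[OF Y] B(2)[OF Y]] A(3)[OF f] B(3)[OF f]
          D.Comp_assoc[OF A(2)[OF X] Gf B(2)[OF Y]] D.Comp_assoc[OF A(2)[OF X] B(2)[OF X] Hf] by simp
    qed
    have "(\<lambda>X\<in>Obj C. \<beta> X \<cdot>\<^bsub>D\<^esub> \<alpha> X) \<in> nat_transformations C D F H"
      using A(2) B(2) nat
      by (auto simp: nat_transformations_def C.Hom_Dom C.Hom_Cod intro: D.Comp_closed)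
    then show "b \<cdot>\<^bsub>?P\<^esub> a \<in> Hom ?P F H" using a b by (simp add: Hom_linear_functor_cat linear_functor_cat_simps)
  next
    fix a F G assume "a \<in> Hom ?P F G"
    then obtain \<alpha> where a: "a = Arrow F G \<alpha>" "\<alpha> \<in> nat_transformations C D F G"
      unfolding Hom_linear_functor_cat by blast
    note A = nat_transformationD[OF a(2)]
    show "Ident ?P G \<cdot>\<^bsub>?P\<^esub> a = a"
      using A(1) D.Ident_left[OF A(2)]
      by (auto simp: a(1) linear_functor_cat_simps extensional_def)
    show "a \<cdot>\<^bsub>?P\<^esub> Ident ?P F = a"
      using A(1) D.Ident_right[OF A(2)]
      by (auto simp: a(1) linear_functor_cat_simps extensional_def)
  next
    fix a b c F G H I assume "a \<in> Hom ?P F G" "b \<in> Hom ?P G H" "c \<in> Hom ?P H I"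
    then obtain \<alpha> \<beta> \<gamma> where "a = Arrow F G \<alpha>" "b = Arrow G H \<beta>" "c = Arrow H I \<gamma>" and
      "\<alpha> \<in> nat_transformations C D F G" "\<beta> \<in> nat_transformations C D G H" "\<gamma> \<in> nat_transformations C D H I"
      unfolding Hom_linear_functor_cat by blast
    then show "(c \<cdot>\<^bsub>?P\<^esub> b) \<cdot>\<^bsub>?P\<^esub> a = c \<cdot>\<^bsub>?P\<^esub> (b \<cdot>\<^bsub>?P\<^esub> a)"
      using D.Comp_assoc[OF nat_transformationD(2) nat_transformationD(2) nat_transformationD(2)]
      by (auto simp: linear_functor_cat_simps intro!: restrict_ext)
  qed
qed

section \<open>Permanence of projectivity\<close>

lemma (in category) projective_retract:
  assumes P: "is_projective C P" and "is_retract_of C Q P"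
  shows "is_projective C Q"
proof -
  obtain s r where s: "s \<in> Hom C Q P" and r: "r \<in> Hom C P Q" and rs: "r \<cdot> s = Ident C Q" and Q: "Q \<in> Obj C"
    using assms unfolding is_retract_of_def by blast
  show ?thesis unfolding is_projective_def
  proof (intro conjI Q allI ballI impI)
    fix e f assume e: "is_epi C e" and f: "f \<in> Hom C Q (Cod C e)"
    obtain g where g: "g \<in> Hom C P (Dom C e)" "e \<cdot> g = f \<cdot> r"
      using P e Comp_closed[OF r f] unfolding is_projective_def by blast
    have eH: "e \<in> Hom C (Dom C e) (Cod C e)" using e Hom_self by (simp add: is_epi_def)
    have "e \<cdot> (g \<cdot> s) = f"
      using Comp_assoc[OF s g(1) eH] g(2) Comp_assoc[OF s r f] rs Ident_right[OF f] by simp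
    then show "\<exists>g\<in>Hom C Q (Dom C e). e \<cdot> g = f" using Comp_closed[OF s g(1)] by blast
  qed
qed

text \<open>Each component of \<open>f\<close> lifts along \<open>e\<close>; the lifts are chosen
  simultaneously and assembled by the universal property, whose uniqueness half shows that the
  result lifts \<open>f\<close>.\<close>

lemma (in category) projective_coproduct:
  assumes Q: "is_coproduct C I X Q \<iota>" and proj: "\<And>i. i \<in> I \<Longrightarrow> is_projective C (X i)"
  shows "is_projective C Q"
  unfolding is_projective_def
proof (intro conjI allI ballI impI)
  show "Q \<in> Obj C" using Q by (simp add: is_coproduct_def)
  have \<iota>: "\<iota> i \<in> Hom C (X i) Q" if "i \<in> I" for i using Q that by (simp add: is_coproduct_def)
  have univ: "\<exists>!u. u \<in> Hom C Q Y \<and> (\<forall>i\<in>I. u \<cdot> \<iota> i = g i)"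
    if "Y \<in> Obj C" "\<forall>i\<in>I. g i \<in> Hom C (X i) Y" for Y g
    using Q that by (simp add: is_coproduct_def)
  fix e f assume e: "is_epi C e" and f: "f \<in> Hom C Q (Cod C e)"
  have eH: "e \<in> Hom C (Dom C e) (Cod C e)" using e Hom_self by (simp add: is_epi_def)
  have "\<forall>i\<in>I. \<exists>g. g \<in> Hom C (X i) (Dom C e) \<and> e \<cdot> g = f \<cdot> \<iota> i"
    using proj e Comp_closed[OF \<iota> f] unfolding is_projective_def by blast
  then obtain g where g: "\<forall>i\<in>I. g i \<in> Hom C (X i) (Dom C e) \<and> e \<cdot> g i = f \<cdot> \<iota> i"
    by (rule bchoice[THEN exE])
  then obtain u where u: "u \<in> Hom C Q (Dom C e)" "\<forall>i\<in>I. u \<cdot> \<iota> i = g i"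
    using univ[of "Dom C e" g] Hom_Dom[OF eH] by blast
  have "\<forall>i\<in>I. (e \<cdot> u) \<cdot> \<iota> i = f \<cdot> \<iota> i" using Comp_assoc[OF \<iota> u(1) eH] u(2) g by simp
  moreover have "\<forall>i\<in>I. f \<cdot> \<iota> i \<in> Hom C (X i) (Cod C e)" using Comp_closed[OF \<iota> f] by blast
  ultimately have "e \<cdot> u = f"
    using univ[of "Cod C e" "\<lambda>i. f \<cdot> \<iota> i"] Hom_Cod[OF eH] Comp_closed[OF u(1) eH] f by blast
  then show "\<exists>g\<in>Hom C Q (Dom C e). e \<cdot> g = f" using u(1) by blast
qed

section \<open>Projectivity of representable presheaves\<close>

context linear_category
begin

lemma smult_Hom: "r \<in> carrier R \<Longrightarrow> f \<in> Hom C X Y \<Longrightarrow> sm r f \<in> Hom C X Y"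
proof -
  assume r: "r \<in> carrier R" and f: "f \<in> Hom C X Y"
  interpret M: module R "hom_module C sm X Y" using Hom_module f Hom_Dom Hom_Cod by blast
  show ?thesis using M.smult_closed r f by (simp add: hom_module_def)
qed

lemma linear_category_full_subcat:
  assumes S: "S \<subseteq> Obj C"
  shows "linear_category R (full_subcat C S) sm"
proof -
  have "hom_module (full_subcat C S) sm X Y = hom_module C sm X Y" if "X \<in> S" "Y \<in> S" for X Y
    using that by (auto simp: hom_module_def Hom_full_subcat full_subcat_simps)
  then have "linear_category_axioms R (full_subcat C S) sm"
    using S scalars Hom_module smult_Comp_left smult_Comp_right
    by (intro linear_category_axioms.intro) (auto simp: Hom_full_subcat full_subcat_simps subset_eq)
  then show ?thesis
    by (rule linear_category.intro[OF preadditive_category_full_subcat[OF S]])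
qed

end

section \<open>Opposite categories and quotient functors\<close>

lemma op_cat_simps:
  "Obj (op_cat C) = Obj C" "Arr (op_cat C) = Arr C" "Dom (op_cat C) = Cod C" "Cod (op_cat C) = Dom C"
  "Ident (op_cat C) = Ident C" "Comp (op_cat C) g f = f \<cdot>\<^bsub>C\<^esub> g" "Plus (op_cat C) = Plus C"
  "Null (op_cat C) X Y = Null C Y X" "Hom (op_cat C) X Y = Hom C Y X"
  by (auto simp: op_cat_def Hom_def)

lemma (in category) category_op: "category (op_cat C)"
  by unfold_locales
    (auto simp: op_cat_simps intro: Dom_closed Cod_closed Ident_closed Comp_closed Ident_left
      Ident_right Comp_assoc[symmetric])

lemma (in preadditive_category) preadditive_category_op: "preadditive_category (op_cat C)"
proof -
  have "hom_group (op_cat C) X Y = hom_group C Y X" for X Y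
    by (simp add: hom_group_def op_cat_simps)
  then have "preadditive_category_axioms (op_cat C)"
    using Hom_group Comp_Plus_left Comp_Plus_right
    by (intro preadditive_category_axioms.intro) (auto simp: op_cat_simps)
  then show ?thesis by (rule preadditive_category.intro[OF category_op])
qed

lemma (in linear_category) linear_category_op: "linear_category R (op_cat C) sm"
proof -
  have "hom_module (op_cat C) sm X Y = hom_module C sm Y X" for X Y
    by (simp add: hom_module_def op_cat_simps)
  then have "linear_category_axioms R (op_cat C) sm"
    using scalars Hom_module smult_Comp_left smult_Comp_right
    by (intro linear_category_axioms.intro) (auto simp: op_cat_simps)
  then show ?thesis by (rule linear_category.intro[OF preadditive_category_op])
qed

text \<open>Stability of \<open>K\<close> under the maps of \<open>G\<close> makes the pointwise
  quotients a functor again. The locale serves to divide a functor by the image of a natural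
  transformation; for presheaves \<open>C\<close> will be an opposite category.\<close>

locale module_subfunctor = linear_category R C sm
  for R :: "'r ring" and C :: "('o, 'm, 'x) acat_scheme" (structure) and sm :: "'r \<Rightarrow> 'm \<Rightarrow> 'm" +
  fixes G :: "('o, 'm, ('r, 'v) module, (('r, 'v) module, 'v \<Rightarrow> 'v) arrow) cfun" and K :: "'o \<Rightarrow> 'v set"
  assumes G: "G \<in> linear_functors R C sm (module_cat R) module_cat_smult"
    and K_submodule: "X \<in> Obj C \<Longrightarrow> submodule (K X) R (OMap G X)"
    and K_map: "f \<in> Hom C X Y \<Longrightarrow> x \<in> K X \<Longrightarrow> act (MMap G f) x \<in> K Y"
begin

abbreviation "Q X \<equiv> quotient_module (OMap G X) (K X)"

abbreviation "rep X \<equiv> coset_rep (OMap G X) (K X)"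

text \<open>Elements of the quotient are themselves elements of \<open>G\<close>, so
  \<open>G\<close> acts on them directly and the result is normalized by \<open>rep\<close>. Both
  components are restricted because \<open>linear_functors\<close> demands extensional maps.\<close>

definition quotient_functor ::
    "('o, 'm, ('r, 'v) module, (('r, 'v) module, 'v \<Rightarrow> 'v) arrow) cfun" where
  "quotient_functor =
     \<lparr>OMap = (\<lambda>X\<in>Obj C. Q X),
      MMap = (\<lambda>f\<in>Arr C. Arrow (Q (Dom C f)) (Q (Cod C f))
        (\<lambda>z\<in>carrier (Q (Dom C f)). rep (Cod C f) (act (MMap G f) z)))\<rparr>"

definition quotient_map where
  "quotient_map = (\<lambda>X\<in>Obj C. Arrow (OMap G X) (Q X) (\<lambda>x\<in>carrier (OMap G X). rep X x))"

lemma G_module: "X \<in> Obj C \<Longrightarrow> module R (OMap G X)"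
  using functor_Obj[OF linear_functorsD(1)[OF G]] by (auto simp: module_cat_simps)

lemma G_quot: "X \<in> Obj C \<Longrightarrow> module_with_submodule R (OMap G X) (K X)"
  by (simp add: module_with_submodule_def module_with_submodule_axioms_def G_module K_submodule)

lemmas rep_closed = module_with_submodule.coset_rep_props(1)[OF G_quot]
  and rep_idem = module_with_submodule.coset_rep_idem[OF G_quot]
  and rep_add_left = module_with_submodule.coset_rep_add_left[OF G_quot]
  and rep_add_right = module_with_submodule.coset_rep_add_right[OF G_quot]
  and rep_smult = module_with_submodule.coset_rep_smult[OF G_quot]
  and rep_add_K = module_with_submodule.coset_rep_add_K[OF G_quot]
  and Q_module = module_with_submodule.quotient_module[OF G_quot]

lemma G_map:
  assumes f: "f \<in> Hom C X Y"
  shows "MMap G f = Arrow (OMap G X) (OMap G Y) (act (MMap G f))"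
    and "act (MMap G f) \<in> module_homs R (OMap G X) (OMap G Y)"
    and "src (MMap G f) = OMap G X" "tgt (MMap G f) = OMap G Y"
  using functor_Hom[OF linear_functorsD(1)[OF G] f] by (auto simp: Hom_module_cat)

lemmas G_homs = module_homs_map[OF G_map(2)]

text \<open>\<open>x\<close> and its representative differ by an element of \<open>K X\<close>,
  which \<open>G\<close> sends into \<open>K Y\<close>; so the induced map does not depend on the
  representative.\<close>

lemma rep_map:
  assumes f: "f \<in> Hom C X Y" and x: "x \<in> carrier (OMap G X)"
  shows "rep Y (act (MMap G f) (rep X x)) = rep Y (act (MMap G f) x)"
proof -
  have X: "X \<in> Obj C" and Y: "Y \<in> Obj C" using f Hom_Dom Hom_Cod by auto
  interpret GX: module_with_submodule R "OMap G X" "K X" by (rule G_quot[OF X])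
  obtain k where k: "k \<in> K X" "rep X x = x \<oplus>\<^bsub>OMap G X\<^esub> k" using GX.coset_rep_props(2)[OF x] by blast
  then show ?thesis
    using G_homs(1,2)[OF f] x GX.K_carrier[OF k(1)] rep_add_K[OF Y _ K_map[OF f k(1)]] by simp
qed

lemma quotient_functor_obj: "X \<in> Obj C \<Longrightarrow> OMap quotient_functor X = Q X"
  by (simp add: quotient_functor_def)

lemma quotient_functor_map:
  assumes f: "f \<in> Hom C X Y"
  shows "MMap quotient_functor f =
    Arrow (Q X) (Q Y) (\<lambda>z\<in>carrier (Q X). rep Y (act (MMap G f) z))"
  using Hom_simps[OF f] by (simp add: quotient_functor_def)

lemma quotient_functor_linear:
  "quotient_functor \<in> linear_functors R C sm (module_cat R) module_cat_smult"
proof -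
  note GF = linear_functorsD[OF G]
  have 1: "OMap quotient_functor X \<in> Obj (module_cat R) \<and>
      MMap quotient_functor (Ident C X) = Ident (module_cat R) (OMap quotient_functor X)"
    if X: "X \<in> Obj C" for X
  proof -
    have "act (MMap G (Ident C X)) = (\<lambda>x\<in>carrier (OMap G X). x)"
      using functor_Ident[OF GF(1) X] by (simp add: module_cat_simps)
    then have "(\<lambda>z\<in>carrier (Q X). rep X (act (MMap G (Ident C X)) z)) = (\<lambda>x\<in>carrier (Q X). x)"
      using rep_closed[OF X] rep_idem[OF X] by (auto simp: quotient_module_simps intro!: restrict_ext)
    then show ?thesis
      using X Q_module[OF X] quotient_functor_map[OF Ident_closed[OF X]]
      by (simp add: module_cat_simps quotient_functor_def)
  qed
  have 2: "MMap quotient_functor f \<in> Hom (module_cat R) (OMap quotient_functor X) (OMap quotient_functor Y)"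
    if f: "f \<in> Hom C X Y" for f X Y
  proof -
    have X: "X \<in> Obj C" and Y: "Y \<in> Obj C" using f Hom_Dom Hom_Cod by auto
    interpret GX: module R "OMap G X" by (rule G_module[OF X])
    note h = G_homs[OF f]
    have "(\<lambda>z\<in>carrier (Q X). rep Y (act (MMap G f) z)) \<in> module_homs R (Q X) (Q Y)"
      unfolding module_homs_def
      by (auto simp: quotient_module_simps h(1-3) rep_map[OF f] rep_closed[OF X] rep_closed[OF Y]
          rep_add_left[OF X] rep_add_right[OF X] rep_smult[OF X]
          rep_add_left[OF Y] rep_add_right[OF Y] rep_smult[OF Y])
    then show ?thesis
      using X Y Q_module[OF X] Q_module[OF Y] quotient_functor_map[OF f]
      by (simp add: Hom_module_cat quotient_functor_def)
  qed
  have 3: "MMap quotient_functor (g \<cdot> f) = MMap quotient_functor g \<cdot>\<^bsub>module_cat R\<^esub> MMap quotient_functor f"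
    if f: "f \<in> Hom C X Y" and g: "g \<in> Hom C Y Z" for f g X Y Z
  proof -
    have X: "X \<in> Obj C" and Y: "Y \<in> Obj C" using f Hom_Dom Hom_Cod by auto
    have "act (MMap G (g \<cdot> f)) = compose (carrier (OMap G X)) (act (MMap G g)) (act (MMap G f))"
      by (simp add: functor_Comp[OF GF(1) f g] module_cat_simps G_map(3)[OF f])
    \<comment> \<open>\<open>rep_map\<close> removes the representatives on both sides, leaving
      functoriality of \<open>G\<close> at \<open>x\<close>.\<close>
    then have "rep Z (act (MMap G (g \<cdot> f)) (rep X x)) =
        rep Z (act (MMap G g) (rep Y (act (MMap G f) (rep X x))))" if "x \<in> carrier (OMap G X)" for x
      unfolding rep_map[OF f that] rep_map[OF Comp_closed[OF f g] that] rep_map[OF g G_homs(1)[OF f that]]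
      using that by (simp add: compose_def)
    then show ?thesis
      unfolding quotient_functor_map[OF f] quotient_functor_map[OF g] quotient_functor_map[OF Comp_closed[OF f g]]
      by (auto simp: module_cat_simps compose_def quotient_module_simps rep_closed[OF X] G_homs(1)[OF f]
          intro!: restrict_ext)
  qed
  have 4: "MMap quotient_functor (Plus C f g) =
      Plus (module_cat R) (MMap quotient_functor f) (MMap quotient_functor g)"
    if f: "f \<in> Hom C X Y" and g: "g \<in> Hom C X Y" for f g X Y
  proof -
    have X: "X \<in> Obj C" and Y: "Y \<in> Obj C" using f Hom_Dom Hom_Cod by auto
    have "MMap G (Plus C f g) = Arrow (OMap G X) (OMap G Y)
        (\<lambda>x\<in>carrier (OMap G X). act (MMap G f) x \<oplus>\<^bsub>OMap G Y\<^esub> act (MMap G g) x)"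
      by (simp add: GF(2)[OF f g] module_cat_simps G_map(3,4)[OF f])
    then show ?thesis
      unfolding quotient_functor_map[OF f] quotient_functor_map[OF g] quotient_functor_map[OF Plus_closed[OF f g]]
      by (auto simp: module_cat_simps quotient_module_simps rep_closed[OF X] rep_closed[OF Y]
          rep_add_left[OF Y] rep_add_right[OF Y] G_homs(1)[OF f] G_homs(1)[OF g] intro!: restrict_ext)
  qed
  have 5: "MMap quotient_functor (sm r f) = module_cat_smult r (MMap quotient_functor f)"
    if r: "r \<in> carrier R" and "f \<in> Arr C" for r f
  proof -
    let ?X = "Dom C f" and ?Y = "Cod C f"
    have f: "f \<in> Hom C ?X ?Y" using that Hom_self by blast
    then have X: "?X \<in> Obj C" and Y: "?Y \<in> Obj C" using Hom_Dom Hom_Cod by auto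
    have "MMap G (sm r f) = Arrow (OMap G ?X) (OMap G ?Y)
        (\<lambda>x\<in>carrier (OMap G ?X). r \<odot>\<^bsub>OMap G ?Y\<^esub> act (MMap G f) x)"
      by (simp add: GF(3)[OF that] module_cat_smult_def G_map(3,4)[OF f])
    then show ?thesis
      unfolding quotient_functor_map[OF f] quotient_functor_map[OF smult_Hom[OF r f]]
      by (auto simp: module_cat_smult_def quotient_module_simps rep_closed[OF X]
          rep_smult[OF Y r] G_homs(1)[OF f] intro!: restrict_ext)
  qed
  show ?thesis
    using 1 2 3 4 5
    unfolding linear_functors_def is_linear_functor_def is_additive_functor_def is_functor_def
    by (simp add: quotient_functor_def)
qed

text \<open>Evaluated at an element, the naturality square is \<open>rep_map\<close>.\<close>

lemma quotient_map_natural: "quotient_map \<in> nat_transformations C (module_cat R) G quotient_functor"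
proof -
  have 1: "quotient_map X \<in> Hom (module_cat R) (OMap G X) (OMap quotient_functor X)"
    if X: "X \<in> Obj C" for X
  proof -
    interpret GX: module R "OMap G X" by (rule G_module[OF X])
    have "(\<lambda>x\<in>carrier (OMap G X). rep X x) \<in> module_homs R (OMap G X) (Q X)"
      by (auto simp: module_homs_def quotient_module_simps rep_add_left[OF X] rep_add_right[OF X]
          rep_smult[OF X] rep_closed[OF X])
    then show ?thesis
      using X G_module[OF X] Q_module[OF X]
      by (simp add: quotient_map_def Hom_module_cat quotient_functor_def)
  qed
  have 2: "quotient_map Y \<cdot>\<^bsub>module_cat R\<^esub> MMap G f = MMap quotient_functor f \<cdot>\<^bsub>module_cat R\<^esub> quotient_map X"
    if f: "f \<in> Hom C X Y" for f X Y
  proof -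
    have X: "X \<in> Obj C" and Y: "Y \<in> Obj C" using f Hom_Dom Hom_Cod by auto
    show ?thesis
      apply (subst G_map(1)[OF f])
      using X Y unfolding quotient_functor_map[OF f]
      by (auto simp: module_cat_simps quotient_map_def compose_def quotient_module_simps
          G_homs(1)[OF f] rep_map[OF f] intro!: restrict_ext)
  qed
  show ?thesis using 1 2 by (simp add: nat_transformations_def quotient_map_def)
qed

end

text \<open>The quotient map of the target by the image agrees with zero on the image. Cosets are
  represented by elements of the target, so the quotient stays in the universe.\<close>

lemma (in linear_category) epi_linear_functor_surj:
  fixes F G :: "('o, 'm, ('r, 'v) module, (('r, 'v) module, 'v \<Rightarrow> 'v) arrow) cfun"
  defines "P \<equiv> linear_functor_cat R C sm (module_cat R) module_cat_smult"
  assumes epi: "is_epi P e" and e: "e \<in> Hom P F G" and N: "N \<in> Obj C" and y: "y \<in> carrier (OMap G N)"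
  shows "\<exists>x\<in>carrier (OMap F N). act (act e N) x = y"
proof -
  obtain \<eta> where \<eta>: "e = Arrow F G \<eta>" "F \<in> linear_functors R C sm (module_cat R) module_cat_smult"
      "G \<in> linear_functors R C sm (module_cat R) module_cat_smult"
      "\<eta> \<in> nat_transformations C (module_cat R) F G"
    using e unfolding P_def Hom_linear_functor_cat by blast
  note nt = nat_transformationD[OF \<eta>(4)]
  have \<eta>X: "\<eta> X = Arrow (OMap F X) (OMap G X) (act (\<eta> X)) \<and> module R (OMap F X) \<and> module R (OMap G X) \<and>
      act (\<eta> X) \<in> module_homs R (OMap F X) (OMap G X)" if "X \<in> Obj C" for X
    using nt(2)[OF that] by (auto simp: Hom_module_cat)
  define K where "K X = act (\<eta> X) ` carrier (OMap F X)" for X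
  \<comment> \<open>Naturality of \<open>\<eta>\<close> moves a preimage of \<open>x\<close> along
    \<open>F\<close>, so the pointwise images form a subfunctor of \<open>G\<close>.\<close>
  have Gf: "act (MMap G f) x \<in> K Y" if f: "f \<in> Hom C X Y" and x: "x \<in> K X" for f X Y x
  proof -
    have X: "X \<in> Obj C" using f Hom_Dom by auto
    obtain a where a: "a \<in> carrier (OMap F X)" "x = act (\<eta> X) a" using x K_def by blast
    obtain \<phi> where \<phi>: "MMap F f = Arrow (OMap F X) (OMap F Y) \<phi>" "\<phi> \<in> module_homs R (OMap F X) (OMap F Y)"
      using functor_Hom[OF linear_functorsD(1)[OF \<eta>(2)] f] by (auto simp: Hom_module_cat)
    have "act (\<eta> Y \<cdot>\<^bsub>module_cat R\<^esub> MMap F f) a = act (MMap G f \<cdot>\<^bsub>module_cat R\<^esub> \<eta> X) a"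
      using nt(3)[OF f] by simp
    moreover have "src (\<eta> X) = OMap F X" using \<eta>X[OF X] by (metis arrow.sel(1))
    ultimately have "act (\<eta> Y) (\<phi> a) = act (MMap G f) x"
      using a \<phi> by (simp add: module_cat_simps compose_def)
    then show ?thesis using module_homs_map(1)[OF \<phi>(2) a(1)] unfolding K_def by (metis image_eqI)
  qed
  have "submodule (K X) R (OMap G X)" if "X \<in> Obj C" for X
    unfolding K_def using \<eta>X[OF that] by (intro submodule_image) blast+
  then have "module_subfunctor R C sm G K"
    using \<eta>(3) Gf
    by (intro module_subfunctor.intro module_subfunctor_axioms.intro linear_category_axioms)
  then interpret Q: module_subfunctor R C sm G K .
  define q where "q = Arrow G Q.quotient_functor Q.quotient_map"
  \<comment> \<open>The zero arrow to the quotient, to be compared with \<open>q\<close>; its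
    naturality rests on the maps of the quotient functor preserving zero.\<close>
  define z where "z = Arrow G Q.quotient_functor
    (\<lambda>X\<in>Obj C. Arrow (OMap G X) (Q.Q X) (\<lambda>x\<in>carrier (OMap G X). \<zero>\<^bsub>Q.Q X\<^esub>))"
  have q: "q \<in> Hom P G Q.quotient_functor"
    using \<eta>(3) Q.quotient_functor_linear Q.quotient_map_natural
    by (simp add: q_def P_def Hom_linear_functor_cat)
  have "(\<lambda>X\<in>Obj C. Arrow (OMap G X) (Q.Q X) (\<lambda>x\<in>carrier (OMap G X). \<zero>\<^bsub>Q.Q X\<^esub>)) \<in>
      nat_transformations C (module_cat R) G Q.quotient_functor"
  proof -
    have 1: "Arrow (OMap G X) (Q.Q X) (\<lambda>x\<in>carrier (OMap G X). \<zero>\<^bsub>Q.Q X\<^esub>) \<in>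
        Hom (module_cat R) (OMap G X) (OMap Q.quotient_functor X)" if X: "X \<in> Obj C" for X
    proof -
      interpret GX: module R "OMap G X" by (rule Q.G_module[OF X])
      interpret QX: module R "Q.Q X" by (rule Q.Q_module[OF X])
      have "r \<odot>\<^bsub>Q.Q X\<^esub> \<zero>\<^bsub>Q.Q X\<^esub> = \<zero>\<^bsub>Q.Q X\<^esub>" if "r \<in> carrier R" for r
        using QX.smult_r_null[OF that] .
      then have "(\<lambda>x\<in>carrier (OMap G X). \<zero>\<^bsub>Q.Q X\<^esub>) \<in> module_homs R (OMap G X) (Q.Q X)"
        by (auto simp: module_homs_def)
      then show ?thesis using X Q.G_module[OF X] Q.Q_module[OF X]
        by (simp add: Hom_module_cat Q.quotient_functor_def)
    qed
    have 2: "Arrow (OMap G Y) (Q.Q Y) (\<lambda>x\<in>carrier (OMap G Y). \<zero>\<^bsub>Q.Q Y\<^esub>) \<cdot>\<^bsub>module_cat R\<^esub> MMap G f =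
        MMap Q.quotient_functor f \<cdot>\<^bsub>module_cat R\<^esub>
          Arrow (OMap G X) (Q.Q X) (\<lambda>x\<in>carrier (OMap G X). \<zero>\<^bsub>Q.Q X\<^esub>)"
      if f: "f \<in> Hom C X Y" for f X Y
    proof -
      have X: "X \<in> Obj C" and Y: "Y \<in> Obj C" using f Hom_Dom Hom_Cod by auto
      interpret QX: module R "Q.Q X" by (rule Q.Q_module[OF X])
      have "act (MMap Q.quotient_functor f) \<zero>\<^bsub>Q.Q X\<^esub> = \<zero>\<^bsub>Q.Q Y\<^esub>"
        using functor_Hom[OF linear_functorsD(1)[OF Q.quotient_functor_linear] f] X Y
          module_homs_zero[OF Q.Q_module[OF X] Q.Q_module[OF Y]]
        by (auto simp: Hom_module_cat Q.quotient_functor_obj)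
      then show ?thesis
        apply (subst Q.G_map(1)[OF f])
        using Q.G_homs(1)[OF f]
        by (auto simp: module_cat_simps compose_def Q.quotient_functor_map[OF f] intro!: restrict_ext)
    qed
    show ?thesis using 1 2 Hom_Dom Hom_Cod by (auto simp: nat_transformations_def)
  qed
  then have z: "z \<in> Hom P G Q.quotient_functor"
    using \<eta>(3) Q.quotient_functor_linear by (simp add: z_def P_def Hom_linear_functor_cat)
  \<comment> \<open>The values of \<open>\<eta> X\<close> lie in \<open>K X\<close> and so have the
    representative of zero. The epimorphism \<open>e\<close> therefore cannot distinguish
    \<open>q\<close> from \<open>z\<close>.\<close>
  have "Q.quotient_map X \<cdot>\<^bsub>module_cat R\<^esub> \<eta> X =
      Arrow (OMap G X) (Q.Q X) (\<lambda>x\<in>carrier (OMap G X). \<zero>\<^bsub>Q.Q X\<^esub>) \<cdot>\<^bsub>module_cat R\<^esub> \<eta> X"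
    if X: "X \<in> Obj C" for X
  proof -
    have "src (\<eta> X) = OMap F X" using \<eta>X[OF X] by (metis arrow.sel(1))
    moreover have "Q.rep X (act (\<eta> X) a) = Q.rep X \<zero>\<^bsub>OMap G X\<^esub>" if "a \<in> carrier (OMap F X)" for a
      using module_with_submodule.coset_rep_zero[OF Q.G_quot[OF X]] that by (simp add: K_def)
    ultimately show ?thesis
      using X module_homs_map(1)[of "act (\<eta> X)" R "OMap F X" "OMap G X"] \<eta>X[OF X]
      by (auto simp: Q.quotient_map_def module_cat_simps compose_def quotient_module_simps intro!: restrict_ext)
  qed
  then have "q \<cdot>\<^bsub>P\<^esub> e = z \<cdot>\<^bsub>P\<^esub> e"
    by (auto simp: q_def z_def P_def \<eta>(1) linear_functor_cat_simps intro!: restrict_ext)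
  then have "q = z" using epi q z Hom_simps[OF e] unfolding is_epi_def by auto
  then have "Q.quotient_map N = Arrow (OMap G N) (Q.Q N) (\<lambda>x\<in>carrier (OMap G N). \<zero>\<^bsub>Q.Q N\<^esub>)"
    using N by (auto simp: q_def z_def)
  then have "(\<lambda>x\<in>carrier (OMap G N). Q.rep N x) = (\<lambda>x\<in>carrier (OMap G N). \<zero>\<^bsub>Q.Q N\<^esub>)"
    using N by (simp add: Q.quotient_map_def)
  from fun_cong[OF this, of y] have "Q.rep N y = Q.rep N \<zero>\<^bsub>OMap G N\<^esub>"
    using y by (simp add: quotient_module_simps)
  then have "y \<in> K N"
    using module_with_submodule.coset_rep_eq_zero[OF Q.G_quot[OF N] y] by simp
  then show ?thesis by (auto simp: K_def \<eta>(1))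
qed

text \<open>By the Yoneda lemma an arrow from \<open>B(-, N)\<close> to \<open>G\<close> is an element of \<open>G(N)\<close>, which lifts along
  an epimorphism onto \<open>G\<close>.\<close>

lemma (in linear_category) yoneda_projective:
  fixes enc :: "'m \<Rightarrow> 'v"
  assumes S: "S \<subseteq> Obj C" and N: "N \<in> S"
    and enc: "\<And>L. L \<in> S \<Longrightarrow> inj_on enc (Hom C L N)"
    and yo: "yoneda_obj C sm enc S N \<in> Obj (presheaf_cat R C sm S)"
  shows "is_projective (presheaf_cat R C sm S) (yoneda_obj C sm enc S N)"
proof -
  let ?P = "presheaf_cat R C sm S" and ?D = "op_cat (full_subcat C S)" and ?M = "module_cat R"
    and ?y = "yoneda_obj C sm enc S N"
  let ?Y = "\<lambda>L. yoneda_module C sm enc L N"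
  interpret D: linear_category R ?D sm
    using linear_category.linear_category_op[OF linear_category_full_subcat[OF S]] .
  have DH: "f \<in> Hom ?D X Y \<longleftrightarrow> f \<in> Hom C Y X \<and> X \<in> S \<and> Y \<in> S" for f X Y
    by (auto simp: op_cat_simps Hom_full_subcat)
  have DO: "Obj ?D = S" by (simp add: op_cat_simps full_subcat_simps)
  have yoF: "?y \<in> linear_functors R ?D sm ?M module_cat_smult"
    using yo by (simp add: presheaf_cat_def linear_functor_cat_simps)
  have dec: "inv_into (Hom C L N) enc (enc u) = u" if "L \<in> S" "u \<in> Hom C L N" for L u
    using inv_into_f_f[OF enc[OF that(1)] that(2)] .
  have Yc: "carrier (?Y L) = enc ` Hom C L N" for L by (simp add: yoneda_module_def Let_def)
  have Yadd: "enc u \<oplus>\<^bsub>?Y L\<^esub> enc v = enc (Plus C u v)" if "L \<in> S" "u \<in> Hom C L N" "v \<in> Hom C L N" for L u v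
    using dec that by (simp add: yoneda_module_def Let_def)
  have Ysm: "r \<odot>\<^bsub>?Y L\<^esub> enc u = enc (sm r u)" if "L \<in> S" "u \<in> Hom C L N" for L u r
    using dec that by (simp add: yoneda_module_def Let_def)
  have yO: "OMap ?y L = ?Y L" if "L \<in> S" for L using that by (simp add: yoneda_obj_def)
  have yM: "MMap ?y f = Arrow (?Y L) (?Y L') (\<lambda>x\<in>enc ` Hom C L N. enc (inv_into (Hom C L N) enc x \<cdot> f))"
    if "f \<in> Hom ?D L L'" for f L L'
    using that unfolding DH
    by (auto simp: yoneda_obj_def Arr_full_subcat full_subcat_simps dest: Hom_simps)
  have Ymod: "module R (?Y L)" if "L \<in> S" for L
    using functor_Obj[OF linear_functorsD(1)[OF yoF], of L] yO[OF that] that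
    by (simp add: DO module_cat_simps)
  show ?thesis
    unfolding is_projective_def
  proof (intro conjI yo allI impI ballI)
    fix e \<eta> assume epi: "is_epi ?P e" and \<eta>: "\<eta> \<in> Hom ?P ?y (Cod ?P e)"
    define F where "F = Dom ?P e"
    define G where "G = Cod ?P e"
    have e: "e \<in> Hom ?P F G" using epi by (simp add: is_epi_def F_def G_def Hom_def)
    obtain \<epsilon> where \<epsilon>: "e = Arrow F G \<epsilon>" "F \<in> linear_functors R ?D sm ?M module_cat_smult"
        "G \<in> linear_functors R ?D sm ?M module_cat_smult" "\<epsilon> \<in> nat_transformations ?D ?M F G"
      using e unfolding presheaf_cat_def Hom_linear_functor_cat by blast
    obtain \<theta> where \<theta>: "\<eta> = Arrow ?y G \<theta>" "\<theta> \<in> nat_transformations ?D ?M ?y G"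
      using \<eta> unfolding presheaf_cat_def Hom_linear_functor_cat G_def by blast
    note \<epsilon>n = nat_transformationD[OF \<epsilon>(4)] and \<theta>n = nat_transformationD[OF \<theta>(2)]
    note FF = linear_functorsD[OF \<epsilon>(2)] and GF = linear_functorsD[OF \<epsilon>(3)]
    have idN: "Ident C N \<in> Hom C N N" using Ident_closed S N by blast
    have arr: "\<psi> = Arrow M' N' (act \<psi>) \<and> module R M' \<and> module R N' \<and> act \<psi> \<in> module_homs R M' N'"
      if "\<psi> \<in> Hom ?M M' N'" for \<psi> M' N' using that by (auto simp: Hom_module_cat)
    have \<theta>L: "\<theta> L \<in> Hom ?M (?Y L) (OMap G L)" if "L \<in> S" for L using \<theta>n(2)[of L] that by (simp add: DO yO)
    have \<epsilon>L: "\<epsilon> L \<in> Hom ?M (OMap F L) (OMap G L)" if "L \<in> S" for L using \<epsilon>n(2)[of L] that by (simp add: DO)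
    have Comp_act: "act (\<psi> \<cdot>\<^bsub>?M\<^esub> \<phi>) x = act \<psi> (act \<phi> x)" if "\<phi> \<in> Hom ?M M' N'" "x \<in> carrier M'"
      for \<psi> \<phi> M' N' and x
      using that by (auto simp: Hom_module_cat module_cat_simps compose_def)
    \<comment> \<open>The Yoneda element of \<open>\<theta>\<close> is its value at the identity of
      \<open>N\<close>; \<open>x0\<close> is a preimage of it under
      \<open>\<epsilon> N\<close>.\<close>
    have "act (\<theta> N) (enc (Ident C N)) \<in> carrier (OMap G N)"
      using arr[OF \<theta>L[OF N]] idN module_homs_map(1)[of "act (\<theta> N)" R "?Y N" "OMap G N"] by (simp add: Yc)
    then obtain x0 where x0: "x0 \<in> carrier (OMap F N)" "act (\<epsilon> N) x0 = act (\<theta> N) (enc (Ident C N))"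
      using D.epi_linear_functor_surj[of e F G N] epi e N \<epsilon>(1) unfolding presheaf_cat_def by (auto simp: DO)
    have FH: "MMap F u \<in> Hom ?M (OMap F L) (OMap F L')" if "u \<in> Hom ?D L L'" for u L L'
      by (rule functor_Hom[OF FF(1) that])
    \<comment> \<open>An arrow of \<open>C\<close> from \<open>L\<close> to \<open>N\<close> points
      from \<open>N\<close> to \<open>L\<close> in \<open>?D\<close>, so \<open>F\<close> carries
      \<open>x0\<close> to an element over \<open>L\<close>.\<close>
    have Fx0: "act (MMap F u) x0 \<in> carrier (OMap F L)" if "u \<in> Hom ?D N L" for u L
      using arr[OF FH[OF that]] x0(1) module_homs_map(1)[of "act (MMap F u)" R "OMap F N" "OMap F L"] by simp
    \<comment> \<open>The transformation that Yoneda attaches to \<open>x0\<close>: it sends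
      \<open>u\<close> to \<open>F(u)\<close> applied to \<open>x0\<close>, with \<open>u\<close>
      recovered from its code.\<close>
    define \<gamma> where "\<gamma> = (\<lambda>L\<in>S. Arrow (?Y L) (OMap F L)
      (\<lambda>z\<in>enc ` Hom C L N. act (MMap F (inv_into (Hom C L N) enc z)) x0))"
    have \<gamma>_act: "act (\<gamma> L) (enc u) = act (MMap F u) x0" if "L \<in> S" "u \<in> Hom C L N" for L u
      using that by (simp add: \<gamma>_def dec)
    have \<gamma>L: "\<gamma> L \<in> Hom ?M (?Y L) (OMap F L)" if L: "L \<in> S" for L
    proof -
      have FLm: "module R (OMap F L)" using functor_Obj[OF FF(1), of L] L by (simp add: DO module_cat_simps)
      have "act (\<gamma> L) \<in> module_homs R (?Y L) (OMap F L)"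
        unfolding module_homs_def
      proof (intro CollectI conjI ballI)
        show "act (\<gamma> L) \<in> carrier (?Y L) \<rightarrow>\<^sub>E carrier (OMap F L)"
          using L N Fx0 by (auto simp: \<gamma>_def Yc dec DH)
        fix x y assume "x \<in> carrier (?Y L)" "y \<in> carrier (?Y L)"
        then obtain u v where uv: "u \<in> Hom C L N" "x = enc u" "v \<in> Hom C L N" "y = enc v"
          by (auto simp: Yc)
        then have uD: "u \<in> Hom ?D N L" and vD: "v \<in> Hom ?D N L" using L N by (auto simp: DH)
        have "MMap F (Plus C u v) = Plus ?M (MMap F u) (MMap F v)"
          using FF(2)[OF uD vD] by (simp add: op_cat_simps full_subcat_simps)
        then have "act (MMap F (Plus C u v)) x0 = act (MMap F u) x0 \<oplus>\<^bsub>OMap F L\<^esub> act (MMap F v) x0"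
          using FH[OF uD] x0(1) by (auto simp: module_cat_simps Hom_module_cat)
        then show "act (\<gamma> L) (x \<oplus>\<^bsub>?Y L\<^esub> y) = act (\<gamma> L) x \<oplus>\<^bsub>OMap F L\<^esub> act (\<gamma> L) y"
          using uv L by (simp add: Yadd \<gamma>_act Plus_closed)
      next
        fix r x assume r: "r \<in> carrier R" and "x \<in> carrier (?Y L)"
        then obtain u where u: "u \<in> Hom C L N" "x = enc u" by (auto simp: Yc)
        then have uD: "u \<in> Hom ?D N L" using L N by (auto simp: DH)
        have "MMap F (sm r u) = module_cat_smult r (MMap F u)"
          using FF(3)[OF r] Hom_simps[OF uD] by blast
        then have "act (MMap F (sm r u)) x0 = r \<odot>\<^bsub>OMap F L\<^esub> act (MMap F u) x0"
          using FH[OF uD] x0(1) by (auto simp: module_cat_smult_def Hom_module_cat)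
        then show "act (\<gamma> L) (r \<odot>\<^bsub>?Y L\<^esub> x) = r \<odot>\<^bsub>OMap F L\<^esub> act (\<gamma> L) x"
          using u L r by (simp add: Ysm \<gamma>_act smult_Hom)
      qed
      then show ?thesis using L Ymod[OF L] FLm by (auto simp: Hom_module_cat \<gamma>_def)
    qed
    have hom_eq: "\<phi> = \<psi>" if "\<phi> \<in> Hom ?M (?Y L) N'" "\<psi> \<in> Hom ?M (?Y L) N'"
        "\<And>u. u \<in> Hom C L N \<Longrightarrow> act \<phi> (enc u) = act \<psi> (enc u)" for \<phi> \<psi> L N'
    proof -
      have "act \<phi> \<in> extensional (carrier (?Y L))" "act \<psi> \<in> extensional (carrier (?Y L))"
        using arr[OF that(1)] arr[OF that(2)] module_homs_map(4)[of _ R "?Y L" N'] by blast+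
      then have "act \<phi> = act \<psi>"
        by (rule extensionalityI) (use that(3) in \<open>auto simp: Yc\<close>)
      then show ?thesis using arr[OF that(1)] arr[OF that(2)] by metis
    qed
    interpret M: category ?M by (rule category_module_cat)
    have \<gamma>nat: "\<gamma> L' \<cdot>\<^bsub>?M\<^esub> MMap ?y f = MMap F f \<cdot>\<^bsub>?M\<^esub> \<gamma> L" if f: "f \<in> Hom ?D L L'" for f L L'
    proof -
      have L: "L \<in> S" and L': "L' \<in> S" and fC: "f \<in> Hom C L' L" using f by (auto simp: DH)
      have yf: "MMap ?y f \<in> Hom ?M (?Y L) (?Y L')"
        using functor_Hom[OF linear_functorsD(1)[OF yoF] f] yO L L' by simp
      show ?thesis
      proof (rule hom_eq[OF M.Comp_closed[OF yf \<gamma>L[OF L']] M.Comp_closed[OF \<gamma>L[OF L] FH[OF f]]])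
        fix u assume u: "u \<in> Hom C L N"
        then have uc: "enc u \<in> carrier (?Y L)" by (simp add: Yc)
        have uD: "u \<in> Hom ?D N L" using u L N by (simp add: DH)
        have "act (MMap ?y f) (enc u) = enc (u \<cdot> f)" using yM[OF f] u dec[OF L u] by simp
        then have "act (\<gamma> L' \<cdot>\<^bsub>?M\<^esub> MMap ?y f) (enc u) = act (MMap F (u \<cdot> f)) x0"
          using Comp_act[OF yf uc] \<gamma>_act[OF L' Comp_closed[OF fC u]] by simp
        also have "MMap F (u \<cdot> f) = MMap F f \<cdot>\<^bsub>?M\<^esub> MMap F u"
          using functor_Comp[OF FF(1) uD f] by (simp add: op_cat_simps full_subcat_simps)
        also have "act \<dots> x0 = act (MMap F f) (act (\<gamma> L) (enc u))"
          using Comp_act[OF FH[OF uD] x0(1)] \<gamma>_act[OF L u] by simp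
        also have "\<dots> = act (MMap F f \<cdot>\<^bsub>?M\<^esub> \<gamma> L) (enc u)" using Comp_act[OF \<gamma>L[OF L] uc] by simp
        finally show "act (\<gamma> L' \<cdot>\<^bsub>?M\<^esub> MMap ?y f) (enc u) = act (MMap F f \<cdot>\<^bsub>?M\<^esub> \<gamma> L) (enc u)" .
      qed
    qed
    have "\<gamma> \<in> nat_transformations ?D ?M ?y F"
      using \<gamma>L \<gamma>nat by (auto simp: nat_transformations_def DO yO) (simp add: \<gamma>_def)
    then have g: "Arrow ?y F \<gamma> \<in> Hom ?P ?y F"
      using \<epsilon>(2) yoF by (simp add: presheaf_cat_def Hom_linear_functor_cat)
    \<comment> \<open>At \<open>enc u\<close> both sides equal \<open>G(u)\<close> applied to the
      Yoneda element, by naturality of \<open>\<epsilon>\<close> on one side and of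
      \<open>\<theta>\<close> on the other.\<close>
    have "\<epsilon> L \<cdot>\<^bsub>?M\<^esub> \<gamma> L = \<theta> L" if L: "L \<in> S" for L
    proof (rule hom_eq[OF M.Comp_closed[OF \<gamma>L[OF L] \<epsilon>L[OF L]] \<theta>L[OF L]])
      fix u assume u: "u \<in> Hom C L N"
      then have uc: "enc u \<in> carrier (?Y L)" by (simp add: Yc)
      have uD: "u \<in> Hom ?D N L" using u L N by (simp add: DH)
      have idc: "enc (Ident C N) \<in> carrier (?Y N)" using idN by (simp add: Yc)
      have yu: "MMap ?y u \<in> Hom ?M (?Y N) (?Y L)"
        using functor_Hom[OF linear_functorsD(1)[OF yoF] uD] yO L N by simp
      have yid: "act (MMap ?y u) (enc (Ident C N)) = enc u"
        using yM[OF uD] idN dec[OF N idN] Ident_left[OF u] by simp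
      have "act (\<epsilon> L \<cdot>\<^bsub>?M\<^esub> \<gamma> L) (enc u) = act (\<epsilon> L) (act (MMap F u) x0)"
        using Comp_act[OF \<gamma>L[OF L] uc] \<gamma>_act[OF L u] by simp
      also have "\<dots> = act (\<epsilon> L \<cdot>\<^bsub>?M\<^esub> MMap F u) x0" using Comp_act[OF FH[OF uD] x0(1)] by simp
      also have "\<dots> = act (MMap G u \<cdot>\<^bsub>?M\<^esub> \<epsilon> N) x0" using \<epsilon>n(3)[OF uD] by simp
      also have "\<dots> = act (MMap G u) (act (\<theta> N) (enc (Ident C N)))"
        using Comp_act[OF \<epsilon>L[OF N] x0(1)] x0(2) by simp
      also have "\<dots> = act (MMap G u \<cdot>\<^bsub>?M\<^esub> \<theta> N) (enc (Ident C N))"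
        using Comp_act[OF \<theta>L[OF N] idc] by simp
      also have "\<dots> = act (\<theta> L \<cdot>\<^bsub>?M\<^esub> MMap ?y u) (enc (Ident C N))" using \<theta>n(3)[OF uD] by simp
      also have "\<dots> = act (\<theta> L) (enc u)" using Comp_act[OF yu idc] yid by simp
      finally show "act (\<epsilon> L \<cdot>\<^bsub>?M\<^esub> \<gamma> L) (enc u) = act (\<theta> L) (enc u)" .
    qed
    then have "e \<cdot>\<^bsub>?P\<^esub> Arrow ?y F \<gamma> = \<eta>"
      using \<theta>n(1)
      by (auto simp: presheaf_cat_def linear_functor_cat_simps \<epsilon>(1) \<theta>(1) DO intro!: extensionalityI[of _ S])
    then show "\<exists>g\<in>Hom ?P ?y (Dom ?P e). e \<cdot>\<^bsub>?P\<^esub> g = \<eta>" using g by (auto simp: F_def)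
  qed
qed

lemma (in linear_category) yoneda_has_projective_image:
  fixes enc :: "'m \<Rightarrow> 'v"
  assumes S: "S \<subseteq> Obj C" and enc: "\<forall>N\<in>S. \<forall>M\<in>Obj C. inj_on enc (Hom C N M)"
    and hull: "OMap (yoneda C sm enc S) ` Obj C
      \<subseteq> Obj (coproductive_hull TYPE('v) (presheaf_cat R C sm S) (OMap (yoneda C sm enc S) ` S))"
  shows "has_projective_image C (presheaf_cat R C sm S) (yoneda C sm enc S)"
  unfolding has_projective_image_def
proof
  let ?P = "presheaf_cat R C sm S"
  interpret D: linear_category R "op_cat (full_subcat C S)" sm
    using linear_category.linear_category_op[OF linear_category_full_subcat[OF S]] .
  have "category ?P" unfolding presheaf_cat_def
    by (rule category_linear_functor_cat[OF D.category_axioms category_module_cat])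
  then interpret P: category ?P .
  have yO: "OMap (yoneda C sm enc S) = yoneda_obj C sm enc S" by (simp add: yoneda_def)
  have hull': "\<exists>(I :: 'v set) X Q \<iota>. X ` I \<subseteq> yoneda_obj C sm enc S ` S \<and> is_coproduct ?P I X Q \<iota> \<and>
      is_retract_of ?P (yoneda_obj C sm enc S M) Q" if "M \<in> Obj C" for M
    using hull that by (auto simp: coproductive_hull_def full_subcat_simps yO)
  have proj: "is_projective ?P (yoneda_obj C sm enc S N)" if N: "N \<in> S" for N
  proof (rule yoneda_projective[OF S N])
    show "inj_on enc (Hom C L N)" if "L \<in> S" for L using enc S N that by blast
    \<comment> \<open>That representables are genuine presheaves is read off from the hull
      hypothesis, since \<open>is_retract_of\<close> includes membership in the objects.\<close>
    show "yoneda_obj C sm enc S N \<in> Obj ?P"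
      using hull'[of N] N S by (auto simp: is_retract_of_def)
  qed
  fix M assume M: "M \<in> Obj C"
  obtain I :: "'v set" and X Q \<iota> where Q: "X ` I \<subseteq> yoneda_obj C sm enc S ` S" "is_coproduct ?P I X Q \<iota>"
      "is_retract_of ?P (yoneda_obj C sm enc S M) Q"
    using hull'[OF M] by (elim exE conjE) (rule that)
  have "is_projective ?P Q"
  proof (rule P.projective_coproduct[OF Q(2)])
    fix i assume "i \<in> I"
    then have "X i \<in> yoneda_obj C sm enc S ` S" by (rule subsetD[OF Q(1) imageI])
    then show "is_projective ?P (X i)" by (elim imageE) (simp add: proj)
  qed
  then show "is_projective ?P (OMap (yoneda C sm enc S) M)"
    using P.projective_retract Q(3) by (simp add: yO)
qed

text \<open>The map \<open>enc\<close> expresses smallness of the hom-sets out of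
  \<open>\<H>\<close>: it lets the Yoneda functor take values in modules whose elements have type
  \<open>'v\<close>.\<close>

theorem proposition2p2p3:
  fixes C :: "('o, 'm) tcat"
    and W :: "'o weights"
    and \<A> :: "('p, 'n) acat"
    and A :: "('o, 'm, 'p, 'n) cfun"
    and R :: "'r ring"
    and sm :: "'r \<Rightarrow> 'm \<Rightarrow> 'm"
    and \<H> :: "'o set"
    and enc :: "'m \<Rightarrow> 'v"
  assumes "triangulated_category C" and "weight_structure C W"
  shows "(abelian_category \<A> \<and> is_additive_functor (heart C W) \<A> A \<and>
            has_projective_image (heart C W) \<A> A \<and>
            preserves_non_split_surjectivity (heart C W) \<A> A \<longrightarrow>
          (\<forall>M\<in>Obj C. \<forall>n :: int.
             (w_bounded_below C W M \<and>
              (\<forall>i<n. is_zero_object \<A> (shifted_homology C (weight_homology C W \<A> A) i M)))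
             \<longleftrightarrow> M \<in> w_ge C W n)) \<and>
         (linear_category R (heart C W) sm \<and>
            \<H> \<subseteq> Obj (heart C W) \<and> small TYPE('v) \<H> \<and>
            (\<forall>N\<in>\<H>. \<forall>M\<in>Obj (heart C W). inj_on enc (Hom (heart C W) N M)) \<and>
            OMap (yoneda (heart C W) sm enc \<H>) ` Obj (heart C W)
              \<subseteq> Obj (coproductive_hull TYPE('v) (presheaf_cat R (heart C W) sm \<H>)
                       (OMap (yoneda (heart C W) sm enc \<H>) ` \<H>)) \<longrightarrow>
          has_projective_image (heart C W) (presheaf_cat R (heart C W) sm \<H>)
            (yoneda (heart C W) sm enc \<H>)) \<and>
         (abelian_category \<A> \<and> is_additive_functor (heart C W) \<A> A \<and>
            is_full (heart C W) \<A> A \<and> is_conservative (heart C W) \<A> A \<longrightarrow>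
          preserves_non_split_surjectivity (heart C W) \<A> A)"
proof (intro conjI impI; (elim conjE)?)
  interpret weight_structure C W by fact
  assume "abelian_category \<A>" "is_additive_functor (heart C W) \<A> A"
    "has_projective_image (heart C W) \<A> A" "preserves_non_split_surjectivity (heart C W) \<A> A"
  then show "\<forall>M\<in>Obj C. \<forall>n :: int.
      (w_bounded_below C W M \<and>
        (\<forall>i<n. is_zero_object \<A> (shifted_homology C (weight_homology C W \<A> A) i M)))
      \<longleftrightarrow> M \<in> w_ge C W n"
    using bounded_below_homology_vanishing_iff by blast
next
  assume "linear_category R (heart C W) sm" "\<H> \<subseteq> Obj (heart C W)"
    "\<forall>N\<in>\<H>. \<forall>M\<in>Obj (heart C W). inj_on enc (Hom (heart C W) N M)"
    "OMap (yoneda (heart C W) sm enc \<H>) ` Obj (heart C W)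
      \<subseteq> Obj (coproductive_hull TYPE('v) (presheaf_cat R (heart C W) sm \<H>)
               (OMap (yoneda (heart C W) sm enc \<H>) ` \<H>))"
  then show "has_projective_image (heart C W) (presheaf_cat R (heart C W) sm \<H>)
      (yoneda (heart C W) sm enc \<H>)"
    by (rule linear_category.yoneda_has_projective_image)
next
  interpret weight_structure C W by fact
  assume "abelian_category \<A>" and F: "is_additive_functor (heart C W) \<A> A"
    and full: "is_full (heart C W) \<A> A" and cons: "is_conservative (heart C W) \<A> A"
  then interpret A: abelian_category \<A> by simp
  interpret H: preadditive_category "heart C W" by (rule preadditive_category_heart)
  show "preserves_non_split_surjectivity (heart C W) \<A> A"
    using full_conservative_preserves_non_split_surjectivity[OF H.category_axioms A.category_axioms _ full cons] F
    by (simp add: is_additive_functor_def)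
qed

end
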